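(* Let $d\ge2$, let $A\in\mathbb{R}^{d\times d}$ be non-singular, $\Sigma=AA^\top$, $\boldsymbol X(t)=A\boldsymbol B(t)$ with $\boldsymbol B$ a standard $d$-dimensional Brownian motion with independent coordinates and $\boldsymbol B(0)=\boldsymbol0$. Let $\boldsymbol\alpha,\boldsymbol\mu\in\mathbb{R}^d$ satisfy $\Sigma^{-1}\boldsymbol\alpha>\boldsymbol0$ and $\Sigma^{-1}\boldsymbol\mu>\boldsymbol0$, and suppose that for some $i$ both $\alpha_i>0$ and $\mu_i>0$. For $u>0$ let $$P(u)=\mathbb{P}\{\exists_{t\ge0}:\boldsymbol X(t)-\boldsymbol\mu t>\boldsymbol\alpha u\},\qquad\tau_u=\inf\{t\ge0:\boldsymbol X(t)-\boldsymbol\mu t>\boldsymbol\alpha u\},$$ and put $$t_0=\sqrt{\frac{\boldsymbol\alpha^\top\Sigma^{-1}\boldsymbol\alpha}{\boldsymbol\mu^\top\Sigma^{-1}\boldsymbol\mu}},\qquad\boldsymbol b=\boldsymbol\alpha+t_0\boldsymbol\mu,$$ $$\mathcal H_{\{1,\dots,d\}}=\lim_{T\to\infty}\frac1T\int_{\mathbb{R}^d}e^{\frac1{t_0}\boldsymbol x^\top\Sigma^{-1}\boldsymbol b}\,\mathbb{P}\{\exists_{t\in[0,T]}:\boldsymbol X(t)-\boldsymbol\mu t>\boldsymbol x\}\,d\boldsymbol x.$$ Then, as $u\to\infty$, $$P(u)\sim\frac{(2\pi)^{(1-d)/2}\,\mathcal H_{\{1,\dots,d\}}}{\sqrt{t_0^{d-3}(\boldsymbol\alpha^\top\Sigma^{-1}\boldsymbol\alpha)|\Sigma|}}\,u^{\frac{1-d}{2}}e^{-\frac{\boldsymbol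 b^\top\Sigma^{-1}\boldsymbol b}{2t_0}u},$$ and for every $s\in\mathbb{R}$ $$\lim_{u\to\infty}\mathbb{P}\left\{\frac{\tau_u-t_0u}{\sqrt{t_0^3(\boldsymbol\alpha^\top\Sigma^{-1}\boldsymbol\alpha)^{-1}u}}\le s\ \Big|\ \tau_u<\infty\right\}=\Phi(s).$$
   Context: Vector inequalities are componentwise; $|\Sigma|$ is the determinant; $f\sim h$ means $f/h\to1$; $\Phi$ is the standard normal distribution function; $\inf\emptyset=\infty$. *)

theory Defs
  imports "HOL-Probability.Probability"
begin

text \<open>Strict componentwise order. The library's \<open><\<close> on \<^typ>\<open>real^'n\<close> is weaker: there
  \<open>x < y\<close> means \<open>x \<le> y \<and> \<not> y \<le> x\<close>.\<close>

definition vless :: "real^'n \<Rightarrow> real^'n \<Rightarrow> bool" (infix "\<lless>" 50) where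
  "x \<lless> y \<longleftrightarrow> (\<forall>i. x $ i < y $ i)"

text \<open>Time ranges over the nonnegative reals; values at negative times are irrelevant.
  All paths, and not just almost all of them, are continuous and start at 0. This makes the events
  \<open>\<exists>t\<ge>0. x \<lless> X t \<omega> - t *\<^sub>R \<mu>\<close> measurable without assuming that \<open>M\<close> is complete.\<close>

locale standard_brownian_motion_1 = prob_space M
  for M :: "'a measure" +
  fixes W :: "real \<Rightarrow> 'a \<Rightarrow> real"
  assumes start: "\<And>\<omega>. \<omega> \<in> space M \<Longrightarrow> W 0 \<omega> = 0"
    and continuous_paths: "\<And>\<omega>. \<omega> \<in> space M \<Longrightarrow> continuous_on {0..} (\<lambda>t. W t \<omega>)"
    and normal_increments: "\<And>s t. 0 \<le> s \<Longrightarrow> s < t \<Longrightarrow>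
      distributed M lborel (\<lambda>\<omega>. W t \<omega> - W s \<omega>) (normal_density 0 (sqrt (t - s)))"
    and indep_increments: "\<And>(n::nat) (t :: nat \<Rightarrow> real). 0 \<le> t 0 \<Longrightarrow> (\<forall>i<n. t i < t (Suc i)) \<Longrightarrow>
      indep_vars (\<lambda>_. borel) (\<lambda>i \<omega>. W (t (Suc i)) \<omega> - W (t i) \<omega>) {..<n}"

text \<open>Independence of the coordinates is independence of processes, i.e. of random elements of
  the product space over the time set.\<close>

locale standard_brownian_motion = prob_space M
  for M :: "'a measure" +
  fixes B :: "real \<Rightarrow> 'a \<Rightarrow> real^'n"
  assumes coordinate: "\<And>i. standard_brownian_motion_1 M (\<lambda>t \<omega>. B t \<omega> $ i)"
    and indep_coordinates: "indep_vars (\<lambda>_. Pi\<^sub>M {0..} (\<lambda>_. borel))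
      (\<lambda>i \<omega>. \<lambda>t\<in>{0..}. B t \<omega> $ i) UNIV"

text \<open>Since \<^term>\<open>Inf {} = (\<infinity>::ereal)\<close>, a path that never exceeds \<open>x\<close> has hitting time \<open>\<infinity>\<close>.\<close>

definition hitting_time ::
    "(real \<Rightarrow> 'a \<Rightarrow> real^'n) \<Rightarrow> real^'n \<Rightarrow> real^'n \<Rightarrow> 'a \<Rightarrow> ereal" where
  "hitting_time X \<mu> x \<omega> = Inf (ereal ` {t. 0 \<le> t \<and> x \<lless> X t \<omega> - t *\<^sub>R \<mu>})"

definition exp_hitting_integral ::
    "'a measure \<Rightarrow> (real \<Rightarrow> 'a \<Rightarrow> real^'n) \<Rightarrow> real^'n \<Rightarrow> real^'n \<Rightarrow> real \<Rightarrow> ennreal" where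
  "exp_hitting_integral M X \<mu> c T =
    (\<integral>\<^sup>+ x. ennreal (exp (x \<bullet> c) * \<P>(\<omega> in M. \<exists>t\<in>{0..T}. x \<lless> X t \<omega> - t *\<^sub>R \<mu>)) \<partial>lborel)"

end

theory Submission
  imports Defs "HOL-Real_Asymp.Real_Asymp"
begin

text \<open>In the coordinates of \<open>B\<close> the orthant becomes an open convex cone \<open>C = {y. 0 < A y}\<close>, and with
  \<open>W t = B t - t \<nu>\<close>, \<open>\<nu> = A\<^sup>-\<^sup>1 \<mu>\<close>, \<open>v = A\<^sup>-\<^sup>1 \<alpha> / t0\<close>, \<open>\<gamma> = v + \<nu>\<close>, the event in \<open>P u\<close> is that the
  walk started at \<open>z = - t0 u v\<close> visits \<open>C\<close>. The choice of \<open>t0\<close> means \<open>norm v = norm \<nu>\<close>, so tilting by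
  \<open>exp (\<gamma> \<bullet> y)\<close> turns the drift \<open>- \<nu>\<close> into \<open>v\<close> without any normalisation, and \<open>exp (- \<gamma> \<bullet> z) dz\<close> is an
  invariant measure of the walk.

  Split the event of a visit by the unit interval \<open>[k, k + 1]\<close> of the last visit. By the Markov property
  at time \<open>k\<close>, \<open>exp (- \<gamma> \<bullet> z) P u\<close> is a sum over \<open>k\<close> of integrals of
  \<open>exp (- \<gamma> \<bullet> w) \<chi>(w)\<close> against the Gaussian density of the tilted walk, where \<open>\<chi>(w)\<close> is the
  probability of a visit from \<open>w\<close> during \<open>[0, 1]\<close> and of none later. Invariance identifies
  \<open>\<integral> exp (- \<gamma> \<bullet> w) \<chi>(w) dw\<close> with \<open>H / \<bar>det A\<bar>\<close>, and with \<open>k = t0 u + r sqrt u\<close> dominated convergence in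
  \<open>w\<close> and \<open>r\<close> gives the asymptotics; restricting to \<open>r \<le> s\<close> gives the law of the hitting time. Domination
  rests on \<open>C\<close> lying strictly inside the half space \<open>\<gamma> \<bullet> y > 0\<close>. Finally \<open>H > 0\<close>, since otherwise
  the walk could not visit \<open>C\<close> at time \<open>1\<close>.\<close>

subsection \<open>Gaussian vectors and independence\<close>

text \<open>The last visit is used rather than the first, because "a visit in [k, k + 1] and none
  later" depends on the past only through the position at the fixed time k. The Markov property at
  integer times then suffices; it comes from independent increments along grids, and openness of
  \<open>C\<close> with continuity of paths carries visits on dyadic grids over to visits in
  continuous time. The real obstacle is the growth of the weight exp(-\<gamma> . w). From w the walk
  must reach \<open>C\<close> within unit time, and
  \<open>\<gamma> \<bullet> y - \<epsilon> * norm y\<close> is nonnegative on \<open>C\<close>, so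
  \<chi>(w) is at most a multiple of exp(\<gamma> . w - \<epsilon> |w|). The weighted function
  decays like exp(-\<epsilon> |w|): half of this rate absorbs the dependence of the Gaussian density
  on w, the other half is left as an integrable majorant. The number \<epsilon> exists because
  \<gamma> . y is the product of \<Sigma>^-1 b / t0, whose coordinates are positive, with A y. Sums
  and integrals are first formed for a finite horizon n, where the last visit is well defined and
  the sum telescopes; only then does n grow, together with u.\<close>

definition gauss :: "real \<Rightarrow> 'b::euclidean_space \<Rightarrow> real" where
  "gauss t y = (1 / sqrt (2 * pi * t)) ^ DIM('b) * exp (- (norm y)\<^sup>2 / (2 * t))"

lemma gauss_nonneg: "0 \<le> t \<Longrightarrow> 0 \<le> gauss t y"
  by (simp add: gauss_def)

lemma gauss_measurable [measurable]: "gauss t \<in> borel_measurable borel"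
  unfolding gauss_def by measurable

lemma gauss_eq_prod:
  fixes y :: "'b::euclidean_space"
  assumes "0 < t"
  shows "gauss t y = (\<Prod>b\<in>Basis. normal_density 0 (sqrt t) (y \<bullet> b))"
proof -
  have "(norm y)\<^sup>2 = (\<Sum>b\<in>Basis. (y \<bullet> b)\<^sup>2)"
    unfolding power2_norm_eq_inner by (subst euclidean_inner) (simp add: power2_eq_square)
  then have "exp (- (norm y)\<^sup>2 / (2 * t)) = (\<Prod>b\<in>(Basis::'b set). exp (- (y \<bullet> b)\<^sup>2 / (2 * t)))"
    by (simp add: exp_sum[symmetric] sum_negf sum_divide_distrib)
  then show ?thesis
    using assms by (simp add: gauss_def normal_density_def prod_dividef power_divide)
qed

lemma prod_Basis_vec: "(\<Prod>b\<in>(Basis::(real^'n) set). f b) = (\<Prod>i\<in>UNIV. f (axis i 1))"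
proof -
  have "(Basis::(real^'n) set) = range (\<lambda>i. axis i 1)"
    by (auto simp: Basis_vec_def)
  moreover have "inj (\<lambda>i::'n. axis i (1::real))"
    by (auto simp: inj_on_def axis_eq_axis)
  ultimately show ?thesis by (metis (no_types, lifting) prod.reindex_cong)
qed

lemma measurable_vec_lambda:
  "(\<lambda>f. \<chi> i. f i) \<in> measurable (PiM (UNIV::'n::finite set) (\<lambda>_. borel)) (borel :: (real^'n) measure)"
  by (rule borel_measurable_euclidean_space[THEN iffD2])
     (auto simp: Basis_vec_def inner_axis)

lemma measurable_vec_nth' [measurable]: "(\<lambda>x::real^'n. x $ i) \<in> borel_measurable borel"
  by (intro borel_measurable_continuous_onI continuous_intros)

lemma distr_gauss_components:
  assumes "0 < t"
  shows "distr (density lborel (gauss t)) (PiM (UNIV::'n::finite set) (\<lambda>_. borel)) (\<lambda>x i. (x :: real^'n) $ i)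
    = PiM UNIV (\<lambda>_. density lborel (normal_density 0 (sqrt t)))"
proof -
  let ?N = "density lborel (normal_density 0 (sqrt t))"
  let ?G = "density lborel (gauss t) :: (real^'n) measure"
  interpret N: prob_space ?N
    using assms by (intro prob_space_normal_density) simp
  interpret product_sigma_finite "\<lambda>_::'n. ?N"
    by unfold_locales
  have meas: "(\<lambda>x i. (x :: real^'n) $ i) \<in> measurable ?G (PiM (UNIV::'n set) (\<lambda>_. borel))"
    by (rule measurable_PiM_single') (auto)
  show ?thesis
  proof (rule PiM_eqI)
    show "sets (distr ?G (PiM (UNIV::'n set) (\<lambda>_. borel)) (\<lambda>x i. (x :: real^'n) $ i)) = sets (PiM UNIV (\<lambda>_. ?N))"
      by (simp cong: sets_PiM_cong)
    fix A :: "'n \<Rightarrow> real set" assume "\<And>i. i \<in> UNIV \<Longrightarrow> A i \<in> sets ?N"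
    then have A[measurable]: "A i \<in> sets borel" for i by simp
    \<comment> \<open>Lebesgue measure on \<open>real^'n\<close> factorises over basis vectors,
      while the sets \<open>A\<close> are indexed by coordinates; the \<open>THE\<close> recovers
      the index \<open>i\<close> of \<open>axis i 1\<close>.\<close>
    define f :: "real^'n \<Rightarrow> real \<Rightarrow> ennreal"
      where "f b x = ennreal (normal_density 0 (sqrt t) x) * indicator (A (THE i. b = axis i 1)) x" for b x
    have the: "(THE j. axis i (1::real) = axis j 1) = i" for i :: 'n
      by (auto simp: axis_eq_axis)
    have AS: "PiE UNIV A \<in> sets (PiM UNIV (\<lambda>_. borel))"
      by (intro sets_PiM_I_finite) auto
    have "emeasure (distr ?G (PiM (UNIV::'n set) (\<lambda>_. borel)) (\<lambda>x i. (x :: real^'n) $ i)) (PiE UNIV A)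
        = emeasure ?G {x. \<forall>i. x $ i \<in> A i}"
      by (subst emeasure_distr[OF meas AS]) (auto intro!: arg_cong2[where f=emeasure])
    also have "\<dots> = (\<integral>\<^sup>+x. ennreal (gauss t x) * indicator {x. \<forall>i. x $ i \<in> A i} x \<partial>lborel)"
      by (rule emeasure_density) auto
    also have "\<dots> = (\<integral>\<^sup>+x. (\<Prod>b\<in>Basis. f b (x \<bullet> b)) \<partial>lborel)"
    proof (rule nn_integral_cong)
      fix x :: "real^'n"
      have "indicator {x. \<forall>i. x $ i \<in> A i} x = (\<Prod>i\<in>UNIV. indicator (A i) (x $ i) :: ennreal)"
        by (auto simp: indicator_def)
      moreover have "ennreal (gauss t x) = (\<Prod>i\<in>UNIV. ennreal (normal_density 0 (sqrt t) (x $ i)))"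
        using assms by (simp add: gauss_eq_prod prod_Basis_vec inner_axis prod_ennreal)
      ultimately show "ennreal (gauss t x) * indicator {x. \<forall>i. x $ i \<in> A i} x = (\<Prod>b\<in>Basis. f b (x \<bullet> b))"
        by (simp add: prod_Basis_vec inner_axis f_def the prod.distrib)
    qed
    also have "\<dots> = (\<Prod>b\<in>Basis. \<integral>\<^sup>+x. f b x \<partial>lborel)"
      unfolding f_def by (intro nn_integral_lborel_prod) auto
    also have "\<dots> = (\<Prod>i\<in>UNIV. emeasure ?N (A i))"
      by (simp add: prod_Basis_vec f_def the emeasure_density)
    finally show "emeasure (distr ?G (PiM (UNIV::'n set) (\<lambda>_. borel)) (\<lambda>x i. (x :: real^'n) $ i)) (PiE UNIV A)
        = (\<Prod>i\<in>UNIV. emeasure ?N (A i))" .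
  qed simp
qed

text \<open>A finite set of pairs lies in a finite rectangle. There the rows are independent as
  random elements of a product space, each row event splits along the row, and the two product
  formulas combine.\<close>

lemma (in prob_space) indep_vars_nested:
  assumes outer: "indep_vars (\<lambda>i. PiM J (N i)) (\<lambda>i \<omega>. \<lambda>j\<in>J. X i j \<omega>) I"
    and inner: "\<And>i. i \<in> I \<Longrightarrow> indep_vars (N i) (X i) J"
  shows "indep_vars (\<lambda>(i, j). N i j) (\<lambda>(i, j). X i j) (I \<times> J)"
  unfolding indep_vars_def2
proof (intro conjI ballI)
  fix p assume "p \<in> I \<times> J"
  then show "random_variable (case p of (i, j) \<Rightarrow> N i j) (case p of (i, j) \<Rightarrow> X i j)"
    using inner by (auto simp: indep_vars_def2)
next
  have XM: "i \<in> I \<Longrightarrow> j \<in> J \<Longrightarrow> X i j \<in> measurable M (N i j)" for i j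
    using inner by (auto simp: indep_vars_def2)
  show "indep_sets (\<lambda>p. {(case p of (i, j) \<Rightarrow> X i j) -` A \<inter> space M |A. A \<in> sets (case p of (i, j) \<Rightarrow> N i j)}) (I \<times> J)"
  proof (rule indep_setsI)
    fix p assume "p \<in> I \<times> J"
    then show "{(case p of (i, j) \<Rightarrow> X i j) -` A \<inter> space M |A. A \<in> sets (case p of (i, j) \<Rightarrow> N i j)} \<subseteq> events"
      by (auto intro!: measurable_sets XM)
  next
    fix A K assume K: "K \<noteq> {}" "K \<subseteq> I \<times> J" "finite K"
      and A: "\<forall>p\<in>K. A p \<in> {(case p of (i, j) \<Rightarrow> X i j) -` A \<inter> space M |A. A \<in> sets (case p of (i, j) \<Rightarrow> N i j)}"
    then obtain S0 where S0: "\<And>p. p \<in> K \<Longrightarrow> S0 p \<in> sets (N (fst p) (snd p))"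
        "\<And>p. p \<in> K \<Longrightarrow> A p = X (fst p) (snd p) -` S0 p \<inter> space M"
      by (simp add: split_beta' Bex_def) metis
    \<comment> \<open>Pairs of the rectangle outside \<open>K\<close> receive the whole space, which
      changes neither the intersection nor the product of probabilities.\<close>
    define S where "S p = (if p \<in> K then S0 p else space (N (fst p) (snd p)))" for p
    have S: "S (i, j) \<in> sets (N i j)" for i j
      using S0(1)[of "(i, j)"] by (auto simp: S_def)
    let ?I = "fst ` K" and ?J = "snd ` K"
    have IJ: "?I \<noteq> {}" "finite ?I" "?I \<subseteq> I" "?J \<noteq> {}" "finite ?J" "?J \<subseteq> J"
      using K by auto
    define T where "T i = {f \<in> space (PiM J (N i)). \<forall>j\<in>?J. f j \<in> S (i, j)}" for i
    have T: "T i \<in> sets (PiM J (N i))" for i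
    proof -
      have "T i = prod_emb J (N i) ?J (PiE ?J (\<lambda>j. S (i, j)))"
        by (auto simp: T_def prod_emb_def space_PiM PiE_iff extensional_def restrict_def image_iff) force
      then show ?thesis using IJ S by (auto intro!: sets_PiM_I)
    qed
    define E where "E i j = X i j -` S (i, j) \<inter> space M" for i j
    have EA: "p \<in> K \<Longrightarrow> E (fst p) (snd p) = A p" for p
      using S0 by (simp add: E_def S_def)
    have EN: "p \<in> ?I \<times> ?J \<Longrightarrow> p \<notin> K \<Longrightarrow> E (fst p) (snd p) = space M" for p
      using K(2) XM[THEN measurable_space] by (fastforce simp: E_def S_def)
    have sub: "K \<subseteq> ?I \<times> ?J" by force
    have row: "(\<lambda>\<omega>. \<lambda>j\<in>J. X i j \<omega>) -` T i \<inter> space M = (\<Inter>j\<in>?J. E i j)" if "i \<in> I" for i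
    proof (intro subset_antisym subsetI)
      fix x assume x: "x \<in> (\<Inter>j\<in>?J. E i j)"
      then have "x \<in> space M" using IJ(4) by (auto simp: E_def)
      moreover have "X i j x \<in> S (i, j)" if "j \<in> ?J" for j
        using INT_D[OF x that] by (simp add: E_def)
      ultimately show "x \<in> (\<lambda>\<omega>. \<lambda>j\<in>J. X i j \<omega>) -` T i \<inter> space M"
        using IJ(6) XM[OF that, THEN measurable_space]
        unfolding T_def space_PiM by (auto simp: subset_eq)
    next
      fix x assume x: "x \<in> (\<lambda>\<omega>. \<lambda>j\<in>J. X i j \<omega>) -` T i \<inter> space M"
      have "X i j x \<in> S (i, j)" if j: "j \<in> ?J" for j
      proof -
        have "(\<lambda>j\<in>J. X i j x) j \<in> S (i, j)" using x j unfolding T_def by blast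
        moreover have "j \<in> J" using IJ(6) j by blast
        ultimately show ?thesis by simp
      qed
      then show "x \<in> (\<Inter>j\<in>?J. E i j)" using x by (auto simp: E_def)
    qed
    have "(\<Inter>p\<in>K. A p) = (\<Inter>i\<in>?I. \<Inter>j\<in>?J. E i j)"
    proof -
      have "(\<Inter>p\<in>?I \<times> ?J. E (fst p) (snd p)) = (\<Inter>p\<in>K. E (fst p) (snd p))"
      proof (intro subset_antisym subsetI)
        fix x assume x: "x \<in> (\<Inter>p\<in>K. E (fst p) (snd p))"
        then have "x \<in> space M" using K(1) by (auto simp: E_def)
        show "x \<in> (\<Inter>p\<in>?I \<times> ?J. E (fst p) (snd p))"
        proof
          fix p assume "p \<in> ?I \<times> ?J" then show "x \<in> E (fst p) (snd p)"
            using x EN[of p] \<open>x \<in> space M\<close> by (cases "p \<in> K") auto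
        qed
      qed (use sub in auto)
      moreover have "(\<Inter>p\<in>I' \<times> J'. E (fst p) (snd p)) = (\<Inter>i\<in>I'. \<Inter>j\<in>J'. E i j)" for I' J'
        by auto
      moreover have "(\<Inter>p\<in>K. A p) = (\<Inter>p\<in>K. E (fst p) (snd p))"
        using EA by (intro INF_cong) auto
      ultimately show ?thesis by metis
    qed
    then have "prob (\<Inter>p\<in>K. A p) = prob (\<Inter>i\<in>?I. (\<lambda>\<omega>. \<lambda>j\<in>J. X i j \<omega>) -` T i \<inter> space M)"
    proof -
      have "(\<Inter>i\<in>?I. (\<lambda>\<omega>. \<lambda>j\<in>J. X i j \<omega>) -` T i \<inter> space M) = (\<Inter>i\<in>?I. \<Inter>j\<in>?J. E i j)"
        using IJ(3) by (intro INF_cong refl row) auto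
      then show ?thesis
        using \<open>(\<Inter>p\<in>K. A p) = (\<Inter>i\<in>?I. \<Inter>j\<in>?J. E i j)\<close> by (simp only:)
    qed
    also have "\<dots> = (\<Prod>i\<in>?I. prob ((\<lambda>\<omega>. \<lambda>j\<in>J. X i j \<omega>) -` T i \<inter> space M))"
      using IJ T by (intro indep_varsD[OF outer]) auto
    also have "\<dots> = (\<Prod>i\<in>?I. \<Prod>j\<in>?J. prob (E i j))"
    proof (rule prod.cong)
      fix i assume "i \<in> ?I"
      then have i: "i \<in> I" using IJ by auto
      have "prob (\<Inter>j\<in>?J. E i j) = (\<Prod>j\<in>?J. prob (E i j))"
        unfolding E_def using IJ S by (intro indep_varsD[OF inner[OF i]]) auto
      then show "prob ((\<lambda>\<omega>. \<lambda>j\<in>J. X i j \<omega>) -` T i \<inter> space M) = (\<Prod>j\<in>?J. prob (E i j))"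
        by (simp add: row[OF i])
    qed simp
    also have "\<dots> = (\<Prod>p\<in>?I \<times> ?J. prob (E (fst p) (snd p)))"
      by (simp add: prod.cartesian_product split_beta')
    also have "\<dots> = (\<Prod>p\<in>K. prob (E (fst p) (snd p)))"
      using sub IJ EN by (intro prod.mono_neutral_right) (auto simp: prob_space)
    finally show "prob (\<Inter>p\<in>K. A p) = (\<Prod>p\<in>K. prob (A p))"
      by (simp add: EA)
  qed
qed

lemma (in prob_space) distr_vec_eq_gauss:
  fixes Z :: "'a \<Rightarrow> real^'n"
  assumes t: "0 < t"
    and dist: "\<And>i. distributed M lborel (\<lambda>\<omega>. Z \<omega> $ i) (normal_density 0 (sqrt t))"
    and indep: "indep_vars (\<lambda>_. borel) (\<lambda>i \<omega>. Z \<omega> $ i) UNIV"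
  shows "distr M borel Z = density lborel (gauss t)"
proof -
  have comp: "(\<lambda>\<omega>. Z \<omega> $ i) \<in> borel_measurable M" for i
    using distributed_measurable[OF dist] by simp
  have Zi: "(\<lambda>\<omega> i. Z \<omega> $ i) \<in> measurable M (PiM UNIV (\<lambda>_. borel))"
    by (rule measurable_PiM_single') (auto intro: comp)
  have gi: "(\<lambda>x i. (x :: real^'n) $ i) \<in> measurable (density lborel (gauss t)) (PiM (UNIV::'n set) (\<lambda>_. borel))"
    by (rule measurable_PiM_single') (auto intro: measurable_vec_nth')
  have "distr M (PiM UNIV (\<lambda>_. borel)) (\<lambda>\<omega>. \<lambda>i\<in>UNIV. Z \<omega> $ i)
      = PiM UNIV (\<lambda>i. distr M borel (\<lambda>\<omega>. Z \<omega> $ i))"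
    using indep by (subst (asm) indep_vars_iff_distr_eq_PiM) (auto intro: comp)
  also have "(\<lambda>i. distr M borel (\<lambda>\<omega>. Z \<omega> $ i)) = (\<lambda>_. density lborel (normal_density 0 (sqrt t)))"
    using distributed_distr_eq_density[OF dist] by (simp cong: distr_cong)
  also have "PiM UNIV (\<lambda>_. density lborel (normal_density 0 (sqrt t)))
      = distr (density lborel (gauss t)) (PiM (UNIV::'n set) (\<lambda>_. borel)) (\<lambda>x i. (x :: real^'n) $ i)"
    by (rule distr_gauss_components[OF t, symmetric])
  finally have eq: "distr M (PiM UNIV (\<lambda>_. borel)) (\<lambda>\<omega> i. Z \<omega> $ i)
      = distr (density lborel (gauss t)) (PiM (UNIV::'n set) (\<lambda>_. borel)) (\<lambda>x i. (x :: real^'n) $ i)"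
    by simp
  have "distr M borel Z = distr (distr M (PiM UNIV (\<lambda>_. borel)) (\<lambda>\<omega> i. Z \<omega> $ i)) borel (\<lambda>f. \<chi> i. f i)"
    by (subst distr_distr[OF measurable_vec_lambda Zi]) (simp add: o_def)
  also have "\<dots> = density lborel (gauss t)"
    unfolding eq by (subst distr_distr[OF measurable_vec_lambda gi]) (simp add: o_def distr_id2)
  finally show ?thesis .
qed

subsection \<open>Brownian motion along a grid\<close>

context standard_brownian_motion
begin

lemma at_zero: "\<omega> \<in> space M \<Longrightarrow> B 0 \<omega> = 0"
  using standard_brownian_motion_1.start[OF coordinate] by (simp add: vec_eq_iff)

lemma continuous_path: "\<omega> \<in> space M \<Longrightarrow> continuous_on {0..} (\<lambda>t. B t \<omega>)"
  using standard_brownian_motion_1.continuous_paths[OF coordinate]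
  by (intro continuous_on_componentwise[THEN iffD2]) (auto simp: Basis_vec_def inner_axis)

lemma coordinate_measurable: "0 \<le> t \<Longrightarrow> (\<lambda>\<omega>. B t \<omega> $ i) \<in> borel_measurable M"
proof (cases "t = 0")
  case False
  assume "0 \<le> t"
  then have "(\<lambda>\<omega>. B t \<omega> $ i - B 0 \<omega> $ i) \<in> borel_measurable M"
    using distributed_measurable[OF standard_brownian_motion_1.normal_increments[OF coordinate, of 0 t i]] False
    by simp
  then show ?thesis
    by (rule measurable_cong[THEN iffD1, rotated]) (simp add: at_zero)
next
  case True
  have "(\<lambda>\<omega>. 0::real) \<in> borel_measurable M" by simp
  then show ?thesis
    by (rule measurable_cong[THEN iffD1, rotated]) (simp add: at_zero True)
qed

lemma measurable_B [measurable]: "0 \<le> t \<Longrightarrow> B t \<in> borel_measurable M"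
  by (rule borel_measurable_euclidean_space[THEN iffD2])
     (auto simp: Basis_vec_def inner_axis coordinate_measurable)

lemma distr_increment:
  assumes "0 \<le> s" "s < t"
  shows "distr M borel (\<lambda>\<omega>. B t \<omega> - B s \<omega>) = density lborel (gauss (t - s))"
proof (rule distr_vec_eq_gauss)
  show "distributed M lborel (\<lambda>\<omega>. (B t \<omega> - B s \<omega>) $ i) (normal_density 0 (sqrt (t - s)))" for i
    using standard_brownian_motion_1.normal_increments[OF coordinate, of s t i] assms by simp
  have "indep_vars (\<lambda>_. borel) (\<lambda>i \<omega>. (\<lambda>f. f t - f s :: real) (\<lambda>t\<in>{0..}. B t \<omega> $ i)) UNIV"
    using assms by (intro indep_vars_compose2[OF indep_coordinates]) auto
  then show "indep_vars (\<lambda>_. borel) (\<lambda>i \<omega>. (B t \<omega> - B s \<omega>) $ i) UNIV"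
    using assms by simp
qed (use assms in simp)

lemma distr_B: "0 < t \<Longrightarrow> distr M borel (B t) = density lborel (gauss t)"
proof -
  assume t: "0 < t"
  have "distr M borel (B t) = distr M borel (\<lambda>\<omega>. B t \<omega> - B 0 \<omega>)"
    by (intro distr_cong) (auto simp: at_zero)
  then show ?thesis using distr_increment[of 0 t] t by simp
qed

text \<open>Two kinds of independence meet: the coordinates are independent as processes, and the
  increments of one coordinate are independent in time. Together they make the array indexed by
  coordinate and step independent; its columns are the vector increments.\<close>

lemma indep_grid_increments:
  assumes h: "0 < h"
  shows "indep_vars (\<lambda>_. borel) (\<lambda>j \<omega>. B (real (Suc j) * h) \<omega> - B (real j * h) \<omega>) UNIV"
proof -
  define X where "X i j \<omega> = B (real (Suc j) * h) \<omega> $ i - B (real j * h) \<omega> $ i" for i j \<omega>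
  have "indep_vars (\<lambda>_. PiM UNIV (\<lambda>_. borel))
      (\<lambda>i \<omega>. (\<lambda>f j. f (real (Suc j) * h) - f (real j * h) :: real) (\<lambda>t\<in>{0..}. B t \<omega> $ i)) UNIV"
    using h by (intro indep_vars_compose2[OF indep_coordinates] measurable_PiM_single') auto
  then have outer: "indep_vars (\<lambda>i. PiM UNIV (\<lambda>j. borel)) (\<lambda>i \<omega>. \<lambda>j\<in>UNIV. X i j \<omega>) UNIV"
    using h by (simp add: X_def restrict_def)
  have inner: "indep_vars (\<lambda>_. borel) (X i) UNIV" for i
    unfolding indep_vars_def2
  proof (intro conjI ballI)
    show "random_variable borel (X i j)" for j
      unfolding X_def using h by (intro borel_measurable_diff coordinate_measurable) auto
    show "indep_sets (\<lambda>j. {X i j -` A \<inter> space M |A. A \<in> sets borel}) UNIV"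
    \<comment> \<open>Independence of infinitely many increments is decided on finite subfamilies,
      each of which lies in some \<open>{..<n}\<close>.\<close>
    proof (rule indep_sets_finite_index_sets[THEN iffD2], intro allI impI)
      fix J :: "nat set" assume "finite J"
      then obtain n where n: "J \<subseteq> {..<n}" by (auto simp: finite_nat_iff_bounded)
      have "indep_vars (\<lambda>_. borel) (X i) {..<n}"
      proof -
        interpret W: standard_brownian_motion_1 M "\<lambda>t \<omega>. B t \<omega> $ i" by (rule coordinate)
        have "\<forall>j<n. real j * h < real (Suc j) * h" using h by simp
        then show ?thesis
          unfolding X_def[abs_def] by (intro W.indep_increments[where t="\<lambda>j. real j * h"]) simp
      qed
      then have "indep_vars (\<lambda>_. borel) (X i) J"
        using n by (rule indep_vars_subset)
      then show "indep_sets (\<lambda>j. {X i j -` A \<inter> space M |A. A \<in> sets borel}) J"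
        by (simp add: indep_vars_def2)
    qed
  qed
  have "indep_vars (\<lambda>(i, j). borel) (\<lambda>(i, j). X i j) (UNIV \<times> UNIV)"
    by (rule indep_vars_nested[OF outer inner])
  then have pairs: "indep_vars (\<lambda>_. borel) (\<lambda>p. X (fst p) (snd p)) UNIV"
    by (simp add: split_beta')
  have "indep_vars (\<lambda>j. PiM (UNIV \<times> {j}) (\<lambda>_. borel))
      (\<lambda>j \<omega>. \<lambda>p\<in>UNIV \<times> {j}. X (fst p) (snd p) \<omega>) UNIV"
    by (rule indep_vars_restrict[OF pairs]) (auto simp: disjoint_family_on_def)
  then have "indep_vars (\<lambda>_. borel) (\<lambda>j \<omega>. (\<lambda>f. \<chi> i. f (i, j)) (\<lambda>p\<in>UNIV \<times> {j}. X (fst p) (snd p) \<omega>)) UNIV"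
    by (rule indep_vars_compose2)
       (intro borel_measurable_euclidean_space[THEN iffD2], auto simp: Basis_vec_def inner_axis)
  then show ?thesis
    by (simp add: X_def minus_vec_def)
qed

text \<open>On a grid the path consists of partial sums of independent increments with density
  \<open>gauss h\<close>. The first \<open>K\<close> of them determine the position at index
  \<open>K\<close> and are independent of the rest, and the rest has the law of the whole
  sequence.\<close>

lemma markov_grid:
  fixes F :: "(nat \<Rightarrow> real^'n) \<Rightarrow> ennreal"
  assumes h: "0 < h" and F[measurable]: "F \<in> borel_measurable (PiM UNIV (\<lambda>_. borel))"
  shows "(\<integral>\<^sup>+\<omega>. F (\<lambda>i. B (real (K + i) * h) \<omega>) \<partial>M)
    = (\<integral>\<^sup>+y. (\<integral>\<^sup>+\<omega>. F (\<lambda>i. y + B (real i * h) \<omega>) \<partial>M) \<partial>distr M borel (B (real K * h)))"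
proof -
  define X where "X j \<omega> = B (real (Suc j) * h) \<omega> - B (real j * h) \<omega>" for j \<omega>
  have X[measurable]: "X j \<in> borel_measurable M" for j
    unfolding X_def using h by (intro borel_measurable_diff measurable_B) auto
  have X_indep: "indep_vars (\<lambda>_. borel) X UNIV"
    using indep_grid_increments[OF h] by (simp add: X_def[abs_def])
  have X_distr: "distr M borel (X j) = density lborel (gauss h)" for j
    unfolding X_def[abs_def] using h by (subst distr_increment) (auto simp: algebra_simps)
  have shift: "B (real (k + i) * h) \<omega> = B (real k * h) \<omega> + (\<Sum>j<i. X (k + j) \<omega>)" for k i \<omega>
    by (induction i) (auto simp: X_def algebra_simps)
  have XK_indep: "indep_vars (\<lambda>_. borel) (\<lambda>i. X (k + i)) UNIV" for k
  proof -
    show ?thesis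
      unfolding indep_vars_def2
    proof (intro conjI ballI indep_setsI)
      fix A J assume J: "J \<noteq> {}" "finite J"
        and "\<forall>j\<in>J. A j \<in> {X (k + j) -` A \<inter> space M |A. A \<in> sets borel}"
      then obtain S where S: "\<And>j. j \<in> J \<Longrightarrow> S j \<in> sets borel \<and> A j = X (k + j) -` S j \<inter> space M"
        by simp metis
      let ?S = "\<lambda>j. S (j - k)"
      have "prob (\<Inter>j\<in>(+) k ` J. X j -` ?S j \<inter> space M) = (\<Prod>j\<in>(+) k ` J. prob (X j -` ?S j \<inter> space M))"
        using J S by (intro indep_varsD[OF X_indep]) auto
      moreover have "(\<Inter>j\<in>(+) k ` J. X j -` ?S j \<inter> space M) = (\<Inter>j\<in>J. A j)"
        unfolding image_image using S by (intro INF_cong) auto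
      ultimately show "prob (\<Inter>j\<in>J. A j) = (\<Prod>j\<in>J. prob (A j))"
        using S by (simp add: prod.reindex del: INT_extend_simps INT_simps)
    qed auto
  qed
  let ?N = "PiM UNIV (\<lambda>_::nat. density lborel (gauss h)) :: (nat \<Rightarrow> real^'n) measure"
  have XKM[measurable]: "(\<lambda>\<omega> i. X (k + i) \<omega>) \<in> measurable M (PiM UNIV (\<lambda>_. borel))" for k
    by (rule measurable_PiM_single') auto
  have XK_distr: "distr M (PiM UNIV (\<lambda>_. borel)) (\<lambda>\<omega> i. X (k + i) \<omega>) = ?N" for k
    using indep_vars_iff_distr_eq_PiM[where I=UNIV and M'="\<lambda>_. borel" and X="\<lambda>i. X (k + i)"] XK_indep[of k]
    by (simp add: X_distr restrict_def)
  let ?S = "PiM UNIV (\<lambda>_. borel) :: (nat \<Rightarrow> real^'n) measure"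
  have BK[measurable]: "B (real K * h) \<in> borel_measurable M" using h by (intro measurable_B) simp
  \<comment> \<open>\<open>indep_var\<close> relates variables with values in one type, so the
    position is carried as a constant sequence and read off at index 0.\<close>
  have BK0: "(\<lambda>\<omega> _. B (real K * h) \<omega>) \<in> measurable M ?S"
    by (rule measurable_PiM_single') auto
  have pair_distr: "distr M ?S (\<lambda>\<omega> _. B (real K * h) \<omega>) \<Otimes>\<^sub>M distr M ?S (\<lambda>\<omega> i. X (K + i) \<omega>)
      = distr M (?S \<Otimes>\<^sub>M ?S) (\<lambda>\<omega>. (\<lambda>_. B (real K * h) \<omega>, \<lambda>i. X (K + i) \<omega>))"
  proof -
    have "indep_var (PiM {..<K} (\<lambda>_. borel)) (\<lambda>\<omega>. \<lambda>i\<in>{..<K}. X i \<omega>) (PiM {K..} (\<lambda>_. borel)) (\<lambda>\<omega>. \<lambda>i\<in>{K..}. X i \<omega>)"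
      by (rule indep_var_restrict[OF X_indep]) auto
    then have "indep_var ?S ((\<lambda>f _. \<Sum>j<K. f j) \<circ> (\<lambda>\<omega>. \<lambda>i\<in>{..<K}. X i \<omega>))
        ?S ((\<lambda>f i. f (K + i)) \<circ> (\<lambda>\<omega>. \<lambda>i\<in>{K..}. X i \<omega>))"
      by (rule indep_var_compose) (auto intro!: measurable_PiM_single' borel_measurable_sum)
    then have "indep_var ?S (\<lambda>\<omega> _. \<Sum>j<K. X j \<omega>) ?S (\<lambda>\<omega> i. X (K + i) \<omega>)"
      by (simp add: o_def)
    then have ind: "distr M ?S (\<lambda>\<omega> _. \<Sum>j<K. X j \<omega>) \<Otimes>\<^sub>M distr M ?S (\<lambda>\<omega> i. X (K + i) \<omega>)
      = distr M (?S \<Otimes>\<^sub>M ?S) (\<lambda>\<omega>. (\<lambda>_. \<Sum>j<K. X j \<omega>, \<lambda>i. X (K + i) \<omega>))"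
      unfolding indep_var_distribution_eq by blast
    have eq: "\<omega> \<in> space M \<Longrightarrow> (\<Sum>j<K. X j \<omega>) = B (real K * h) \<omega>" for \<omega>
      using shift[of 0 K \<omega>] by (simp add: at_zero)
    have "distr M ?S (\<lambda>\<omega> _. \<Sum>j<K. X j \<omega>) = distr M ?S (\<lambda>\<omega> _. B (real K * h) \<omega>)"
      by (intro distr_cong) (auto simp: eq)
    moreover have "distr M (?S \<Otimes>\<^sub>M ?S) (\<lambda>\<omega>. (\<lambda>_. \<Sum>j<K. X j \<omega>, \<lambda>i. X (K + i) \<omega>))
        = distr M (?S \<Otimes>\<^sub>M ?S) (\<lambda>\<omega>. (\<lambda>_. B (real K * h) \<omega>, \<lambda>i. X (K + i) \<omega>))"
      by (intro distr_cong) (auto simp: eq)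
    ultimately show ?thesis
      using ind by simp
  qed
  define G where "G y x = F (\<lambda>i. y 0 + (\<Sum>j<i. x j))" for y x :: "nat \<Rightarrow> real^'n"
  have path: "(\<lambda>p i. fst p 0 + (\<Sum>j<i. snd p j)) \<in> measurable (?S \<Otimes>\<^sub>M ?S) ?S"
    by (rule measurable_PiM_single') auto
  have G: "(\<lambda>p. G (fst p) (snd p)) \<in> borel_measurable (?S \<Otimes>\<^sub>M ?S)"
    unfolding G_def by (rule measurable_compose[OF path F])
  interpret N: prob_space ?N
    unfolding XK_distr[of 0, symmetric] by (rule prob_space_distr[OF XKM])
  have N_sets: "sets ?N = sets ?S"
    by (intro sets_PiM_cong) auto
  have "(\<integral>\<^sup>+\<omega>. F (\<lambda>i. B (real (K + i) * h) \<omega>) \<partial>M)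
      = (\<integral>\<^sup>+\<omega>. G (fst (\<lambda>_. B (real K * h) \<omega>, \<lambda>i. X (K + i) \<omega>)) (snd (\<lambda>_::nat. B (real K * h) \<omega>, \<lambda>i. X (K + i) \<omega>)) \<partial>M)"
    unfolding G_def by (simp only: shift fst_conv snd_conv)
  also have "\<dots> = (\<integral>\<^sup>+p. G (fst p) (snd p) \<partial>distr M (?S \<Otimes>\<^sub>M ?S) (\<lambda>\<omega>. (\<lambda>_. B (real K * h) \<omega>, \<lambda>i. X (K + i) \<omega>)))"
    by (subst nn_integral_distr[OF measurable_Pair[OF BK0 XKM]]) (use G in simp_all)
  also have "\<dots> = (\<integral>\<^sup>+p. G (fst p) (snd p) \<partial>(distr M ?S (\<lambda>\<omega> _. B (real K * h) \<omega>) \<Otimes>\<^sub>M ?N))"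
    by (simp only: pair_distr[symmetric] XK_distr)
  also have "\<dots> = (\<integral>\<^sup>+y. \<integral>\<^sup>+x. G y x \<partial>?N \<partial>distr M ?S (\<lambda>\<omega> _. B (real K * h) \<omega>))"
  proof -
    have "sets (distr M ?S (\<lambda>\<omega> _. B (real K * h) \<omega>) \<Otimes>\<^sub>M ?N) = sets (?S \<Otimes>\<^sub>M ?S)"
      using N_sets by (intro sets_pair_measure_cong) auto
    then have "(\<lambda>p. G (fst p) (snd p)) \<in> borel_measurable (distr M ?S (\<lambda>\<omega> _. B (real K * h) \<omega>) \<Otimes>\<^sub>M ?N)"
      using G by (subst measurable_cong_sets[OF _ refl])
    from N.nn_integral_fst[OF this] show ?thesis by simp
  qed
  also have "\<dots> = (\<integral>\<^sup>+y. (\<integral>\<^sup>+\<omega>. F (\<lambda>i. y 0 + B (real i * h) \<omega>) \<partial>M) \<partial>distr M ?S (\<lambda>\<omega> _. B (real K * h) \<omega>))"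
  proof (rule nn_integral_cong)
    fix y :: "nat \<Rightarrow> real^'n"
    have Gy: "G y \<in> borel_measurable ?S"
    proof -
      have "y \<in> space ?S" by (simp add: space_PiM)
      from measurable_compose[OF measurable_Pair1'[OF this] G] show ?thesis by (simp only: fst_conv snd_conv)
    qed
    have "(\<integral>\<^sup>+x. G y x \<partial>?N) = (\<integral>\<^sup>+x. G y x \<partial>distr M ?S (\<lambda>\<omega> i. X (0 + i) \<omega>))"
      by (simp only: XK_distr)
    also have "\<dots> = (\<integral>\<^sup>+\<omega>. G y (\<lambda>i. X (0 + i) \<omega>) \<partial>M)"
      by (rule nn_integral_distr[OF XKM]) (simp only: measurable_distr_eq1 Gy)
    also have "\<dots> = (\<integral>\<^sup>+\<omega>. G y (\<lambda>i. X i \<omega>) \<partial>M)"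
      by (simp only: add_0)
    also have "\<dots> = (\<integral>\<^sup>+\<omega>. F (\<lambda>i. y 0 + B (real i * h) \<omega>) \<partial>M)"
    proof (rule nn_integral_cong)
      fix \<omega> assume "\<omega> \<in> space M"
      then have "(\<Sum>j<i. X j \<omega>) = B (real i * h) \<omega>" for i
        using shift[of 0 i \<omega>] by (simp add: at_zero)
      then show "G y (\<lambda>i. X i \<omega>) = F (\<lambda>i. y 0 + B (real i * h) \<omega>)"
        unfolding G_def by simp
    qed
    finally show "(\<integral>\<^sup>+x. G y x \<partial>?N) = (\<integral>\<^sup>+\<omega>. F (\<lambda>i. y 0 + B (real i * h) \<omega>) \<partial>M)" .
  qed
  also have "\<dots> = (\<integral>\<^sup>+y. (\<integral>\<^sup>+\<omega>. F (\<lambda>i. y + B (real i * h) \<omega>) \<partial>M) \<partial>distr M borel (B (real K * h)))"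
  proof -
    have BM: "B (real i * h) \<in> borel_measurable M" for i using h by (intro measurable_B) simp
    have p: "(\<lambda>p i. fst p + B (real i * h) (snd p)) \<in> measurable (borel \<Otimes>\<^sub>M M) ?S"
      using BM by (intro measurable_PiM_single') auto
    have F2[measurable]: "(\<lambda>y. \<integral>\<^sup>+\<omega>. F (\<lambda>i. y + B (real i * h) \<omega>) \<partial>M) \<in> borel_measurable borel"
      using measurable_compose[OF p F]
      by (intro borel_measurable_nn_integral) (simp add: split_beta')
    have F3: "(\<lambda>y. \<integral>\<^sup>+\<omega>. F (\<lambda>i. y 0 + B (real i * h) \<omega>) \<partial>M) \<in> borel_measurable ?S"
      by (rule measurable_compose[OF _ F2]) simp
    show ?thesis
      by (subst nn_integral_distr[OF BK0], use F3 in simp, subst nn_integral_distr[OF BK], use F2 in simp, simp)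
  qed
  finally show ?thesis .
qed

end

subsection \<open>Visits of a drifted walk to a cone\<close>

lemma nn_integral_exp_abs_finite:
  assumes "0 < (c::real)"
  shows "(\<integral>\<^sup>+x. ennreal (exp (- c * \<bar>x\<bar>)) \<partial>lborel) < \<infinity>"
proof -
  let ?e = "exponential_density c"
  have e: "(\<integral>\<^sup>+x. ennreal (?e x) \<partial>lborel) = 1"
    using prob_space.emeasure_space_1[OF prob_space_exponential_density[OF assms]]
    by (simp add: emeasure_density)
  have e': "(\<integral>\<^sup>+x. ennreal (?e (- x)) \<partial>lborel) = 1"
    using nn_integral_real_affine[of "\<lambda>x. ennreal (?e x)" "-1" 0] e by simp
  have "ennreal (exp (- c * \<bar>x\<bar>)) \<le> ennreal (1 / c) * (ennreal (?e x) + ennreal (?e (- x)))" for x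
  proof -
    have "exp (- c * \<bar>x\<bar>) \<le> 1 / c * (?e x + ?e (- x))"
      using assms by (auto simp: exponential_density_def field_simps)
    moreover have "0 \<le> ?e x" "0 \<le> ?e (- x)"
      using assms by (auto simp: exponential_density_nonneg)
    ultimately show ?thesis
      using assms by (simp add: ennreal_mult[symmetric] ennreal_plus[symmetric] del: ennreal_plus)
  qed
  then have "(\<integral>\<^sup>+x. ennreal (exp (- c * \<bar>x\<bar>)) \<partial>lborel)
      \<le> (\<integral>\<^sup>+x. ennreal (1 / c) * (ennreal (?e x) + ennreal (?e (- x))) \<partial>lborel)"
    by (rule nn_integral_mono)
  also have "\<dots> = ennreal (1 / c) * ((\<integral>\<^sup>+x. ennreal (?e x) \<partial>lborel) + (\<integral>\<^sup>+x. ennreal (?e (- x)) \<partial>lborel))"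
    by (simp add: nn_integral_cmult nn_integral_add)
  also have "\<dots> < \<infinity>"
    unfolding e e' by (simp add: ennreal_mult_less_top)
  finally show ?thesis .
qed

text \<open>The norm dominates the mean of the absolute coordinates, so the integrand lies below a
  product of one-dimensional exponentials.\<close>

lemma integrable_exp_norm:
  assumes "0 < \<delta>"
  shows "integrable lborel (\<lambda>z::'b::euclidean_space. exp (- \<delta> * norm z))"
proof -
  define c where "c = \<delta> / DIM('b)"
  have c: "0 < c" using assms by (simp add: c_def)
  have "(\<integral>\<^sup>+z. ennreal (exp (- \<delta> * norm (z::'b))) \<partial>lborel)
      \<le> (\<integral>\<^sup>+(z::'b). (\<Prod>b\<in>Basis. ennreal (exp (- c * \<bar>z \<bullet> b\<bar>))) \<partial>lborel)"
  proof (rule nn_integral_mono)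
    fix z :: 'b
    have "(\<Sum>b\<in>Basis. c * \<bar>z \<bullet> b\<bar>) \<le> (\<Sum>b\<in>(Basis::'b set). c * norm z)"
      using c by (intro sum_mono mult_left_mono Basis_le_norm) auto
    then have "exp (- \<delta> * norm z) \<le> exp (\<Sum>b\<in>Basis. - c * \<bar>z \<bullet> b\<bar>)"
      using assms by (simp add: c_def sum_negf)
    then show "ennreal (exp (- \<delta> * norm z)) \<le> (\<Prod>b\<in>Basis. ennreal (exp (- c * \<bar>z \<bullet> b\<bar>)))"
      by (simp add: prod_ennreal exp_sum ennreal_leI)
  qed
  also have "\<dots> = (\<Prod>b\<in>(Basis::'b set). \<integral>\<^sup>+x. ennreal (exp (- c * \<bar>x\<bar>)) \<partial>lborel)"
    by (rule nn_integral_lborel_prod) auto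
  also have "\<dots> < \<infinity>"
    using nn_integral_exp_abs_finite[OF c] by (simp add: ennreal_prod_eq_top less_top power_less_top_ennreal)
  finally show ?thesis
    by (intro integrableI_nonneg) auto
qed

text \<open>The substitution \<open>y = sqrt t x - w\<close> moves \<open>t\<close> out of the
  density, so that estimates uniform in \<open>t\<close> can be made under the fixed density
  \<open>gauss 1\<close>.\<close>

lemma gauss_scale:
  fixes g :: "'b::euclidean_space \<Rightarrow> ennreal"
  assumes t: "0 < t" and [measurable]: "g \<in> borel_measurable borel"
  shows "(\<integral>\<^sup>+y. g y * ennreal (gauss t (y + w)) \<partial>lborel) = (\<integral>\<^sup>+x. g (sqrt t *\<^sub>R x - w) * ennreal (gauss 1 x) \<partial>lborel)"
proof -
  have s: "sqrt t \<noteq> 0" using t by simp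
  have "(\<integral>\<^sup>+y. g y * ennreal (gauss t (y + w)) \<partial>lborel)
     = (\<integral>\<^sup>+x. ennreal (\<bar>sqrt t\<bar> ^ DIM('b)) * (g (- w + sqrt t *\<^sub>R x) * ennreal (gauss t (- w + sqrt t *\<^sub>R x + w))) \<partial>lborel)"
    by (subst lborel_affine[OF s, of "- w"]) (simp add: nn_integral_density nn_integral_distr)
  also have "\<dots> = (\<integral>\<^sup>+x. g (sqrt t *\<^sub>R x - w) * ennreal (gauss 1 x) \<partial>lborel)"
  proof (rule nn_integral_cong)
    fix x :: 'b
    have "sqrt t ^ DIM('b) * gauss t (sqrt t *\<^sub>R x) = gauss 1 x"
      using t by (simp add: gauss_def power_mult_distrib power_divide real_sqrt_mult)
    then have "ennreal (\<bar>sqrt t\<bar> ^ DIM('b)) * ennreal (gauss t (sqrt t *\<^sub>R x)) = ennreal (gauss 1 x)"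
      using t by (simp add: ennreal_mult[symmetric] gauss_nonneg)
    moreover have "- w + sqrt t *\<^sub>R x + w = sqrt t *\<^sub>R x" "- w + sqrt t *\<^sub>R x = sqrt t *\<^sub>R x - w"
      by simp_all
    ultimately show "ennreal (\<bar>sqrt t\<bar> ^ DIM('b)) * (g (- w + sqrt t *\<^sub>R x) * ennreal (gauss t (- w + sqrt t *\<^sub>R x + w)))
        = g (sqrt t *\<^sub>R x - w) * ennreal (gauss 1 x)"
      by (metis mult.left_commute)
  qed
  finally show ?thesis .
qed

lemma gauss_pos: "0 < t \<Longrightarrow> 0 < gauss t y"
  by (simp add: gauss_def)

lemma gauss_exp_finite:
  "(\<integral>\<^sup>+x. ennreal (exp (L * norm x)) * ennreal (gauss 1 (x::'b::euclidean_space)) \<partial>lborel) < \<infinity>"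
proof -
  have "exp (L * norm x) * gauss 1 x \<le> (1 / sqrt (2 * pi)) ^ DIM('b) * exp ((L + 1)\<^sup>2 / 2) * exp (- 1 * norm x)" for x :: 'b
  proof -
    \<comment> \<open>Completing the square with \<open>L + 1\<close> in place of \<open>L\<close>
      leaves a factor \<open>exp (- norm x)\<close> for integrability.\<close>
    have "0 \<le> (norm x - (L + 1))\<^sup>2" by simp
    then have "L * norm x - (norm x)\<^sup>2 / 2 \<le> (L + 1)\<^sup>2 / 2 - norm x"
      by (simp add: power2_eq_square algebra_simps)
    then have "exp (L * norm x) * exp (- (norm x)\<^sup>2 / 2) \<le> exp ((L + 1)\<^sup>2 / 2) * exp (- 1 * norm x)"
      by (simp add: exp_add[symmetric])
    then show ?thesis
      unfolding gauss_def by (simp add: mult.left_commute mult.assoc mult_left_mono)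
  qed
  then have "(\<integral>\<^sup>+x. ennreal (exp (L * norm x)) * ennreal (gauss 1 (x::'b)) \<partial>lborel)
     \<le> (\<integral>\<^sup>+(x::'b). ennreal ((1 / sqrt (2 * pi)) ^ DIM('b) * exp ((L + 1)\<^sup>2 / 2) * exp (- 1 * norm x)) \<partial>lborel)"
    by (intro nn_integral_mono) (simp add: ennreal_mult[symmetric] gauss_nonneg)
  also have "\<dots> < \<infinity>"
    using integrable_exp_norm[of 1, where 'b='b]
  proof -
    have "integrable lborel (\<lambda>x::'b. (1 / sqrt (2 * pi)) ^ DIM('b) * exp ((L + 1)\<^sup>2 / 2) * exp (- 1 * norm x))"
      by (intro integrable_mult_right integrable_exp_norm) simp
    then show ?thesis
      by (subst nn_integral_eq_integral) auto
  qed
  finally show ?thesis .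
qed

text \<open>The interface through which the visit estimates see Brownian motion. The shift by
  \<open>t *\<^sub>R \<nu>\<close> in the density encodes the drift \<open>- \<nu>\<close>, and the
  Markov property is demanded along grids only.\<close>

locale gaussian_walk = prob_space M for M :: "'a measure" +
  fixes W :: "real \<Rightarrow> 'a \<Rightarrow> 'b::euclidean_space" and \<nu> :: 'b
  assumes measurable_W [measurable]: "\<And>t. 0 \<le> t \<Longrightarrow> W t \<in> borel_measurable M"
    and start: "\<And>\<omega>. \<omega> \<in> space M \<Longrightarrow> W 0 \<omega> = 0"
    and path_continuous: "\<And>\<omega>. \<omega> \<in> space M \<Longrightarrow> continuous_on {0..} (\<lambda>t. W t \<omega>)"
    and distr_W: "\<And>t. 0 < t \<Longrightarrow> distr M borel (W t) = density lborel (\<lambda>y. ennreal (gauss t (y + t *\<^sub>R \<nu>)))"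
    and markov: "\<And>h K F. 0 < h \<Longrightarrow> F \<in> borel_measurable (PiM (UNIV::nat set) (\<lambda>_. borel)) \<Longrightarrow>
      (\<integral>\<^sup>+\<omega>. F (\<lambda>i. W (real (K + i) * h) \<omega>) \<partial>M)
    = (\<integral>\<^sup>+y. (\<integral>\<^sup>+\<omega>. F (\<lambda>i. y + W (real i * h) \<omega>) \<partial>M) \<partial>distr M borel (W (real K * h)))"

text \<open>\<open>norm_v\<close> is the equation that fixes \<open>t0\<close>, and
  \<open>C_cone\<close> keeps the angle between \<open>\<gamma>\<close> and the points of
  \<open>C\<close> away from a right angle.\<close>

locale cone_hitting = gaussian_walk M W \<nu> for M :: "'a measure" and W :: "real \<Rightarrow> 'a \<Rightarrow> 'b::euclidean_space" and \<nu> +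
  fixes C :: "'b set" and v \<gamma> :: 'b and \<epsilon> :: real
  assumes open_C: "open C" and C_ne: "C \<noteq> {}"
    and \<gamma>_def: "\<gamma> = v + \<nu>" and norm_v: "norm v = norm \<nu>" and v_ne: "v \<noteq> 0"
    and \<epsilon>_pos: "0 < \<epsilon>" and C_cone: "\<And>y. y \<in> C \<Longrightarrow> \<epsilon> * norm y \<le> \<gamma> \<bullet> y"
begin

lemma measurable_C [measurable]: "C \<in> sets borel"
  using open_C by simp

text \<open>In the expanded squares the terms with \<open>t\<^sup>2\<close> cancel because
  \<open>v\<close> and \<open>\<nu>\<close> have the same norm. The difference is linear in
  \<open>y\<close>, so the change of drift comes without a factor depending on time.\<close>

lemma gauss_tilt:
  assumes t: "0 < t"
  shows "gauss t (y + t *\<^sub>R \<nu>) = exp (- (\<gamma> \<bullet> y)) * gauss t (y - t *\<^sub>R v)"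
proof -
  have "(norm (y + t *\<^sub>R \<nu>))\<^sup>2 = (norm (y - t *\<^sub>R v))\<^sup>2 + 2 * t * (\<gamma> \<bullet> y)"
    using norm_v unfolding \<gamma>_def norm_eq_sqrt_inner[of v] norm_eq_sqrt_inner[of \<nu>] power2_norm_eq_inner
    by (simp add: algebra_simps inner_commute)
  then have "- (norm (y + t *\<^sub>R \<nu>))\<^sup>2 / (2 * t) = - (\<gamma> \<bullet> y) + - (norm (y - t *\<^sub>R v))\<^sup>2 / (2 * t)"
    using t by (simp add: field_simps)
  then show ?thesis
    by (simp add: gauss_def exp_add[symmetric])
qed

text \<open>Only rational times and the right end point matter, because \<open>C\<close> is open and paths are
  continuous.\<close>

lemma visit_iff_rational:
  assumes "\<omega> \<in> space M" "0 \<le> a"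
  shows "(\<exists>t\<in>{a..b}. z + W t \<omega> \<in> C)
    \<longleftrightarrow> (a \<le> b \<and> z + W b \<omega> \<in> C) \<or> (\<exists>q::rat. a \<le> of_rat q \<and> of_rat q \<le> b \<and> z + W (of_rat q) \<omega> \<in> C)"
proof
  assume "\<exists>t\<in>{a..b}. z + W t \<omega> \<in> C"
  then obtain t where t: "a \<le> t" "t \<le> b" "z + W t \<omega> \<in> C" by auto
  show "(a \<le> b \<and> z + W b \<omega> \<in> C) \<or> (\<exists>q::rat. a \<le> of_rat q \<and> of_rat q \<le> b \<and> z + W (of_rat q) \<omega> \<in> C)"
  proof (cases "t = b")
    case False
    then have "t < b" using t by simp
    have cont: "continuous_on {0..} (\<lambda>t. z + W t \<omega>)"
      by (intro continuous_intros path_continuous assms)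
    obtain A where A: "open A" "A \<inter> {0..} = (\<lambda>t. z + W t \<omega>) -` C \<inter> {0..}"
      using continuous_on_open_invariant[THEN iffD1, rule_format, OF cont open_C] by auto
    have "t \<in> A \<inter> {0..}" unfolding A(2) using t assms by simp
    then have "t \<in> A" by simp
    then obtain \<delta> where \<delta>: "\<delta> > 0" "\<And>s. dist s t < \<delta> \<Longrightarrow> s \<in> A"
      using A(1) by (auto simp: open_dist)
    obtain q :: rat where q: "t < of_rat q" "of_rat q < min b (t + \<delta>)"
      using of_rat_dense[of t "min b (t + \<delta>)"] \<open>t < b\<close> \<delta> by auto
    have "of_rat q \<in> A" using q by (intro \<delta>(2)) (auto simp: dist_real_def)
    moreover have "of_rat q \<in> {0::real..}" unfolding atLeast_iff using q(1) t(1) assms(2) by linarith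
    ultimately have "z + W (of_rat q) \<omega> \<in> C" using A(2) by blast
    then show ?thesis using q t by (intro disjI2 exI[of _ q]) auto
  qed (use t in auto)
qed auto

text \<open>Measurability jointly in the starting point and the path is what makes visit
  probabilities measurable functions of the starting point.\<close>

lemma pred_visit_pair [measurable]:
  assumes "0 \<le> a"
  shows "Measurable.pred (borel \<Otimes>\<^sub>M M) (\<lambda>p. \<exists>t\<in>{a..b}. fst p + W t (snd p) \<in> C)"
proof -
  have 1: "(\<lambda>p. fst p + W t (snd p)) \<in> borel_measurable (borel \<Otimes>\<^sub>M M)" if "0 \<le> t" for t
    using that by measurable
  \<comment> \<open>\<open>W\<close> is known to be measurable at nonnegative times only; the
    proposition \<open>P\<close> guards against rationals that are negative.\<close>
  have 2: "Measurable.pred (borel \<Otimes>\<^sub>M M) (\<lambda>p. P \<and> fst p + W t (snd p) \<in> C)" if "P \<Longrightarrow> 0 \<le> t" for t P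
    using measurable_sets[OF 1 measurable_C] that by (cases P) (auto simp: pred_def vimage_def Int_def conj_commute)
  have "Measurable.pred (borel \<Otimes>\<^sub>M M) (\<lambda>p. (a \<le> b \<and> fst p + W b (snd p) \<in> C) \<or>
      (\<exists>q::rat. a \<le> of_rat q \<and> of_rat q \<le> b \<and> fst p + W (of_rat q) (snd p) \<in> C))"
  proof (rule pred_intros_logic(5))
    have "Measurable.pred (borel \<Otimes>\<^sub>M M) (\<lambda>p. (a \<le> of_rat q \<and> of_rat q \<le> b) \<and> fst p + W (of_rat q) (snd p) \<in> C)" for q
      by (intro 2 order_trans[OF assms]) simp
    then show "Measurable.pred (borel \<Otimes>\<^sub>M M) (\<lambda>p. \<exists>q::rat. a \<le> of_rat q \<and> of_rat q \<le> b \<and> fst p + W (of_rat q) (snd p) \<in> C)"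
      unfolding conj_assoc by (rule pred_intros_countable(2))
  qed (use assms in \<open>intro 2, auto\<close>)
  then show ?thesis
    by (rule measurable_cong[THEN iffD1, rotated])
       (rule visit_iff_rational[symmetric, OF _ assms], auto simp: space_pair_measure)
qed

lemma pred_visit [measurable]:
  assumes "0 \<le> a"
  shows "Measurable.pred M (\<lambda>\<omega>. \<exists>t\<in>{a..b}. z + W t \<omega> \<in> C)"
  using measurable_compose[OF measurable_Pair1'[of z borel M] pred_visit_pair[OF assms, of b]] by simp

definition Psi :: "real \<Rightarrow> real \<Rightarrow> 'b \<Rightarrow> real" where
  "Psi a b z = prob {\<omega> \<in> space M. \<exists>t\<in>{a..b}. z + W t \<omega> \<in> C}"

lemma Psi_bounds: "0 \<le> Psi a b z" "Psi a b z \<le> 1"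
  by (auto simp: Psi_def)

lemma emeasure_visit: "emeasure M {\<omega> \<in> space M. \<exists>t\<in>{a..b}. z + W t \<omega> \<in> C} = ennreal (Psi a b z)"
  by (simp add: Psi_def emeasure_eq_measure)

lemma measurable_Psi [measurable]: "0 \<le> a \<Longrightarrow> Psi a b \<in> borel_measurable borel"
proof -
  assume a: "0 \<le> a"
  let ?S = "{p \<in> space (borel \<Otimes>\<^sub>M M). \<exists>t\<in>{a..b}. fst p + W t (snd p) \<in> C}"
  have "?S \<in> sets (borel \<Otimes>\<^sub>M M)"
    using pred_visit_pair[OF a] by (simp add: pred_def)
  then have "(\<lambda>z. emeasure M (Pair z -` ?S)) \<in> borel_measurable borel"
    by (rule measurable_emeasure_Pair)
  moreover have "Pair z -` ?S = {\<omega> \<in> space M. \<exists>t\<in>{a..b}. z + W t \<omega> \<in> C}" for z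
    by (auto simp: space_pair_measure)
  ultimately have "(\<lambda>z. ennreal (Psi a b z)) \<in> borel_measurable borel"
    by (simp add: emeasure_visit)
  then have "(\<lambda>z. enn2real (ennreal (Psi a b z))) \<in> borel_measurable borel"
    by measurable
  then show ?thesis by (simp add: Psi_bounds)
qed

subsection \<open>Markov property and exponential bound for visits\<close>

abbreviation law :: "nat \<Rightarrow> 'b measure" where
  "law k \<equiv> distr M borel (W (real k))"

text \<open>Dyadic meshes are nested, so these events grow with \<open>m\<close>, and the integer
  end points \<open>a\<close>, \<open>b\<close> are grid times at every level.\<close>

definition grid_visit :: "nat \<Rightarrow> nat \<Rightarrow> nat \<Rightarrow> 'b \<Rightarrow> 'a set" where
  "grid_visit m a b z = {\<omega> \<in> space M. \<exists>i\<in>{a * 2 ^ m..b * 2 ^ m}. z + W (real i * (1 / 2 ^ m)) \<omega> \<in> C}"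

lemma grid_visit_sets [measurable]: "grid_visit m a b z \<in> sets M"
  unfolding grid_visit_def by measurable

lemma incseq_grid_visit: "incseq (\<lambda>m. grid_visit m a b z)"
proof (rule incseq_SucI, rule subsetI)
  fix m \<omega> assume "\<omega> \<in> grid_visit m a b z"
  then obtain i where i: "\<omega> \<in> space M" "i \<in> {a * 2 ^ m..b * 2 ^ m}" "z + W (real i * (1 / 2 ^ m)) \<omega> \<in> C"
    by (auto simp: grid_visit_def)
  have "real (2 * i) * (1 / 2 ^ Suc m) = real i * (1 / 2 ^ m)" by simp
  then have "z + W (real (2 * i) * (1 / 2 ^ Suc m)) \<omega> \<in> C" using i(3) by metis
  moreover have "2 * i \<in> {a * 2 ^ Suc m..b * 2 ^ Suc m}" using i(2) by simp
  ultimately show "\<omega> \<in> grid_visit (Suc m) a b z"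
    unfolding grid_visit_def using i(1) by blast
qed

lemma UN_grid_visit:
  "(\<Union>m. grid_visit m a b z) = {\<omega> \<in> space M. \<exists>t\<in>{real a..real b}. z + W t \<omega> \<in> C}"
proof (intro subset_antisym subsetI)
  fix \<omega> assume "\<omega> \<in> (\<Union>m. grid_visit m a b z)"
  then obtain m i where i: "\<omega> \<in> space M" "i \<in> {a * 2 ^ m..b * 2 ^ m}" "z + W (real i * (1 / 2 ^ m)) \<omega> \<in> C"
    by (auto simp: grid_visit_def)
  have "real (a * 2 ^ m) \<le> real i" "real i \<le> real (b * 2 ^ m)"
    using i(2) by (simp_all only: of_nat_le_iff atLeastAtMost_iff)
  then have "real i * (1 / 2 ^ m) \<in> {real a..real b}"
    by (simp add: field_simps)
  then show "\<omega> \<in> {\<omega> \<in> space M. \<exists>t\<in>{real a..real b}. z + W t \<omega> \<in> C}"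
    using i(1,3) by blast
next
  fix \<omega> assume "\<omega> \<in> {\<omega> \<in> space M. \<exists>t\<in>{real a..real b}. z + W t \<omega> \<in> C}"
  then obtain t where t: "\<omega> \<in> space M" "real a \<le> t" "t \<le> real b" "z + W t \<omega> \<in> C"
    by auto
  have cont: "continuous_on {0..} (\<lambda>t. z + W t \<omega>)"
    by (intro continuous_intros path_continuous t)
  obtain A where A: "open A" "A \<inter> {0..} = (\<lambda>t. z + W t \<omega>) -` C \<inter> {0..}"
    using continuous_on_open_invariant[THEN iffD1, rule_format, OF cont open_C] by auto
  have "0 \<le> t" using t(2) by linarith
  then have "t \<in> A \<inter> {0..}" unfolding A(2) using t(4) by simp
  then have "t \<in> A" by simp
  then obtain \<delta> where \<delta>: "\<delta> > 0" "\<And>s. dist s t < \<delta> \<Longrightarrow> s \<in> A"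
    using A(1) by (auto simp: open_dist)
  obtain m where m: "(1 / 2) ^ m < \<delta>"
    using real_arch_pow_inv[of \<delta> "1/2"] \<delta> by auto
  \<comment> \<open>Rounding \<open>t\<close> down keeps the grid time in the interval, because
    \<open>a * 2 ^ m\<close> is an integer not above \<open>t * 2 ^ m\<close>.\<close>
  define i where "i = nat \<lfloor>t * 2 ^ m\<rfloor>"
  have "0 \<le> \<lfloor>t * 2 ^ m\<rfloor>" using \<open>0 \<le> t\<close> by simp
  then have i1: "real i \<le> t * 2 ^ m" "t * 2 ^ m < real i + 1"
    by (simp_all add: i_def)
  have "real a * 2 ^ m \<le> t * 2 ^ m" "t * 2 ^ m \<le> real b * 2 ^ m"
    using t(2,3) by simp_all
  then have "real (a * 2 ^ m) < real i + 1" "real i \<le> real (b * 2 ^ m)"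
    unfolding of_nat_mult of_nat_power of_nat_numeral using i1 by linarith+
  then have i2: "i \<in> {a * 2 ^ m..b * 2 ^ m}"
    by (simp_all only: atLeastAtMost_iff) linarith
  have "dist (real i * (1 / 2 ^ m)) t < \<delta>"
  proof -
    have "t - real i * (1 / 2 ^ m) = (t * 2 ^ m - real i) * (1 / 2 ^ m)" by (simp add: field_simps)
    also have "\<dots> \<le> 1 * (1 / 2 ^ m)" using i1 by (intro mult_right_mono) auto
    also have "\<dots> < \<delta>" using m by (simp add: power_one_over)
    finally have "t - real i * (1 / 2 ^ m) < \<delta>" .
    moreover have "real i * (1 / 2 ^ m) \<le> t" using i1 by (simp add: field_simps)
    ultimately show ?thesis by (simp add: dist_real_def)
  qed
  then have "real i * (1 / 2 ^ m) \<in> A" by (rule \<delta>(2))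
  then have "real i * (1 / 2 ^ m) \<in> A \<inter> {0..}" by simp
  then have "z + W (real i * (1 / 2 ^ m)) \<omega> \<in> C" unfolding A(2) by simp
  then show "\<omega> \<in> (\<Union>m. grid_visit m a b z)"
    using i2 t(1) unfolding grid_visit_def by blast
qed

lemma Psi_eq_SUP: "ennreal (Psi (real a) (real b) z) = (SUP m. emeasure M (grid_visit m a b z))"
proof -
  have "(SUP m. emeasure M (grid_visit m a b z)) = emeasure M (\<Union>m. grid_visit m a b z)"
    by (rule SUP_emeasure_incseq) (auto intro: incseq_grid_visit)
  then show ?thesis
    unfolding UN_grid_visit by (simp add: emeasure_visit)
qed

lemma walk_path_measurable:
  "0 \<le> h \<Longrightarrow> (\<lambda>p i. fst p + W (real i * h) (snd p)) \<in> measurable (borel \<Otimes>\<^sub>M M) (PiM (UNIV::nat set) (\<lambda>_. borel))"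
  by (rule measurable_PiM_single') auto

lemma grid_markov_measurable:
  assumes "0 \<le> h" and F: "F \<in> borel_measurable (PiM (UNIV::nat set) (\<lambda>_. borel))"
  shows "(\<lambda>y. \<integral>\<^sup>+\<omega>. F (\<lambda>i. y + W (real i * h) \<omega>) \<partial>M) \<in> borel_measurable borel"
  using measurable_compose[OF walk_path_measurable[OF assms(1)] F]
  by (intro borel_measurable_nn_integral) (simp add: split_beta')

lemma grid_visit_nn_integral:
  "emeasure M (grid_visit m a b z) = (\<integral>\<^sup>+\<omega>. indicator {x. \<exists>i\<in>{a * 2 ^ m..b * 2 ^ m}. z + x i \<in> C} (\<lambda>i. W (real i * (1 / 2 ^ m)) \<omega>) \<partial>M)"
proof -
  have "emeasure M (grid_visit m a b z) = (\<integral>\<^sup>+\<omega>. indicator (grid_visit m a b z) \<omega> \<partial>M)"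
    by simp
  also have "\<dots> = (\<integral>\<^sup>+\<omega>. indicator {x. \<exists>i\<in>{a * 2 ^ m..b * 2 ^ m}. z + x i \<in> C} (\<lambda>i. W (real i * (1 / 2 ^ m)) \<omega>) \<partial>M)"
    by (intro nn_integral_cong) (simp add: grid_visit_def indicator_def)
  finally show ?thesis .
qed

lemma indicator_path_measurable:
  assumes "finite I"
  shows "(\<lambda>x. indicator {x. \<exists>i\<in>I. z + x i \<in> C} x :: ennreal) \<in> borel_measurable (PiM (UNIV::nat set) (\<lambda>_. borel))"
proof -
  have "{x. \<exists>i\<in>I. z + x i \<in> C} = (\<Union>i\<in>I. (\<lambda>x. z + x i) -` C \<inter> space (PiM (UNIV::nat set) (\<lambda>_. borel)))"
    by (auto simp: space_PiM)
  also have "\<dots> \<in> sets (PiM (UNIV::nat set) (\<lambda>_. borel))"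
    using assms by (intro sets.finite_UN measurable_sets[OF _ measurable_C]) measurable
  finally show ?thesis by (rule borel_measurable_indicator)
qed

lemma grid_visit_measurable_z:
  "(\<lambda>z. emeasure M (grid_visit m a b z)) \<in> borel_measurable borel"
proof -
  have "(\<lambda>y. \<integral>\<^sup>+\<omega>. indicator {x. \<exists>i\<in>{a * 2 ^ m..b * 2 ^ m}. 0 + x i \<in> C} (\<lambda>i. y + W (real i * (1 / 2 ^ m)) \<omega>) \<partial>M) \<in> borel_measurable borel"
    by (intro grid_markov_measurable indicator_path_measurable) auto
  also have "(\<lambda>y. \<integral>\<^sup>+\<omega>. indicator {x. \<exists>i\<in>{a * 2 ^ m..b * 2 ^ m}. 0 + x i \<in> C} (\<lambda>i. y + W (real i * (1 / 2 ^ m)) \<omega>) \<partial>M)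
     = (\<lambda>z. emeasure M (grid_visit m a b z))"
    unfolding grid_visit_nn_integral by (simp add: indicator_def)
  finally show ?thesis .
qed

lemma grid_visit_markov:
  "emeasure M (grid_visit m (k + a) (k + b) z) = (\<integral>\<^sup>+y. emeasure M (grid_visit m a b (z + y)) \<partial>law k)"
proof -
  let ?h = "1 / 2 ^ m :: real"
  let ?F = "\<lambda>x. indicator {x. \<exists>i\<in>{a * 2 ^ m..b * 2 ^ m}. z + x i \<in> C} x :: ennreal"
  have shift: "{(k + a) * 2 ^ m..(k + b) * 2 ^ m} = (+) (k * 2 ^ m) ` {a * 2 ^ m..b * 2 ^ m}"
    by (simp add: add_mult_distrib)
  have "emeasure M (grid_visit m (k + a) (k + b) z) = (\<integral>\<^sup>+\<omega>. ?F (\<lambda>i. W (real (k * 2 ^ m + i) * ?h) \<omega>) \<partial>M)"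
  proof -
    have "(\<exists>i\<in>(+) c ` S. Q i) \<longleftrightarrow> (\<exists>i\<in>S. Q (c + i))" for c :: nat and S Q
      by blast
    then show ?thesis
      unfolding grid_visit_nn_integral shift by (simp only: indicator_def mem_Collect_eq)
  qed
  also have "\<dots> = (\<integral>\<^sup>+y. (\<integral>\<^sup>+\<omega>. ?F (\<lambda>i. y + W (real i * ?h) \<omega>) \<partial>M) \<partial>distr M borel (W (real (k * 2 ^ m) * ?h)))"
    by (intro markov indicator_path_measurable) auto
  also have "real (k * 2 ^ m) * ?h = real k" by simp
  also have "(\<lambda>y. \<integral>\<^sup>+\<omega>. ?F (\<lambda>i. y + W (real i * ?h) \<omega>) \<partial>M) = (\<lambda>y. emeasure M (grid_visit m a b (z + y)))"
    unfolding grid_visit_nn_integral by (simp add: indicator_def add.assoc)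
  finally show ?thesis .
qed

text \<open>The integer time \<open>k\<close> lies on every dyadic grid, and the identities for the
  grids pass to the limit by monotone convergence.\<close>

lemma Psi_markov:
  "ennreal (Psi (real (k + a)) (real (k + b)) z) = (\<integral>\<^sup>+y. ennreal (Psi (real a) (real b) (z + y)) \<partial>law k)"
proof -
  have "(\<integral>\<^sup>+y. ennreal (Psi (real a) (real b) (z + y)) \<partial>law k)
      = (\<integral>\<^sup>+y. (SUP m. emeasure M (grid_visit m a b (z + y))) \<partial>law k)"
    by (simp add: Psi_eq_SUP)
  also have "\<dots> = (SUP m. \<integral>\<^sup>+y. emeasure M (grid_visit m a b (z + y)) \<partial>law k)"
  proof (rule nn_integral_monotone_convergence_SUP)
    show "incseq (\<lambda>m y. emeasure M (grid_visit m a b (z + y)))"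
      by (intro incseq_SucI le_funI emeasure_mono incseq_SucD[OF incseq_grid_visit] grid_visit_sets)
    show "(\<lambda>y. emeasure M (grid_visit m a b (z + y))) \<in> borel_measurable (law k)" for m
      using measurable_compose[OF _ grid_visit_measurable_z, of "\<lambda>y. z + y" borel m a b] by simp
  qed
  finally show ?thesis
    unfolding Psi_eq_SUP grid_visit_markov by simp
qed

lemma W_nn_integral:
  assumes t: "0 < t" and [measurable]: "g \<in> borel_measurable borel"
  shows "(\<integral>\<^sup>+\<omega>. g (W t \<omega>) \<partial>M) = (\<integral>\<^sup>+x. g (sqrt t *\<^sub>R x - t *\<^sub>R \<nu>) * ennreal (gauss 1 x) \<partial>lborel)"
proof -
  have "(\<integral>\<^sup>+\<omega>. g (W t \<omega>) \<partial>M) = (\<integral>\<^sup>+y. g y \<partial>distr M borel (W t))"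
    using t by (intro nn_integral_distr[symmetric]) auto
  also have "\<dots> = (\<integral>\<^sup>+y. g y * ennreal (gauss t (y + t *\<^sub>R \<nu>)) \<partial>lborel)"
    using t by (simp add: distr_W nn_integral_density mult.commute)
  finally show ?thesis
    using gauss_scale[OF t, of g "t *\<^sub>R \<nu>"] by simp
qed

text \<open>A Lipschitz constant of \<open>\<gamma> \<bullet> w - \<epsilon> * norm w\<close>, the
  logarithm of \<open>cone_fn\<close>.\<close>

definition lip :: real where "lip = norm \<gamma> + \<epsilon>"
text \<open>At least 1 on \<open>C\<close> by \<open>C_cone\<close>, yet equal to
  \<open>exp (- \<epsilon> * norm w)\<close> after multiplication by the weight
  \<open>exp (- (\<gamma> \<bullet> w))\<close>: the majorant wanted for visit
  probabilities.\<close>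

definition cone_fn :: "'b \<Rightarrow> real" where "cone_fn w = exp (\<gamma> \<bullet> w - \<epsilon> * norm w)"
text \<open>A lower bound, uniform in \<open>w\<close> and in \<open>t \<le> 1\<close>, for the
  expectation of \<open>cone_fn (w + W t)\<close> relative to \<open>cone_fn w\<close>; the exponent
  is \<open>lip\<close> times the largest displacement \<open>norm x + norm \<nu>\<close>.\<close>

definition shrink :: real where
  "shrink = enn2real (\<integral>\<^sup>+x. ennreal (exp (- lip * (norm (x::'b) + norm \<nu>))) * ennreal (gauss 1 x) \<partial>lborel)"

lemma cone_fn_measurable [measurable]: "cone_fn \<in> borel_measurable borel"
  unfolding cone_fn_def by measurable

lemma cone_fn_pos: "0 < cone_fn w" by (simp add: cone_fn_def)

lemma cone_fn_ge_1: "w \<in> C \<Longrightarrow> 1 \<le> cone_fn w"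
  using C_cone[of w] by (simp add: cone_fn_def)

lemma cone_fn_add_bounds:
  "cone_fn w * exp (- lip * norm y) \<le> cone_fn (w + y)" "cone_fn (w + y) \<le> cone_fn w * exp (lip * norm y)"
proof -
  have "\<bar>\<gamma> \<bullet> y\<bar> \<le> norm \<gamma> * norm y" by (rule Cauchy_Schwarz_ineq2)
  moreover have "\<bar>\<epsilon> * norm (w + y) - \<epsilon> * norm w\<bar> \<le> \<epsilon> * norm y"
  proof -
    have "\<bar>norm (w + y) - norm w\<bar> \<le> norm y"
      using norm_triangle_ineq3[of "w + y" w] by simp
    then have "\<epsilon> * \<bar>norm (w + y) - norm w\<bar> \<le> \<epsilon> * norm y" using \<epsilon>_pos by simp
    then show ?thesis using \<epsilon>_pos by (simp add: right_diff_distrib[symmetric] abs_mult del: right_diff_distrib')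
  qed
  ultimately show "cone_fn w * exp (- lip * norm y) \<le> cone_fn (w + y)" "cone_fn (w + y) \<le> cone_fn w * exp (lip * norm y)"
    unfolding cone_fn_def lip_def by (auto simp: exp_add[symmetric] inner_add_right algebra_simps abs_le_iff)
qed

lemma gauss1_total: "(\<integral>\<^sup>+x. ennreal (gauss 1 (x::'b)) \<partial>lborel) = 1"
  using W_nn_integral[of 1 "\<lambda>_. 1"] emeasure_space_1 by simp

lemma lip_pos: "0 < lip" using \<epsilon>_pos by (simp add: lip_def add_nonneg_pos)

lemma shrink: "0 < shrink" "shrink \<le> 1"
  "ennreal shrink = (\<integral>\<^sup>+x. ennreal (exp (- lip * (norm (x::'b) + norm \<nu>))) * ennreal (gauss 1 x) \<partial>lborel)"
proof -
  let ?I = "(\<integral>\<^sup>+x. ennreal (exp (- lip * (norm (x::'b) + norm \<nu>))) * ennreal (gauss 1 x) \<partial>lborel)"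
  have "?I \<le> (\<integral>\<^sup>+x. 1 * ennreal (gauss 1 (x::'b)) \<partial>lborel)"
    using lip_pos by (intro nn_integral_mono mult_right_mono) (auto simp: ennreal_le_1)
  then have le: "?I \<le> 1" by (simp add: gauss1_total)
  then have ne: "?I \<noteq> \<infinity>" by (auto simp: top_unique)
  show eq: "ennreal shrink = ?I" using ne by (simp add: shrink_def less_top)
  show "shrink \<le> 1" using le unfolding eq[symmetric] by (simp add: ennreal_le_1)
  have "?I \<noteq> 0"
  proof
    assume "?I = 0"
    then have "AE x in lborel. ennreal (exp (- lip * (norm (x::'b) + norm \<nu>))) * ennreal (gauss 1 x) = 0"
      by (subst (asm) nn_integral_0_iff_AE) auto
    then have "AE x in (lborel :: 'b measure). False"
      by (rule AE_mp) (use gauss_pos[of 1] in \<open>auto simp: ennreal_eq_0_iff not_le\<close>)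
    then show False by (subst (asm) AE_iff_measurable[of UNIV]) auto
  qed
  then show "0 < shrink" using eq by (metis ennreal_eq_0_iff not_le)
qed

text \<open>For \<open>t > 0\<close> the walk is distributed like \<open>sqrt t x - t \<nu>\<close>
  with \<open>x\<close> standard Gaussian. For \<open>t \<le> 1\<close> the norm of this is at most
  \<open>norm x + norm \<nu>\<close>, and the Lipschitz bound applies.\<close>

lemma cone_fn_lower:
  assumes "0 \<le> t" "t \<le> 1"
  shows "ennreal (shrink * cone_fn w) \<le> (\<integral>\<^sup>+\<omega>. ennreal (cone_fn (w + W t \<omega>)) \<partial>M)"
proof (cases "t = 0")
  case True
  have "(\<integral>\<^sup>+\<omega>. ennreal (cone_fn (w + W t \<omega>)) \<partial>M) = (\<integral>\<^sup>+\<omega>. ennreal (cone_fn w) \<partial>M)"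
    by (intro nn_integral_cong) (simp add: True start)
  also have "\<dots> = ennreal (cone_fn w)" by (simp add: emeasure_space_1)
  finally show ?thesis
    using shrink cone_fn_pos[of w] by (simp add: ennreal_leI mult_left_le_one_le)
next
  case False
  have "ennreal (shrink * cone_fn w) = ennreal (cone_fn w) * ennreal shrink"
    using shrink(1) cone_fn_pos[of w] by (simp add: ennreal_mult[symmetric] mult.commute)
  also have "\<dots> = (\<integral>\<^sup>+x. ennreal (cone_fn w) * (ennreal (exp (- lip * (norm (x::'b) + norm \<nu>))) * ennreal (gauss 1 x)) \<partial>lborel)"
    unfolding shrink(3) by (rule nn_integral_cmult[symmetric]) measurable
  also have "\<dots> \<le> (\<integral>\<^sup>+x. ennreal (cone_fn (w + (sqrt t *\<^sub>R x - t *\<^sub>R \<nu>))) * ennreal (gauss 1 x) \<partial>lborel)"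
  proof (rule nn_integral_mono)
    fix x :: 'b
    have "norm (sqrt t *\<^sub>R x - t *\<^sub>R \<nu>) \<le> norm x + norm \<nu>"
    proof -
      have "norm (sqrt t *\<^sub>R x - t *\<^sub>R \<nu>) \<le> sqrt t * norm x + t * norm \<nu>"
        using norm_triangle_ineq4[of "sqrt t *\<^sub>R x" "t *\<^sub>R \<nu>"] assms by simp
      also have "\<dots> \<le> 1 * norm x + 1 * norm \<nu>"
        using assms by (intro add_mono mult_right_mono) auto
      finally show ?thesis by simp
    qed
    then have "exp (- lip * (norm x + norm \<nu>)) \<le> exp (- lip * norm (sqrt t *\<^sub>R x - t *\<^sub>R \<nu>))"
      using lip_pos by simp
    then have "cone_fn w * exp (- lip * (norm x + norm \<nu>)) \<le> cone_fn (w + (sqrt t *\<^sub>R x - t *\<^sub>R \<nu>))"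
      using cone_fn_add_bounds(1)[of w "sqrt t *\<^sub>R x - t *\<^sub>R \<nu>"] cone_fn_pos[of w]
      by (meson mult_left_mono order_trans less_imp_le)
    then show "ennreal (cone_fn w) * (ennreal (exp (- lip * (norm x + norm \<nu>))) * ennreal (gauss 1 x))
        \<le> ennreal (cone_fn (w + (sqrt t *\<^sub>R x - t *\<^sub>R \<nu>))) * ennreal (gauss 1 x)"
      using cone_fn_pos[of w] by (simp add: mult.assoc[symmetric] ennreal_mult[symmetric] mult_right_mono ennreal_leI less_imp_le)
  qed
  also have "\<dots> = (\<integral>\<^sup>+\<omega>. ennreal (cone_fn (w + W t \<omega>)) \<partial>M)"
    using False assms by (subst W_nn_integral) auto
  finally show ?thesis .
qed

lemma cone_fn_upper: "\<exists>K>0. \<forall>w. (\<integral>\<^sup>+\<omega>. ennreal (cone_fn (w + W 1 \<omega>)) \<partial>M) \<le> ennreal (K * cone_fn w)"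
proof -
  let ?I = "\<integral>\<^sup>+x. ennreal (exp (lip * norm (x::'b))) * ennreal (gauss 1 x) \<partial>lborel"
  define K where "K = exp (lip * norm \<nu>) * enn2real ?I + 1"
  have I: "ennreal (enn2real ?I) = ?I" using gauss_exp_finite[of lip, where 'b='b] by simp
  have "0 < K" by (simp add: K_def add_nonneg_pos)
  moreover have "(\<integral>\<^sup>+\<omega>. ennreal (cone_fn (w + W 1 \<omega>)) \<partial>M) \<le> ennreal (K * cone_fn w)" for w
  proof -
    have "(\<integral>\<^sup>+\<omega>. ennreal (cone_fn (w + W 1 \<omega>)) \<partial>M) = (\<integral>\<^sup>+x. ennreal (cone_fn (w + (sqrt 1 *\<^sub>R x - 1 *\<^sub>R \<nu>))) * ennreal (gauss 1 x) \<partial>lborel)"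
      by (subst W_nn_integral) auto
    also have "\<dots> \<le> (\<integral>\<^sup>+x. ennreal (cone_fn w * exp (lip * norm \<nu>)) * (ennreal (exp (lip * norm (x::'b))) * ennreal (gauss 1 x)) \<partial>lborel)"
    proof (rule nn_integral_mono)
      fix x :: 'b
      have "lip * norm (x - \<nu>) \<le> lip * (norm \<nu> + norm x)"
        using lip_pos norm_triangle_ineq4[of x \<nu>] by simp
      then have "cone_fn (w + (x - \<nu>)) \<le> cone_fn w * exp (lip * (norm \<nu> + norm x))"
        using cone_fn_add_bounds(2)[of w "x - \<nu>"] cone_fn_pos[of w]
        by (meson exp_le_cancel_iff mult_left_mono order_trans less_imp_le)
      also have "\<dots> = cone_fn w * exp (lip * norm \<nu>) * exp (lip * norm x)"
        by (simp add: exp_add distrib_left)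
      finally show "ennreal (cone_fn (w + (sqrt 1 *\<^sub>R x - 1 *\<^sub>R \<nu>))) * ennreal (gauss 1 x)
          \<le> ennreal (cone_fn w * exp (lip * norm \<nu>)) * (ennreal (exp (lip * norm x)) * ennreal (gauss 1 x))"
        using cone_fn_pos[of w] by (simp add: mult.assoc[symmetric] ennreal_mult[symmetric] mult_right_mono ennreal_leI less_imp_le)
    qed
    also have "\<dots> = ennreal (cone_fn w * exp (lip * norm \<nu>)) * ennreal (enn2real ?I)"
      by (simp add: I nn_integral_cmult)
    also have "\<dots> \<le> ennreal (K * cone_fn w)"
      using cone_fn_pos[of w] by (simp add: ennreal_mult[symmetric] K_def algebra_simps ennreal_leI)
    finally show ?thesis .
  qed
  ultimately show ?thesis by blast
qed

text \<open>A first-passage argument in which \<open>cone_fn\<close>, which is at least \<open>1\<close> on \<open>C\<close>, replaces a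
  submartingale: it can shrink by at most the factor \<open>shrink\<close> in expectation.\<close>

lemma first_passage:
  assumes h: "0 < h" and nh: "real n * h \<le> 1"
  shows "ennreal shrink * emeasure M {\<omega> \<in> space M. \<exists>i\<in>{0..n}. z + W (real i * h) \<omega> \<in> C}
     \<le> (\<integral>\<^sup>+\<omega>. ennreal (cone_fn (z + W (real n * h) \<omega>)) \<partial>M)"
  using nh
proof (induction n arbitrary: z)
  case (0 z)
  show ?case
  proof (cases "z \<in> C")
    case True
    have "ennreal shrink * emeasure M {\<omega> \<in> space M. \<exists>i\<in>{0..0}. z + W (real i * h) \<omega> \<in> C} \<le> ennreal shrink * 1"
      by (intro mult_left_mono measure_le_1) simp
    also have "\<dots> \<le> ennreal (shrink * cone_fn z)"
      using cone_fn_ge_1[OF True] shrink(1) by (simp add: ennreal_leI)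
    also have "\<dots> \<le> (\<integral>\<^sup>+\<omega>. ennreal (cone_fn (z + W (real 0 * h) \<omega>)) \<partial>M)"
      by (rule cone_fn_lower) auto
    finally show ?thesis .
  next
    case False
    then have "{\<omega> \<in> space M. \<exists>i\<in>{0..0}. z + W (real i * h) \<omega> \<in> C} = {}" by (auto simp: start)
    then show ?thesis by (simp only: emeasure_empty mult_zero_right zero_le)
  qed
next
  case (Suc n z)
  show ?case
  proof (cases "z \<in> C")
    case True
    have "ennreal shrink * emeasure M {\<omega> \<in> space M. \<exists>i\<in>{0..Suc n}. z + W (real i * h) \<omega> \<in> C} \<le> ennreal shrink * 1"
      by (intro mult_left_mono measure_le_1) simp
    also have "\<dots> \<le> ennreal (shrink * cone_fn z)"
      using cone_fn_ge_1[OF True] shrink(1) by (simp add: ennreal_leI)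
    \<comment> \<open>One factor \<open>shrink\<close> covers all the time left after the visit,
      which is at most 1; hence no factors accumulate in the induction.\<close>
    also have "\<dots> \<le> (\<integral>\<^sup>+\<omega>. ennreal (cone_fn (z + W (real (Suc n) * h) \<omega>)) \<partial>M)"
      using Suc.prems h by (intro cone_fn_lower) auto
    finally show ?thesis .
  next
    case False
    \<comment> \<open>Outside \<open>C\<close> the index 0 contributes nothing, so the first step is
      split off and the induction hypothesis is used from \<open>z + y\<close> with \<open>n\<close>
      steps left.\<close>
    let ?F = "\<lambda>x. indicator {x. \<exists>i\<in>{0..n}. z + x i \<in> C} x :: ennreal"
    let ?D = "distr M borel (W (real 1 * h))"
    have em: "emeasure M {\<omega> \<in> space M. \<exists>i\<in>I. y + W (r i) \<omega> \<in> C}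
      = (\<integral>\<^sup>+\<omega>. indicator {x. \<exists>i\<in>I. y + x i \<in> C} (\<lambda>i. W (r i) \<omega>) \<partial>M)" if "finite I" "\<And>i. 0 \<le> r i" for I y and r :: "nat \<Rightarrow> real"
    proof -
      have "{\<omega> \<in> space M. \<exists>i\<in>I. y + W (r i) \<omega> \<in> C} \<in> sets M"
        using that by measurable
      then have "emeasure M {\<omega> \<in> space M. \<exists>i\<in>I. y + W (r i) \<omega> \<in> C}
        = (\<integral>\<^sup>+\<omega>. indicator {\<omega> \<in> space M. \<exists>i\<in>I. y + W (r i) \<omega> \<in> C} \<omega> \<partial>M)" by simp
      also have "\<dots> = (\<integral>\<^sup>+\<omega>. indicator {x. \<exists>i\<in>I. y + x i \<in> C} (\<lambda>i. W (r i) \<omega>) \<partial>M)"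
        by (intro nn_integral_cong) (simp add: indicator_def)
      finally show ?thesis .
    qed
    have "{\<omega> \<in> space M. \<exists>i\<in>{0..Suc n}. z + W (real i * h) \<omega> \<in> C} = {\<omega> \<in> space M. \<exists>i\<in>{0..n}. z + W (real (1 + i) * h) \<omega> \<in> C}"
    proof -
      have "(\<exists>i\<in>{0..Suc n}. z + W (real i * h) \<omega> \<in> C) \<longleftrightarrow> (\<exists>i\<in>{0..n}. z + W (real (1 + i) * h) \<omega> \<in> C)"
        if "\<omega> \<in> space M" for \<omega>
        using False start[OF that] unfolding atMost_atLeast0[symmetric] atMost_Suc_eq_insert_0 by simp
      then show ?thesis by blast
    qed
    then have "emeasure M {\<omega> \<in> space M. \<exists>i\<in>{0..Suc n}. z + W (real i * h) \<omega> \<in> C}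
        = (\<integral>\<^sup>+\<omega>. ?F (\<lambda>i. W (real (1 + i) * h) \<omega>) \<partial>M)"
      using h by (simp only:) (subst em, auto)
    also have "\<dots> = (\<integral>\<^sup>+y. (\<integral>\<^sup>+\<omega>. ?F (\<lambda>i. y + W (real i * h) \<omega>) \<partial>M) \<partial>?D)"
      by (intro markov indicator_path_measurable h) auto
    finally have 1: "emeasure M {\<omega> \<in> space M. \<exists>i\<in>{0..Suc n}. z + W (real i * h) \<omega> \<in> C}
        = (\<integral>\<^sup>+y. (\<integral>\<^sup>+\<omega>. ?F (\<lambda>i. y + W (real i * h) \<omega>) \<partial>M) \<partial>?D)" .
    have Fm: "(\<lambda>y. \<integral>\<^sup>+\<omega>. ?F (\<lambda>i. y + W (real i * h) \<omega>) \<partial>M) \<in> borel_measurable ?D"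
      using grid_markov_measurable[OF less_imp_le[OF h] indicator_path_measurable] by simp
    have "ennreal shrink * emeasure M {\<omega> \<in> space M. \<exists>i\<in>{0..Suc n}. z + W (real i * h) \<omega> \<in> C}
        = (\<integral>\<^sup>+y. ennreal shrink * (\<integral>\<^sup>+\<omega>. ?F (\<lambda>i. y + W (real i * h) \<omega>) \<partial>M) \<partial>?D)"
      unfolding 1 by (rule nn_integral_cmult[symmetric, OF Fm])
    also have "\<dots> \<le> (\<integral>\<^sup>+y. (\<integral>\<^sup>+\<omega>. ennreal (cone_fn (z + (y + W (real n * h) \<omega>))) \<partial>M) \<partial>?D)"
    proof (rule nn_integral_mono)
      fix y :: 'b
      have nh: "real n * h \<le> 1" using Suc.prems h by (simp add: distrib_right)
      have "(\<integral>\<^sup>+\<omega>. ?F (\<lambda>i. y + W (real i * h) \<omega>) \<partial>M)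
          = emeasure M {\<omega> \<in> space M. \<exists>i\<in>{0..n}. z + y + W (real i * h) \<omega> \<in> C}"
        using h by (subst em) (auto simp: indicator_def add.assoc)
      with Suc.IH[OF nh, of "z + y"]
      show "ennreal shrink * (\<integral>\<^sup>+\<omega>. ?F (\<lambda>i. y + W (real i * h) \<omega>) \<partial>M) \<le> (\<integral>\<^sup>+\<omega>. ennreal (cone_fn (z + (y + W (real n * h) \<omega>))) \<partial>M)"
        by (simp add: add.assoc)
    qed
    also have "\<dots> = (\<integral>\<^sup>+\<omega>. ennreal (cone_fn (z + W (real (1 + n) * h) \<omega>)) \<partial>M)"
      by (rule markov[symmetric, OF h, of "\<lambda>x. ennreal (cone_fn (z + x n))"]) measurable
    finally show ?thesis by simp
  qed
qed

text \<open>The first-passage estimate has a constant independent of the mesh, so it survives the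
  passage to continuous time; \<open>2 ^ m\<close> steps of length \<open>1 / 2 ^ m\<close> fill the
  unit interval exactly.\<close>

lemma Psi_cone_bound: "\<exists>K>0. \<forall>z. Psi 0 1 z \<le> K * exp (\<gamma> \<bullet> z - \<epsilon> * norm z)"
proof -
  obtain K where K: "0 < K" "\<And>w. (\<integral>\<^sup>+\<omega>. ennreal (cone_fn (w + W 1 \<omega>)) \<partial>M) \<le> ennreal (K * cone_fn w)"
    using cone_fn_upper by blast
  have "Psi 0 1 z \<le> K / shrink * exp (\<gamma> \<bullet> z - \<epsilon> * norm z)" for z
  proof -
    have "ennreal shrink * emeasure M (grid_visit m 0 1 z) \<le> ennreal (K * cone_fn z)" for m
    proof -
      have one: "real (2 ^ m) * (1 / 2 ^ m) = 1" by simp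
      have gv: "grid_visit m 0 1 z = {\<omega> \<in> space M. \<exists>i\<in>{0..2 ^ m}. z + W (real i * (1 / 2 ^ m)) \<omega> \<in> C}"
        by (simp only: grid_visit_def mult_0 mult_1)
      have "ennreal shrink * emeasure M (grid_visit m 0 1 z) \<le> (\<integral>\<^sup>+\<omega>. ennreal (cone_fn (z + W (real (2 ^ m) * (1 / 2 ^ m)) \<omega>)) \<partial>M)"
        unfolding gv by (rule first_passage) (simp_all only: one, simp_all)
      also have "\<dots> \<le> ennreal (K * cone_fn z)"
        unfolding one by (rule K(2))
      finally show ?thesis .
    qed
    then have "emeasure M (grid_visit m 0 1 z) \<le> ennreal (K / shrink * cone_fn z)" for m
    proof -
      assume *: "\<And>m. ennreal shrink * emeasure M (grid_visit m 0 1 z) \<le> ennreal (K * cone_fn z)"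
      have "shrink * prob (grid_visit m 0 1 z) \<le> K * cone_fn z"
        using *[of m] shrink(1) K(1) cone_fn_pos[of z] by (simp add: emeasure_eq_measure ennreal_mult[symmetric])
      then show ?thesis
        using shrink(1) by (simp add: emeasure_eq_measure ennreal_leI field_simps)
    qed
    then have "(SUP m. emeasure M (grid_visit m 0 1 z)) \<le> ennreal (K / shrink * cone_fn z)"
      by (intro SUP_least)
    then have "ennreal (Psi 0 1 z) \<le> ennreal (K / shrink * cone_fn z)"
      using Psi_eq_SUP[of 0 1 z] by simp
    then show ?thesis
      using shrink(1) K(1) cone_fn_pos[of z] by (simp add: cone_fn_def)
  qed
  then show ?thesis using K(1) shrink(1) by (intro exI[of _ "K / shrink"]) auto
qed

subsection \<open>Decomposition at the last visit\<close>

lemma prob_law: "prob_space (law k)"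
  by (intro prob_space_distr) simp

lemma law_0: "law 0 = return borel 0"
proof -
  have "law 0 = distr M borel (\<lambda>_. 0)"
    by (intro distr_cong) (auto simp: start)
  then show ?thesis by (simp add: distr_const)
qed

lemma Psi_translate_measurable [measurable]:
  "0 \<le> a \<Longrightarrow> (\<lambda>y. Psi a b (z + y)) \<in> borel_measurable borel"
  by (rule measurable_compose[OF _ measurable_Psi]) auto

lemma Psi_markov_real:
  "Psi (real (k + a)) (real (k + b)) z = (\<integral>y. Psi (real a) (real b) (z + y) \<partial>law k)"
  by (subst integral_eq_nn_integral) (simp_all add: Psi_bounds Psi_markov[symmetric] del: of_nat_add)

lemma integrable_Psi: "0 \<le> a \<Longrightarrow> integrable (law k) (\<lambda>y. Psi a b (z + y))"
proof -
  assume "0 \<le> a"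
  interpret L: prob_space "law k" by (rule prob_law)
  show ?thesis
    using \<open>0 \<le> a\<close> by (intro L.integrable_const_bound[where B=1]) (auto simp: Psi_bounds)
qed

text \<open>\<open>chi j z\<close> is the probability of a visit from \<open>z\<close> during \<open>[0, 1]\<close> and of none during \<open>[1, j]\<close>.
  The value \<open>chi 0\<close>, the indicator of \<open>C\<close>, makes the decomposition of \<open>Psi 0 n\<close> end with the term of
  time \<open>n\<close>.\<close>

definition chi :: "nat \<Rightarrow> 'b \<Rightarrow> real" where
  "chi j z = (if j = 0 then Psi 0 0 z else Psi 0 (real j) z - Psi 1 (real j) z)"

definition visit :: "real \<Rightarrow> real \<Rightarrow> 'b \<Rightarrow> 'a set" where
  "visit a b z = {\<omega> \<in> space M. \<exists>t\<in>{a..b}. z + W t \<omega> \<in> C}"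

lemma visit_sets [measurable]: "0 \<le> a \<Longrightarrow> visit a b z \<in> sets M"
  using pred_visit[of a b z] by (simp add: visit_def pred_def)

lemma Psi_eq_visit: "Psi a b z = prob (visit a b z)"
  by (simp add: Psi_def visit_def)

lemma visit_mono: "a' \<le> a \<Longrightarrow> b \<le> b' \<Longrightarrow> visit a b z \<subseteq> visit a' b' z"
  by (fastforce simp: visit_def)

lemma chi_eq_prob:
  assumes "1 \<le> j"
  shows "chi j z = prob (visit 0 1 z - visit 1 (real j) z)"
proof -
  have "visit 0 (real j) z = visit 0 1 z \<union> visit 1 (real j) z"
  proof -
    have "{0..real j} = {0..1} \<union> {1..real j}" using assms by auto
    then show ?thesis unfolding visit_def by blast
  qed
  moreover have "prob (visit 0 1 z \<union> visit 1 (real j) z) = prob (visit 0 1 z - visit 1 (real j) z) + prob (visit 1 (real j) z)"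
    by (subst finite_measure_Union[symmetric]) (auto simp: Un_commute)
  ultimately show ?thesis
    using assms by (simp add: chi_def Psi_eq_visit)
qed

lemma chi_bounds: "0 \<le> chi j z" "chi j z \<le> Psi 0 1 z"
proof -
  show "0 \<le> chi j z"
    by (cases "j = 0") (simp_all add: chi_def[of 0] Psi_bounds chi_eq_prob)
  show "chi j z \<le> Psi 0 1 z"
  proof (cases "j = 0")
    case True
    then show ?thesis unfolding chi_def Psi_eq_visit
      using finite_measure_mono[OF visit_mono[of 0 0 0 1 z] visit_sets] by simp
  next
    case False
    then show ?thesis unfolding Psi_eq_visit
      by (subst chi_eq_prob) (auto intro!: finite_measure_mono)
  qed
qed

lemma chi_measurable [measurable]: "chi j \<in> borel_measurable borel"
  unfolding chi_def[abs_def] by (cases "j = 0") simp_all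

text \<open>The function called \<chi> in the overview; finite horizons see its approximations
  \<open>chi j\<close>, which decrease from \<open>j = 1\<close> on.\<close>

definition chi_inf :: "'b \<Rightarrow> real" where
  "chi_inf z = prob (visit 0 1 z - (\<Union>j. visit 1 (real j) z))"

lemma chi_tendsto: "(\<lambda>j. chi j z) \<longlonglongrightarrow> chi_inf z"
proof -
  have "(\<lambda>j. prob (visit 0 1 z - visit 1 (real j) z)) \<longlonglongrightarrow> prob (\<Inter>j. visit 0 1 z - visit 1 (real j) z)"
  proof (rule finite_Lim_measure_decseq)
    show "decseq (\<lambda>j. visit 0 1 z - visit 1 (real j) z)"
      unfolding decseq_def by (intro allI impI Diff_mono visit_mono) auto
  qed auto
  moreover have "(\<Inter>j. visit 0 1 z - visit 1 (real j) z) = visit 0 1 z - (\<Union>j. visit 1 (real j) z)"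
    by auto
  ultimately have "(\<lambda>j. prob (visit 0 1 z - visit 1 (real j) z)) \<longlonglongrightarrow> chi_inf z"
    by (simp add: chi_inf_def)
  then show ?thesis
    by (rule Lim_transform_eventually) (auto simp: chi_eq_prob eventually_at_top_linorder intro!: exI[of _ 1])
qed

lemma chi_inf_measurable [measurable]: "chi_inf \<in> borel_measurable borel"
  by (rule borel_measurable_LIMSEQ_real[OF chi_tendsto]) measurable

definition tilted :: "nat \<Rightarrow> 'b \<Rightarrow> real" where "tilted j w = exp (- (\<gamma> \<bullet> w)) * chi j w"
definition tilted_inf :: "'b \<Rightarrow> real" where "tilted_inf w = exp (- (\<gamma> \<bullet> w)) * chi_inf w"

lemma tilted_measurable [measurable]: "tilted j \<in> borel_measurable borel" "tilted_inf \<in> borel_measurable borel"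
  unfolding tilted_def[abs_def] tilted_inf_def[abs_def] by measurable

lemma tilted_tendsto: "(\<lambda>j. tilted j w) \<longlonglongrightarrow> tilted_inf w"
  unfolding tilted_def tilted_inf_def by (intro tendsto_intros chi_tendsto)

text \<open>One admissible constant is fixed so that the integrable majorant
  \<open>tilt_bound * exp (- \<epsilon> * norm w)\<close> can be named.\<close>

definition tilt_bound :: real where
  "tilt_bound = (SOME K. K > 0 \<and> (\<forall>z. Psi 0 1 z \<le> K * exp (\<gamma> \<bullet> z - \<epsilon> * norm z)))"

lemma tilt_bound: "0 < tilt_bound" "Psi 0 1 z \<le> tilt_bound * exp (\<gamma> \<bullet> z - \<epsilon> * norm z)"
  using someI_ex[OF Psi_cone_bound] unfolding tilt_bound_def by auto

lemma tilted_bounds: "0 \<le> tilted j w" "tilted j w \<le> tilt_bound * exp (- \<epsilon> * norm w)"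
proof -
  show "0 \<le> tilted j w" by (simp add: tilted_def chi_bounds)
  have "tilted j w \<le> exp (- (\<gamma> \<bullet> w)) * (tilt_bound * exp (\<gamma> \<bullet> w - \<epsilon> * norm w))"
    unfolding tilted_def by (intro mult_left_mono order_trans[OF chi_bounds(2) tilt_bound(2)]) simp
  also have "\<dots> = tilt_bound * exp (- \<epsilon> * norm w)"
    by (simp add: exp_diff exp_minus field_simps)
  finally show "tilted j w \<le> tilt_bound * exp (- \<epsilon> * norm w)" .
qed

lemma tilted_inf_bounds: "0 \<le> tilted_inf w" "tilted_inf w \<le> tilt_bound * exp (- \<epsilon> * norm w)"
  by (rule LIMSEQ_le_const[OF tilted_tendsto], use tilted_bounds in blast)
     (rule LIMSEQ_le_const2[OF tilted_tendsto], use tilted_bounds in blast)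

lemma integrable_bound: "integrable lborel (\<lambda>w::'b. tilt_bound * exp (- \<epsilon> * norm w))"
  by (intro integrable_mult_right integrable_exp_norm \<epsilon>_pos)

lemma integrable_tilted: "integrable lborel (tilted j)" "integrable lborel tilted_inf"
proof -
  show "integrable lborel (tilted j)"
    by (rule Bochner_Integration.integrable_bound[OF integrable_bound])
       (use tilted_bounds tilt_bound in \<open>auto intro!: AE_I2\<close>)
  show "integrable lborel tilted_inf"
    by (rule Bochner_Integration.integrable_bound[OF integrable_bound])
       (use tilted_inf_bounds tilt_bound in \<open>auto intro!: AE_I2\<close>)
qed

text \<open>The contribution, up to the factor \<bar>det A\<bar>, of a last-visit interval with
  \<open>j\<close> time units ahead to the integral behind H. Its limit \<open>mass_inf\<close>
  turns out to be H / \<bar>det A\<bar>.\<close>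

definition mass :: "nat \<Rightarrow> real" where "mass j = (\<integral>w. tilted j w \<partial>lborel)"
definition mass_inf :: real where "mass_inf = (\<integral>w. tilted_inf w \<partial>lborel)"

lemma mass_tendsto: "mass \<longlonglongrightarrow> mass_inf"
  unfolding mass_def[abs_def] mass_inf_def
  by (rule integral_dominated_convergence[OF _ _ integrable_bound])
     (use tilted_bounds tilted_tendsto in auto)

lemma mass_nonneg: "0 \<le> mass j" "0 \<le> mass_inf"
  unfolding mass_def mass_inf_def using tilted_bounds tilted_inf_bounds by (auto intro!: integral_nonneg_AE)

text \<open>A last-visit term after the tilt: the Gaussian factor is the density at
  \<open>w\<close>, at time \<open>k\<close>, of the walk with drift \<open>v\<close> started at
  \<open>z\<close>.\<close>

definition conv :: "nat \<Rightarrow> nat \<Rightarrow> 'b \<Rightarrow> real" where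
  "conv j k z = (\<integral>w. tilted j w * gauss (real k) (w - z - real k *\<^sub>R v) \<partial>lborel)"

lemma gauss_le: "0 < t \<Longrightarrow> gauss t (y::'b) \<le> (1 / sqrt (2 * pi * t)) ^ DIM('b)"
  unfolding gauss_def by (intro mult_left_le) auto

lemma integrable_conv:
  assumes "1 \<le> k"
  shows "integrable lborel (\<lambda>w. tilted j w * gauss (real k) (w - z - real k *\<^sub>R v))"
proof (rule Bochner_Integration.integrable_bound[OF integrable_mult_left[OF integrable_tilted(1)]])
  show "AE w in lborel. norm (tilted j w * gauss (real k) (w - z - real k *\<^sub>R v))
      \<le> norm (tilted j w * (1 / sqrt (2 * pi * real k)) ^ DIM('b))"
  proof (rule AE_I2)
    fix w :: 'b
    have "0 < real k" using assms by simp
    then have "\<bar>gauss (real k) (w - z - real k *\<^sub>R v)\<bar> \<le> \<bar>(1 / sqrt (2 * pi * real k)) ^ DIM('b)\<bar>"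
      using gauss_le[of "real k" "w - z - real k *\<^sub>R v"] gauss_nonneg[of "real k" "w - z - real k *\<^sub>R v"] by linarith
    then show "norm (tilted j w * gauss (real k) (w - z - real k *\<^sub>R v))
      \<le> norm (tilted j w * (1 / sqrt (2 * pi * real k)) ^ DIM('b))"
      unfolding real_norm_def abs_mult by (rule mult_left_mono) simp
  qed
qed measurable

text \<open>Tilting the displacement \<open>w - z\<close> splits the weight into
  \<open>exp (\<gamma> \<bullet> z)\<close>, which the prefactor cancels, and
  \<open>exp (- (\<gamma> \<bullet> w))\<close>, which turns \<open>chi\<close> into
  \<open>tilted\<close>.\<close>

lemma law_integral:
  assumes "1 \<le> k"
  shows "exp (- (\<gamma> \<bullet> z)) * (\<integral>y. chi j (z + y) \<partial>law k) = conv j k z"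
proof -
  have k: "0 < real k" using assms by simp
  have "(\<integral>y. chi j (z + y) \<partial>law k) = (\<integral>y. gauss (real k) (y + real k *\<^sub>R \<nu>) * chi j (z + y) \<partial>lborel)"
    unfolding distr_W[OF k] using k by (subst integral_density) (auto simp: gauss_nonneg)
  also have "\<dots> = (\<integral>y. gauss (real k) (y + real k *\<^sub>R \<nu>) * chi j (z + y) \<partial>distr lborel borel ((+) (- z)))"
    by (simp add: lborel_distr_plus)
  also have "\<dots> = (\<integral>w. gauss (real k) ((- z + w) + real k *\<^sub>R \<nu>) * chi j (z + (- z + w)) \<partial>lborel)"
    by (rule integral_distr) measurable
  also have "\<dots> = (\<integral>w. exp (\<gamma> \<bullet> z) * (tilted j w * gauss (real k) (w - z - real k *\<^sub>R v)) \<partial>lborel)"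
  proof (rule Bochner_Integration.integral_cong)
    fix w :: 'b
    have "exp (- (\<gamma> \<bullet> (w - z))) = exp (\<gamma> \<bullet> z) * exp (- (\<gamma> \<bullet> w))"
      by (simp add: exp_add[symmetric] inner_diff_right)
    then show "gauss (real k) ((- z + w) + real k *\<^sub>R \<nu>) * chi j (z + (- z + w))
        = exp (\<gamma> \<bullet> z) * (tilted j w * gauss (real k) (w - z - real k *\<^sub>R v))"
      using gauss_tilt[OF k, of "w - z"] by (simp add: tilted_def)
  qed simp
  also have "\<dots> = exp (\<gamma> \<bullet> z) * conv j k z"
    by (simp add: conv_def)
  finally show ?thesis by (simp add: exp_minus)
qed

text \<open>Both probabilities are shifted back by the Markov property at the same time
  \<open>k\<close>, so their difference is an integral of a difference; this is the reason for the
  form of \<open>chi\<close>.\<close>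

lemma last_visit_term:
  assumes "k < n"
  shows "Psi (real k) (real n) z - Psi (real (Suc k)) (real n) z = (\<integral>y. chi (n - k) (z + y) \<partial>law k)"
proof -
  have "Psi (real k) (real n) z = (\<integral>y. Psi 0 (real (n - k)) (z + y) \<partial>law k)"
    using Psi_markov_real[of k 0 "n - k" z] assms by simp
  moreover have "Psi (real (Suc k)) (real n) z = (\<integral>y. Psi 1 (real (n - k)) (z + y) \<partial>law k)"
    using Psi_markov_real[of k 1 "n - k" z] assms by simp
  ultimately show ?thesis
    using assms by (simp add: chi_def Bochner_Integration.integral_diff[OF integrable_Psi integrable_Psi])
qed

lemma last_visit_end: "Psi (real n) (real n) z = (\<integral>y. chi 0 (z + y) \<partial>law n)"
  using Psi_markov_real[of n 0 0 z] by (simp add: chi_def)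

lemma last_visit:
  assumes "a \<le> n"
  shows "Psi (real a) (real n) z = (\<Sum>k=a..n. \<integral>y. chi (n - k) (z + y) \<partial>law k)"
proof -
  have "(\<Sum>k=a..n. \<integral>y. chi (n - k) (z + y) \<partial>law k)
      = (\<Sum>k=a..<n. \<integral>y. chi (n - k) (z + y) \<partial>law k) + (\<integral>y. chi 0 (z + y) \<partial>law n)"
    using assms by (simp add: sum.last_plus add.commute)
  also have "(\<Sum>k=a..<n. \<integral>y. chi (n - k) (z + y) \<partial>law k)
      = (\<Sum>k=a..<n. - Psi (real (Suc k)) (real n) z - - Psi (real k) (real n) z)"
    by (intro sum.cong refl) (simp add: last_visit_term[symmetric])
  also have "\<dots> = Psi (real a) (real n) z - Psi (real n) (real n) z"
    using sum_Suc_diff'[OF assms, of "\<lambda>k. - Psi (real k) (real n) z"] by simp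
  finally show ?thesis by (simp add: last_visit_end)
qed

text \<open>The term \<open>k = 0\<close> stays apart, because the walk at time 0 is a point mass
  without Gaussian density.\<close>

lemma decomposition:
  "exp (- (\<gamma> \<bullet> z)) * Psi 0 (real n) z = tilted n z + (\<Sum>k=1..n. conv (n - k) k z)"
proof -
  have "{0..n} = insert 0 {1..n}" by auto
  then have "Psi 0 (real n) z = (\<integral>y. chi n (z + y) \<partial>law 0) + (\<Sum>k=1..n. \<integral>y. chi (n - k) (z + y) \<partial>law k)"
    using last_visit[of 0 n z] by simp
  also have "(\<integral>y. chi n (z + y) \<partial>law 0) = chi n z"
    unfolding law_0 by (subst integral_return) auto
  finally show ?thesis
    using law_integral by (simp add: tilted_def distrib_left sum_distrib_left)
qed

text \<open>Counting visits from time 1 on avoids the point mass at time 0, so that every term is an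
  integral of \<open>tilted\<close>; this form serves the positivity of
  \<open>mass_inf\<close>.\<close>

lemma decomposition1:
  assumes "1 \<le> n"
  shows "exp (- (\<gamma> \<bullet> z)) * Psi 1 (real n) z = (\<Sum>k=1..n. conv (n - k) k z)"
  using last_visit[OF assms, of z] law_integral by (simp add: sum_distrib_left)

lemma conv_nonneg: "0 \<le> conv j k z"
  unfolding conv_def using tilted_bounds gauss_nonneg[of "real k"] by (intro integral_nonneg_AE AE_I2 mult_nonneg_nonneg) auto

lemma gauss_total: "0 < t \<Longrightarrow> (\<integral>\<^sup>+z. ennreal (gauss t (a - z)) \<partial>(lborel :: 'b measure)) = 1"
proof -
  assume t: "0 < t"
  have g: "gauss t (a - z) = gauss t (z + (- a))" for z :: 'b
    by (simp add: gauss_def norm_minus_commute)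
  show ?thesis
    unfolding g using gauss_scale[OF t, of "\<lambda>_. 1" "- a"] by (simp add: gauss1_total)
qed

text \<open>Integrated over the starting point, the Gaussian kernel has mass 1 for every
  \<open>w\<close> and \<open>k\<close>. This is the invariance of the measure with density
  \<open>exp (- (\<gamma> \<bullet> z))\<close>.\<close>

lemma conv_total:
  assumes "1 \<le> k"
  shows "(\<integral>\<^sup>+z. ennreal (conv j k z) \<partial>lborel) = ennreal (mass j)"
proof -
  have k: "0 < real k" using assms by simp
  have c: "ennreal (conv j k z) = (\<integral>\<^sup>+w. ennreal (tilted j w) * ennreal (gauss (real k) (w - z - real k *\<^sub>R v)) \<partial>lborel)" for z
  proof -
    have "(\<integral>\<^sup>+w. ennreal (tilted j w * gauss (real k) (w - z - real k *\<^sub>R v)) \<partial>lborel) = ennreal (conv j k z)"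
      unfolding conv_def using tilted_bounds gauss_nonneg[of "real k"]
      by (intro nn_integral_eq_integral integrable_conv assms AE_I2 mult_nonneg_nonneg) auto
    then show ?thesis by (simp only: ennreal_mult'[OF tilted_bounds(1)])
  qed
  have "(\<integral>\<^sup>+z. ennreal (conv j k z) \<partial>lborel)
      = (\<integral>\<^sup>+z. \<integral>\<^sup>+w. ennreal (tilted j w) * ennreal (gauss (real k) (w - z - real k *\<^sub>R v)) \<partial>lborel \<partial>lborel)"
    by (simp only: c)
  also have "\<dots> = (\<integral>\<^sup>+w. \<integral>\<^sup>+z. ennreal (tilted j w) * ennreal (gauss (real k) (w - z - real k *\<^sub>R v)) \<partial>lborel \<partial>lborel)"
    by (rule lborel_pair.Fubini') measurable
  also have "\<dots> = (\<integral>\<^sup>+w. ennreal (tilted j w) * (\<integral>\<^sup>+z. ennreal (gauss (real k) ((w - real k *\<^sub>R v) - z)) \<partial>lborel) \<partial>lborel)"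
  proof (intro nn_integral_cong)
    fix w :: 'b
    have "w - z - real k *\<^sub>R v = (w - real k *\<^sub>R v) - z" for z by simp
    then show "(\<integral>\<^sup>+z. ennreal (tilted j w) * ennreal (gauss (real k) (w - z - real k *\<^sub>R v)) \<partial>lborel)
      = ennreal (tilted j w) * (\<integral>\<^sup>+z. ennreal (gauss (real k) ((w - real k *\<^sub>R v) - z)) \<partial>lborel)"
      by (simp only:) (rule nn_integral_cmult, measurable)
  qed
  also have "\<dots> = (\<integral>\<^sup>+w. ennreal (tilted j w) \<partial>lborel)"
    unfolding gauss_total[OF k] by simp
  also have "\<dots> = ennreal (mass j)"
    unfolding mass_def using tilted_bounds by (intro nn_integral_eq_integral integrable_tilted) auto
  finally show ?thesis .
qed

lemma conv_measurable [measurable]: "conv j k \<in> borel_measurable borel"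
  unfolding conv_def[abs_def] by measurable

text \<open>The term of time \<open>k\<close> has \<open>n - k\<close> time units ahead and
  contributes \<open>mass (n - k)\<close>. The sum has \<open>n + 1\<close> terms, so H will arise
  as a limit of Cesaro means.\<close>

lemma tilted_total:
  "(\<integral>\<^sup>+z. ennreal (exp (- (\<gamma> \<bullet> z)) * Psi 0 (real n) z) \<partial>lborel) = ennreal (\<Sum>j\<le>n. mass j)"
proof -
  have "(\<integral>\<^sup>+z. ennreal (exp (- (\<gamma> \<bullet> z)) * Psi 0 (real n) z) \<partial>lborel)
     = (\<integral>\<^sup>+z. ennreal (tilted n z) + (\<Sum>k=1..n. ennreal (conv (n - k) k z)) \<partial>lborel)"
    unfolding decomposition using tilted_bounds conv_nonneg by (simp add: sum_nonneg)
  also have "\<dots> = (\<integral>\<^sup>+z. ennreal (tilted n z) \<partial>lborel) + (\<Sum>k=1..n. \<integral>\<^sup>+z. ennreal (conv (n - k) k z) \<partial>lborel)"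
    by (subst nn_integral_add) (simp_all add: nn_integral_sum)
  also have "\<dots> = ennreal (mass n) + (\<Sum>k=1..n. ennreal (mass (n - k)))"
  proof -
    have "(\<integral>\<^sup>+z. ennreal (tilted n z) \<partial>lborel) = ennreal (mass n)"
      unfolding mass_def using tilted_bounds by (intro nn_integral_eq_integral integrable_tilted) auto
    then show ?thesis by (simp add: conv_total)
  qed
  also have "\<dots> = ennreal (mass n + (\<Sum>k=1..n. mass (n - k)))"
    using mass_nonneg by (simp add: sum_nonneg)
  also have "mass n + (\<Sum>k=1..n. mass (n - k)) = (\<Sum>k\<le>n. mass (n - k))"
    by (simp add: atMost_atLeast0 sum.atLeast_Suc_atMost)
  also have "\<dots> = (\<Sum>j\<le>n. mass j)"
    by (rule sum.reindex_bij_witness[of _ "\<lambda>k. n - k" "\<lambda>k. n - k"]) auto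
  finally show ?thesis .
qed

end

subsection \<open>Domination and positivity\<close>

text \<open>A parabola lies above its tangents, so Gaussian decay in \<open>a\<close> is traded for
  exponential decay at a rate \<open>s\<close> of choice.\<close>

lemma gauss_exponent:
  fixes a k s :: real
  assumes "0 < k"
  shows "- (a\<^sup>2) / (2 * k) \<le> - (s * a) + s\<^sup>2 * k / 2"
proof -
  have "0 \<le> (a - s * k)\<^sup>2" by simp
  then have "0 \<le> a\<^sup>2 - 2 * (s * k * a) + s\<^sup>2 * k\<^sup>2"
    by (simp add: power2_eq_square algebra_simps)
  then have "0 \<le> (a\<^sup>2 - 2 * (s * k * a) + s\<^sup>2 * k\<^sup>2) / (2 * k)"
    using assms by simp
  also have "\<dots> = a\<^sup>2 / (2 * k) - s * a + s\<^sup>2 * k / 2"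
    using assms by (simp add: field_simps power2_eq_square)
  finally show ?thesis by simp
qed

text \<open>This is \<open>x \<le> exp x\<close> at \<open>x = c * u / d\<close>, raised to the
  power \<open>d\<close>.\<close>

lemma power_le_exp:
  fixes c u :: real
  assumes "0 < c" "0 \<le> u"
  shows "u ^ d \<le> (real d / c + 1) ^ d * exp (c * u)"
proof (cases "d = 0")
  case False
  have "c * u / d \<le> exp (c * u / d)"
    using exp_ge_add_one_self[of "c * u / d"] by linarith
  then have "(c * u / d) ^ d \<le> exp (c * u / d) ^ d"
    using assms by (intro power_mono) auto
  also have "\<dots> = exp (c * u)"
    using False by (simp add: exp_of_nat_mult[symmetric])
  finally have 1: "(c * u / d) ^ d \<le> exp (c * u)" .
  have "u ^ d = (real d / c) ^ d * (c * u / d) ^ d"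
    using False assms by (simp add: power_mult_distrib[symmetric])
  also have "\<dots> \<le> (real d / c + 1) ^ d * exp (c * u)"
    using 1 assms by (intro mult_mono power_mono) auto
  finally show ?thesis .
qed (use assms in simp)

text \<open>The majorant for dominated convergence in \<open>w\<close> and in
  \<open>r = (k - t0 * u) / sqrt u\<close> together. A shift by \<open>w\<close> can move the
  argument towards the peak of the Gaussian; the price is a growing factor
  \<open>exp (\<delta> * norm w)\<close>, with \<open>\<delta>\<close> as small as desired.\<close>

lemma gauss_domination:
  fixes v :: "'b::euclidean_space"
  assumes v: "v \<noteq> 0" and t0: "0 < t0" and \<delta>: "0 < \<delta>"
  shows "\<exists>C>0. \<exists>c>0. \<forall>u\<ge>1. \<forall>k\<ge>1. \<forall>w::'b.
    sqrt u ^ DIM('b) * gauss k (w + (t0 * u - k) *\<^sub>R v) \<le> C * exp (- c * \<bar>k - t0 * u\<bar> / sqrt u + \<delta> * norm w)"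
proof -
  define n where "n = norm v"
  have n: "0 < n" using v by (simp add: n_def)
  \<comment> \<open>The slope of the tangent: at most \<open>\<delta>\<close> because of the loss
    \<open>s * norm w\<close>, and at most \<open>n / 2\<close> so that
    \<open>s\<^sup>2 * \<bar>D\<bar>\<close> uses up no more than half of
    \<open>s * n * \<bar>D\<bar>\<close>.\<close>
  define s where "s = min \<delta> (n / 2)"
  have s: "0 < s" "s \<le> \<delta>" "s \<le> n / 2" using n \<delta> by (auto simp: s_def)
  \<comment> \<open>The remaining half is \<open>2 * c * \<bar>D\<bar>\<close>: one share is the
    claimed decay, the other a reserve against the prefactor.\<close>
  define c where "c = s * n / 4"
  have c: "0 < c" using s n by (simp add: c_def)
  let ?d = "DIM('b)"
  define C1 where "C1 = sqrt (1 / (pi * t0)) ^ ?d * exp (s\<^sup>2 * t0)"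
  define C2 where "C2 = sqrt (1 / (pi * t0)) ^ ?d"
  define C3 where "C3 = (real ?d / (c * t0 / 2) + 1) ^ ?d"
  define C where "C = C1 + C2 + C3"
  have Cs: "0 < C1" "0 < C2" "0 < C3"
    using t0 c by (auto simp: C1_def C2_def C3_def add_nonneg_pos)
  have main: "sqrt u ^ ?d * gauss k (w + (t0 * u - k) *\<^sub>R v) \<le> C * exp (- c * \<bar>k - t0 * u\<bar> / sqrt u + \<delta> * norm w)"
    if u: "1 \<le> u" and k: "1 \<le> k" for u k and w :: 'b
  proof -
    define D where "D = k - t0 * u"
    define a where "a = norm (w + (t0 * u - k) *\<^sub>R v)"
    have k0: "0 < k" using k by simp
    have u0: "0 < u" using u by simp
    have su: "1 \<le> sqrt u" using u by simp
    have Dsu: "\<bar>D\<bar> / sqrt u \<le> \<bar>D\<bar>"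
      using su mult_left_mono[OF su, of "\<bar>D\<bar>"] by (simp add: divide_le_eq)
    have "norm ((t0 * u - k) *\<^sub>R v) \<le> a + norm w"
      unfolding a_def using norm_triangle_ineq4[of "w + (t0 * u - k) *\<^sub>R v" w] by simp
    then have a: "n * \<bar>D\<bar> - norm w \<le> a"
      by (simp add: D_def n_def abs_minus_commute mult.commute)
    have lhs: "sqrt u ^ ?d * gauss k (w + (t0 * u - k) *\<^sub>R v) = sqrt (u / (2 * pi * k)) ^ ?d * exp (- (a\<^sup>2) / (2 * k))"
      by (simp add: gauss_def a_def real_sqrt_divide power_divide)
    have sn: "s * norm w \<le> \<delta> * norm w" using s by (intro mult_right_mono) auto
    have aux1: "x \<le> - (4 * p) + q + r \<Longrightarrow> 0 \<le> p \<Longrightarrow> q \<le> q' \<Longrightarrow> x \<le> r + (- p + q')" for x p q q' r :: real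
      by linarith
    have aux2: "x \<le> - (2 * y) + q \<Longrightarrow> p \<le> y \<Longrightarrow> 0 \<le> y \<Longrightarrow> q \<le> q' \<Longrightarrow> x \<le> - p + q'" for x y p q q' :: real
      by linarith
    have aux3: "x \<le> - (2 * y) + q \<Longrightarrow> p \<le> y \<Longrightarrow> e \<le> y \<Longrightarrow> e = e' \<Longrightarrow> q \<le> q' \<Longrightarrow> x \<le> - e' + (- p + q')" for x y p q q' e e' :: real
      by linarith
    have neg: "- c * \<bar>D\<bar> / sqrt u = - (c * \<bar>D\<bar> / sqrt u)" by simp
    consider (mid) "t0 * u / 2 \<le> k" "k \<le> 2 * t0 * u" | (big) "2 * t0 * u < k" | (small) "k < t0 * u / 2"
      by linarith
    then obtain C' where "0 < C'" "C' \<le> C"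
      "sqrt (u / (2 * pi * k)) ^ ?d * exp (- (a\<^sup>2) / (2 * k)) \<le> C' * exp (- c * \<bar>D\<bar> / sqrt u + \<delta> * norm w)"
    proof cases
      \<comment> \<open>Around the peak the slope is \<open>s / sqrt u\<close>, the inverse of the
        fluctuation scale; the quadratic term then stays below \<open>s\<^sup>2 * t0\<close>, since
        \<open>k \<le> 2 * t0 * u\<close>.\<close>
      case mid
      have "- (a\<^sup>2) / (2 * k) \<le> - ((s / sqrt u) * a) + (s / sqrt u)\<^sup>2 * k / 2"
        by (rule gauss_exponent[OF k0])
      also have "(s / sqrt u)\<^sup>2 * k / 2 = s\<^sup>2 * (k / (2 * u))"
        using u0 by (simp add: power_divide)
      also have "\<dots> \<le> s\<^sup>2 * t0"
        using mid u0 by (intro mult_left_mono) (auto simp: field_simps)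
      also have "- ((s / sqrt u) * a) \<le> - ((s / sqrt u) * (n * \<bar>D\<bar> - norm w))"
        using a s su by (intro le_imp_neg_le mult_left_mono) auto
      also have "\<dots> = - (4 * (c * \<bar>D\<bar> / sqrt u)) + s * norm w / sqrt u"
        by (simp add: c_def algebra_simps diff_divide_distrib)
      also have "s * norm w / sqrt u \<le> s * norm w"
        using su s mult_left_mono[OF su, of "s * norm w"] by (simp add: divide_le_eq)
      finally have "- (a\<^sup>2) / (2 * k) \<le> - (4 * (c * \<bar>D\<bar> / sqrt u)) + s * norm w + s\<^sup>2 * t0" by simp
      moreover have "0 \<le> c * \<bar>D\<bar> / sqrt u" using c su by simp
      ultimately have "- (a\<^sup>2) / (2 * k) \<le> s\<^sup>2 * t0 + (- c * \<bar>D\<bar> / sqrt u + \<delta> * norm w)"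
        unfolding neg using aux1[OF _ _ sn] by blast
      moreover have "sqrt (u / (2 * pi * k)) ^ ?d \<le> sqrt (1 / (pi * t0)) ^ ?d"
      proof (intro power_mono)
        show "sqrt (u / (2 * pi * k)) \<le> sqrt (1 / (pi * t0))"
          using mid(1) t0 k0 u0 by (simp add: field_simps)
      qed (use u0 k0 in auto)
      ultimately have "sqrt (u / (2 * pi * k)) ^ ?d * exp (- (a\<^sup>2) / (2 * k))
          \<le> sqrt (1 / (pi * t0)) ^ ?d * exp (s\<^sup>2 * t0 + (- c * \<bar>D\<bar> / sqrt u + \<delta> * norm w))"
        using t0 by (intro mult_mono) auto
      also have "\<dots> = C1 * exp (- c * \<bar>D\<bar> / sqrt u + \<delta> * norm w)"
        by (simp add: C1_def exp_add)
      finally show thesis using Cs by (intro that[of C1]) (auto simp: C_def)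
    next
      \<comment> \<open>Here \<open>k \<le> 2 * D\<close>, so the full slope \<open>s\<close> is
        affordable, and \<open>\<bar>D\<bar> / sqrt u \<le> \<bar>D\<bar>\<close> returns to the
        required scale.\<close>
      case big
      have D: "k \<le> 2 * D" "0 < D" "\<bar>D\<bar> = D"
      proof -
        define p where "p = t0 * u"
        have "0 < p" "2 * p < k" "D = k - p" using big t0 u0 by (simp_all add: p_def D_def)
        then show "k \<le> 2 * D" "0 < D" "\<bar>D\<bar> = D" by simp_all
      qed
      have "- (a\<^sup>2) / (2 * k) \<le> - (s * a) + s\<^sup>2 * k / 2"
        by (rule gauss_exponent[OF k0])
      also have "s\<^sup>2 * k / 2 \<le> s\<^sup>2 * D"
        using D(1) mult_left_mono[of k "2 * D" "s\<^sup>2"] by simp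
      also have "s\<^sup>2 * D \<le> s * (n / 2) * D"
        using s D by (simp add: power2_eq_square mult_right_mono)
      also have "- (s * a) \<le> - (s * (n * \<bar>D\<bar> - norm w))"
        using a s by (intro le_imp_neg_le mult_left_mono) auto
      finally have "- (a\<^sup>2) / (2 * k) \<le> - (2 * (c * \<bar>D\<bar>)) + s * norm w"
        by (simp add: c_def algebra_simps D)
      moreover have "c * \<bar>D\<bar> / sqrt u \<le> c * \<bar>D\<bar>"
        using mult_left_mono[OF Dsu, of c] c by simp
      moreover have "0 \<le> c * \<bar>D\<bar>" using c by simp
      ultimately have "- (a\<^sup>2) / (2 * k) \<le> - c * \<bar>D\<bar> / sqrt u + \<delta> * norm w"
        unfolding neg using aux2[OF _ _ _ sn] by blast
      moreover have "sqrt (u / (2 * pi * k)) ^ ?d \<le> sqrt (1 / (pi * t0)) ^ ?d"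
      proof (intro power_mono)
        have "t0 * u \<le> k * 2" using D(1,2) k0 by (simp add: D_def)
        then show "sqrt (u / (2 * pi * k)) \<le> sqrt (1 / (pi * t0))"
          using t0 k0 u0 by (simp add: field_simps)
      qed (use u0 k0 in auto)
      ultimately have "sqrt (u / (2 * pi * k)) ^ ?d * exp (- (a\<^sup>2) / (2 * k))
          \<le> C2 * exp (- c * \<bar>D\<bar> / sqrt u + \<delta> * norm w)"
        unfolding C2_def using t0 by (intro mult_mono) auto
      then show thesis using Cs by (intro that[of C2]) (auto simp: C_def)
    next
      \<comment> \<open>The prefactor grows like a power of \<open>u\<close> when \<open>k\<close>
        stays bounded. Since \<open>t0 * u / 2 \<le> \<bar>D\<bar>\<close>, the reserve
        \<open>c * \<bar>D\<bar>\<close> pays for it.\<close>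
      case small
      have D: "k \<le> \<bar>D\<bar>" "t0 * u / 2 \<le> \<bar>D\<bar>" "0 < \<bar>D\<bar>" using small k0 by (auto simp: D_def)
      have "- (a\<^sup>2) / (2 * k) \<le> - (s * a) + s\<^sup>2 * k / 2"
        by (rule gauss_exponent[OF k0])
      also have "s\<^sup>2 * k / 2 \<le> s\<^sup>2 * \<bar>D\<bar>"
      proof -
        have "k \<le> 2 * \<bar>D\<bar>" using D(1,3) by linarith
        from mult_left_mono[OF this, of "s\<^sup>2"] show ?thesis by simp
      qed
      also have "s\<^sup>2 * \<bar>D\<bar> \<le> s * (n / 2) * \<bar>D\<bar>"
        using s D by (simp add: power2_eq_square mult_right_mono)
      also have "- (s * a) \<le> - (s * (n * \<bar>D\<bar> - norm w))"
        using a s by (intro le_imp_neg_le mult_left_mono) auto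
      finally have "- (a\<^sup>2) / (2 * k) \<le> - (2 * (c * \<bar>D\<bar>)) + s * norm w"
        by (simp add: c_def algebra_simps)
      moreover have "c * \<bar>D\<bar> / sqrt u \<le> c * \<bar>D\<bar>"
        using mult_left_mono[OF Dsu, of c] c by simp
      moreover have "c * (t0 * u / 2) \<le> c * \<bar>D\<bar>" using D(2) c by (intro mult_left_mono) auto
      moreover have "c * (t0 * u / 2) = c * t0 / 2 * u" by simp
      ultimately have "- (a\<^sup>2) / (2 * k) \<le> - (c * t0 / 2 * u) + (- c * \<bar>D\<bar> / sqrt u + \<delta> * norm w)"
        unfolding neg using aux3[OF _ _ _ _ sn] by blast
      moreover have "sqrt (u / (2 * pi * k)) ^ ?d \<le> C3 * exp (c * t0 / 2 * u)"
      proof -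
        have "1 \<le> 2 * pi * k"
          using mult_mono[of 1 "2 * pi" 1 k] k pi_gt3 by simp
        then have "u / (2 * pi * k) \<le> u" using u0 by (simp add: divide_le_eq)
        also have "u \<le> u\<^sup>2" using u by (simp add: power2_eq_square)
        finally have "sqrt (u / (2 * pi * k)) \<le> u" using u0 by (intro real_le_lsqrt) auto
        then have "sqrt (u / (2 * pi * k)) ^ ?d \<le> u ^ ?d"
          using u0 k0 by (intro power_mono) auto
        also have "\<dots> \<le> C3 * exp (c * t0 / 2 * u)"
          unfolding C3_def using c t0 u0 by (intro power_le_exp) auto
        finally show ?thesis .
      qed
      ultimately have "sqrt (u / (2 * pi * k)) ^ ?d * exp (- (a\<^sup>2) / (2 * k))
          \<le> (C3 * exp (c * t0 / 2 * u)) * exp (- (c * t0 / 2 * u) + (- c * \<bar>D\<bar> / sqrt u + \<delta> * norm w))"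
        using Cs by (intro mult_mono) auto
      also have "\<dots> = C3 * exp (- c * \<bar>D\<bar> / sqrt u + \<delta> * norm w)"
        by (simp add: exp_add[symmetric])
      finally show thesis using Cs by (intro that[of C3]) (auto simp: C_def)
    qed
    then have "sqrt (u / (2 * pi * k)) ^ ?d * exp (- (a\<^sup>2) / (2 * k)) \<le> C * exp (- c * \<bar>D\<bar> / sqrt u + \<delta> * norm w)"
      by (meson exp_ge_zero mult_right_mono order_trans)
    then show ?thesis unfolding lhs D_def .
  qed
  have "0 < C" using Cs by (simp add: C_def)
  with c main show ?thesis by blast
qed

text \<open>With the sum over last-visit times written as an integral, the substitution
  \<open>y = t0 * u + sqrt u * r\<close> and dominated convergence take the place of a Riemann-sum
  argument.\<close>

lemma sum_eq_integral_floor: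
  fixes a :: "nat \<Rightarrow> real"
  shows "(\<Sum>k=1..n. a k) = (\<integral>(y::real). (if 1 \<le> \<lfloor>y\<rfloor> \<and> \<lfloor>y\<rfloor> \<le> int n then a (nat \<lfloor>y\<rfloor>) else 0) \<partial>lborel)"
proof -
  have "(\<integral>(y::real). (if 1 \<le> \<lfloor>y\<rfloor> \<and> \<lfloor>y\<rfloor> \<le> int n then a (nat \<lfloor>y\<rfloor>) else 0) \<partial>lborel)
      = (\<integral>y. (\<Sum>k=1..n. a k * indicator {real k..<real k + 1} y) \<partial>lborel)"
  proof (rule Bochner_Integration.integral_cong)
    fix y :: real
    have ind: "indicator {real k..<real k + 1} y = (if \<lfloor>y\<rfloor> = int k then 1 else 0 :: real)" for k :: nat
      by (auto simp: indicator_def floor_eq_iff)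
    show "(if 1 \<le> \<lfloor>y\<rfloor> \<and> \<lfloor>y\<rfloor> \<le> int n then a (nat \<lfloor>y\<rfloor>) else 0)
        = (\<Sum>k=1..n. a k * indicator {real k..<real k + 1} y)"
    proof (cases "1 \<le> \<lfloor>y\<rfloor> \<and> \<lfloor>y\<rfloor> \<le> int n")
      case True
      then have "(\<Sum>k=1..n. a k * indicator {real k..<real k + 1} y) = (\<Sum>k=1..n. if k = nat \<lfloor>y\<rfloor> then a k else 0)"
        by (intro sum.cong) (auto simp: ind)
      moreover have "nat \<lfloor>y\<rfloor> \<in> {1..n}"
        unfolding atLeastAtMost_iff using True by linarith
      ultimately show ?thesis using True by simp
    next
      case False
      then have "(\<Sum>k=1..n. a k * indicator {real k..<real k + 1} y) = 0"
      proof (intro sum.neutral ballI)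
        fix k assume "k \<in> {1..n}"
        then have "\<lfloor>y\<rfloor> \<noteq> int k" using False unfolding atLeastAtMost_iff by linarith
        then show "a k * indicator {real k..<real k + 1} y = 0" by (simp add: ind)
      qed
      then show ?thesis using False by auto
    qed
  qed simp
  also have "\<dots> = (\<Sum>k=1..n. a k)"
    by (subst Bochner_Integration.integral_sum) (auto simp: integrable_indicator_iff)
  finally show ?thesis by simp
qed

context cone_hitting begin

lemma abs_gauss_le: "0 < t \<Longrightarrow> \<bar>gauss t (y::'b)\<bar> \<le> (1 / sqrt (2 * pi * t)) ^ DIM('b)"
  using gauss_le[of t y] gauss_nonneg[of t y] by simp

lemma conv_inf_tendsto:
  assumes k: "1 \<le> k"
  shows "(\<lambda>n. conv (n - k) k z) \<longlonglongrightarrow> (\<integral>w. tilted_inf w * gauss (real k) (w - z - real k *\<^sub>R v) \<partial>lborel)"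
  unfolding conv_def
proof (rule integral_dominated_convergence[where w="\<lambda>w. tilt_bound * exp (- \<epsilon> * norm w) * (1 / sqrt (2 * pi * real k)) ^ DIM('b)"])
  have k0: "0 < real k" using k by simp
  show "AE w in lborel. (\<lambda>n. tilted (n - k) w * gauss (real k) (w - z - real k *\<^sub>R v)) \<longlonglongrightarrow> tilted_inf w * gauss (real k) (w - z - real k *\<^sub>R v)"
    by (intro AE_I2 tendsto_mult tendsto_const filterlim_compose[OF tilted_tendsto] filterlim_minus_const_nat_at_top)
  show "AE w in lborel. norm (tilted (n - k) w * gauss (real k) (w - z - real k *\<^sub>R v)) \<le> tilt_bound * exp (- \<epsilon> * norm w) * (1 / sqrt (2 * pi * real k)) ^ DIM('b)" for n
    unfolding real_norm_def abs_mult
    by (intro AE_I2 mult_mono) (use tilted_bounds abs_gauss_le[OF k0] tilt_bound in auto)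
qed (auto intro!: integrable_mult_left integrable_bound[simplified])

lemma conv_dominated:
  "\<exists>C>0. \<exists>c>0. \<forall>u\<ge>1. \<forall>k\<ge>1. \<forall>w j. \<bar>tilted j w * (sqrt u ^ DIM('b) * gauss (real k) (w + (t0 * u - real k) *\<^sub>R v))\<bar>
      \<le> C * exp (- c * \<bar>real k - t0 * u\<bar> / sqrt u) * exp (- (\<epsilon> / 2) * norm w)" if t0: "0 < t0"
proof -
  \<comment> \<open>Half of the decay of \<open>tilted\<close> absorbs the factor
    \<open>exp (\<epsilon> / 2 * norm w)\<close>; the other half remains.\<close>
  have "0 < \<epsilon> / 2" using \<epsilon>_pos by simp
  from gauss_domination[OF v_ne t0 this] obtain C c where C: "0 < C" "0 < c"
    "\<And>u k w. 1 \<le> u \<Longrightarrow> 1 \<le> k \<Longrightarrow> sqrt u ^ DIM('b) * gauss k (w + (t0 * u - k) *\<^sub>R v) \<le> C * exp (- c * \<bar>k - t0 * u\<bar> / sqrt u + \<epsilon> / 2 * norm w)"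
    by blast
  have "\<bar>tilted j w * (sqrt u ^ DIM('b) * gauss (real k) (w + (t0 * u - real k) *\<^sub>R v))\<bar>
      \<le> (tilt_bound * C) * exp (- c * \<bar>real k - t0 * u\<bar> / sqrt u) * exp (- (\<epsilon> / 2) * norm w)"
    if u: "1 \<le> u" and k: "1 \<le> k" for u k w j
  proof -
    have k1: "1 \<le> real k" using k by simp
    have nn: "0 \<le> sqrt u ^ DIM('b) * gauss (real k) (w + (t0 * u - real k) *\<^sub>R v)"
      using u by (intro mult_nonneg_nonneg gauss_nonneg) auto
    have "tilted j w * (sqrt u ^ DIM('b) * gauss (real k) (w + (t0 * u - real k) *\<^sub>R v))
        \<le> (tilt_bound * exp (- \<epsilon> * norm w)) * (C * exp (- c * \<bar>real k - t0 * u\<bar> / sqrt u + \<epsilon> / 2 * norm w))"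
      using tilt_bound(1) by (intro mult_mono tilted_bounds C(3) u k1 nn) auto
    also have "\<dots> = (tilt_bound * C) * (exp (- c * \<bar>real k - t0 * u\<bar> / sqrt u) * (exp (- \<epsilon> * norm w) * exp (\<epsilon> / 2 * norm w)))"
      by (subst exp_add) (simp only: mult_ac)
    also have "exp (- \<epsilon> * norm w) * exp (\<epsilon> / 2 * norm w) = exp (- (\<epsilon> / 2) * norm w)"
      by (simp add: exp_add[symmetric])
    finally show ?thesis
      using tilted_bounds(1)[of j w] nn by (simp add: mult.assoc)
  qed
  then show ?thesis using C(1,2) tilt_bound(1) by (intro exI[of _ "tilt_bound * C"] conjI exI[of _ c]) auto
qed

definition exp_mass :: real where "exp_mass = (\<integral>w. exp (- (\<epsilon> / 2) * norm (w::'b)) \<partial>lborel)"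

lemma integrable_half: "integrable lborel (\<lambda>w::'b. exp (- (\<epsilon> / 2) * norm w))"
  by (rule integrable_exp_norm) (use \<epsilon>_pos in simp)

lemma exp_mass_nonneg: "0 \<le> exp_mass"
  unfolding exp_mass_def by (intro integral_nonneg_AE) auto

lemma conv_bound:
  assumes t0: "0 < t0"
  shows "\<exists>C>0. \<exists>c>0. \<forall>u\<ge>1. \<forall>k\<ge>1. \<forall>j.
    sqrt u ^ DIM('b) * conv j k (- (t0 * u) *\<^sub>R v) \<le> C * exp_mass * exp (- c * \<bar>real k - t0 * u\<bar> / sqrt u)"
proof -
  from conv_dominated[OF t0] obtain C c where C: "0 < C" "0 < c"
    "\<And>u k w j. 1 \<le> u \<Longrightarrow> 1 \<le> k \<Longrightarrow> \<bar>tilted j w * (sqrt u ^ DIM('b) * gauss (real k) (w + (t0 * u - real k) *\<^sub>R v))\<bar>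
      \<le> C * exp (- c * \<bar>real k - t0 * u\<bar> / sqrt u) * exp (- (\<epsilon> / 2) * norm w)"
    by blast
  have "sqrt u ^ DIM('b) * conv j k (- (t0 * u) *\<^sub>R v) \<le> C * exp_mass * exp (- c * \<bar>real k - t0 * u\<bar> / sqrt u)"
    if u: "1 \<le> u" and k: "1 \<le> k" for u k j
  proof -
    have "sqrt u ^ DIM('b) * conv j k (- (t0 * u) *\<^sub>R v)
        = (\<integral>w. sqrt u ^ DIM('b) * (tilted j w * gauss (real k) (w - (- (t0 * u) *\<^sub>R v) - real k *\<^sub>R v)) \<partial>lborel)"
      by (simp add: conv_def)
    also have "\<dots> \<le> (\<integral>w. C * exp (- c * \<bar>real k - t0 * u\<bar> / sqrt u) * exp (- (\<epsilon> / 2) * norm (w::'b)) \<partial>lborel)"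
    proof (rule integral_mono)
      fix w :: 'b
      have "w - (- (t0 * u) *\<^sub>R v) - real k *\<^sub>R v = w + (t0 * u - real k) *\<^sub>R v"
        by (simp add: scaleR_diff_left)
      then show "sqrt u ^ DIM('b) * (tilted j w * gauss (real k) (w - (- (t0 * u) *\<^sub>R v) - real k *\<^sub>R v))
          \<le> C * exp (- c * \<bar>real k - t0 * u\<bar> / sqrt u) * exp (- (\<epsilon> / 2) * norm w)"
        using order_trans[OF abs_ge_self C(3)[OF u k, of j w]] by (simp only: mult.left_commute[of "sqrt u ^ DIM('b)"])
    qed (rule integrable_mult_right[OF integrable_conv[OF k]], rule integrable_mult_right[OF integrable_half])
    also have "\<dots> = C * exp_mass * exp (- c * \<bar>real k - t0 * u\<bar> / sqrt u)"
      by (simp add: exp_mass_def)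
    finally show ?thesis .
  qed
  with C show ?thesis by blast
qed

text \<open>A nonempty open set has positive Lebesgue measure, and the Gaussian density vanishes
  nowhere.\<close>

lemma Psi_unit_pos: "0 < Psi 1 1 z"
proof -
  have em: "ennreal (Psi 1 1 z) = (\<integral>\<^sup>+y. indicator C (z + y) * ennreal (gauss 1 (y + \<nu>)) \<partial>lborel)"
  proof -
    have "ennreal (Psi 1 1 z) = emeasure M {\<omega> \<in> space M. z + W 1 \<omega> \<in> C}"
      using emeasure_visit[of 1 1 z] by simp
    also have "\<dots> = (\<integral>\<^sup>+\<omega>. indicator C (z + W 1 \<omega>) \<partial>M)"
    proof -
      have [measurable]: "(\<lambda>\<omega>. z + W 1 \<omega>) \<in> borel_measurable M" by measurable
      have "{\<omega> \<in> space M. z + W 1 \<omega> \<in> C} \<in> sets M" by measurable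
      then have "emeasure M {\<omega> \<in> space M. z + W 1 \<omega> \<in> C} = (\<integral>\<^sup>+\<omega>. indicator {\<omega> \<in> space M. z + W 1 \<omega> \<in> C} \<omega> \<partial>M)" by simp
      also have "\<dots> = (\<integral>\<^sup>+\<omega>. indicator C (z + W 1 \<omega>) \<partial>M)"
        by (intro nn_integral_cong) (simp add: indicator_def)
      finally show ?thesis .
    qed
    also have "\<dots> = (\<integral>\<^sup>+y. indicator C (z + y) \<partial>distr M borel (W 1))"
      by (rule nn_integral_distr[symmetric]) measurable
    also have "\<dots> = (\<integral>\<^sup>+y. indicator C (z + y) * ennreal (gauss 1 (y + \<nu>)) \<partial>lborel)"
      by (simp add: distr_W nn_integral_density mult.commute)
    finally show ?thesis .
  qed
  have "Psi 1 1 z \<noteq> 0"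
  proof
    assume "Psi 1 1 z = 0"
    then have "(\<integral>\<^sup>+y. indicator C (z + y) * ennreal (gauss 1 (y + \<nu>)) \<partial>lborel) = 0"
      using em by simp
    then have "AE y in lborel. indicator C (z + y) * ennreal (gauss 1 (y + \<nu>)) = 0"
      by (subst (asm) nn_integral_0_iff_AE) measurable
    then have "AE y in lborel. y \<notin> (\<lambda>y. z + y) -` C"
    proof (rule AE_mp, intro AE_I2 impI)
      fix y assume "indicator C (z + y) * ennreal (gauss 1 (y + \<nu>)) = 0"
      then show "y \<notin> (\<lambda>y. z + y) -` C"
        using gauss_pos[of 1 "y + \<nu>"] by (auto simp: indicator_def split: if_splits)
    qed
    moreover have op: "open ((\<lambda>y. z + y) -` C)"
      using open_C by (intro open_vimage continuous_intros) auto
    ultimately have "(\<lambda>y. z + y) -` C \<in> null_sets lborel"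
      by (subst AE_iff_null_sets) (auto simp: borel_open)
    moreover obtain y0 where "y0 \<in> C" using C_ne by auto
    then have "y0 - z \<in> (\<lambda>y. z + y) -` C" by simp
    then obtain e where e: "0 < e" "ball (y0 - z) e \<subseteq> (\<lambda>y. z + y) -` C"
      using op by (meson open_contains_ball)
    ultimately have "ball (y0 - z) e \<in> null_sets lborel"
      by (intro null_sets_subset[of _ _ "ball (y0 - z) e"]) auto
    then have "measure lborel (ball (y0 - z) e) = 0"
      by (simp add: null_sets_def measure_def)
    then show False using content_ball_pos[OF e(1), of "y0 - z"] by simp
  qed
  then show ?thesis using Psi_bounds(1)[of 1 1 z] by linarith
qed

text \<open>Otherwise \<open>tilted_inf\<close> vanishes almost everywhere, so each last-visit term
  from a fixed \<open>z\<close> tends to 0 as the horizon grows. By a summable bound the sum of the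
  terms tends to 0 as well, although it dominates the positive probability of being in
  \<open>C\<close> at time 1, up to a fixed factor.\<close>

lemma mass_inf_pos: "0 < mass_inf"
proof (rule ccontr)
  assume "\<not> 0 < mass_inf"
  then have "mass_inf = 0" using mass_nonneg by linarith
  then have ae: "AE w in lborel. tilted_inf w = 0"
    unfolding mass_inf_def using tilted_inf_bounds by (subst (asm) integral_nonneg_eq_0_iff_AE[OF integrable_tilted(2)]) auto
  \<comment> \<open>The start that \<open>conv_bound\<close> uses for \<open>t0 = u = 1\<close>,
    where it gives geometric decay in \<open>k\<close>, uniformly in the horizon.\<close>
  define z where "z = - (1 * 1) *\<^sub>R v"
  from conv_bound[of 1] obtain C c where C: "0 < C" "0 < c"
    "\<And>k j. 1 \<le> k \<Longrightarrow> conv j k z \<le> C * exp_mass * exp (- c * \<bar>real k - 1\<bar>)"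
    unfolding z_def by (force dest: spec[of _ "1::real"])
  define a where "a n k = (if 1 \<le> k \<and> k \<le> n then conv (n - k) k z else 0)" for n k
  define h where "h k = C * exp_mass * exp c * exp (- c) ^ k" for k :: nat
  have h: "summable h"
    unfolding h_def using C(2) by (intro summable_mult summable_geometric) simp
  have an: "norm (a n k) \<le> h k" for n k
  proof (cases "1 \<le> k \<and> k \<le> n")
    case True
    have "conv (n - k) k z \<le> C * exp_mass * exp (- c * \<bar>real k - 1\<bar>)" using C(3) True by simp
    also have "exp (- c * \<bar>real k - 1\<bar>) = exp c * exp (- c) ^ k"
      using True by (simp add: exp_of_nat_mult[symmetric] exp_add[symmetric] algebra_simps)
    finally show ?thesis using True conv_nonneg by (simp add: a_def h_def)
  next
    case False
    then show ?thesis using C(1) exp_mass_nonneg by (auto simp: a_def h_def)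
  qed
  have lim: "(\<lambda>n. a n k) \<longlonglongrightarrow> 0" for k
  proof (cases "1 \<le> k")
    case True
    have "(\<integral>w. tilted_inf w * gauss (real k) (w - z - real k *\<^sub>R v) \<partial>lborel) = (\<integral>w. 0 \<partial>(lborel :: 'b measure))"
      using ae by (intro integral_cong_AE) auto
    then have "(\<lambda>n. conv (n - k) k z) \<longlonglongrightarrow> 0"
      using conv_inf_tendsto[OF True, of z] by simp
    then show ?thesis
      by (rule Lim_transform_eventually)
         (use True in \<open>auto simp: a_def eventually_at_top_linorder intro!: exI[of _ k]\<close>)
  qed (simp add: a_def)
  have "(\<lambda>n. \<Sum>k. a n k) \<longlonglongrightarrow> (\<Sum>k. 0::real)"
    by (rule tannerys_theorem[where a="\<lambda>k n. a n k" and M=h, THEN conjunct2, THEN conjunct2])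
       (use h an lim in \<open>auto intro!: always_eventually\<close>)
  then have lim0: "(\<lambda>n. \<Sum>k. a n k) \<longlonglongrightarrow> 0" by simp
  have "exp (- (\<gamma> \<bullet> z)) * Psi 1 1 z \<le> (\<Sum>k. a n k)" if n: "1 \<le> n" for n
  proof -
    have "(\<Sum>k. a n k) = (\<Sum>k\<in>{1..n}. a n k)"
      by (rule suminf_finite) (auto simp: a_def)
    also have "\<dots> = exp (- (\<gamma> \<bullet> z)) * Psi 1 (real n) z"
      using decomposition1[OF n, of z] by (simp add: a_def)
    also have "\<dots> \<ge> exp (- (\<gamma> \<bullet> z)) * Psi 1 1 z"
      unfolding Psi_eq_visit using n by (intro mult_left_mono finite_measure_mono visit_mono) auto
    finally show ?thesis .
  qed
  then have "exp (- (\<gamma> \<bullet> z)) * Psi 1 1 z \<le> 0"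
    by (intro LIMSEQ_le_const[OF lim0]) blast
  then show False using Psi_unit_pos[of z] by (simp add: mult_le_0_iff)
qed

subsection \<open>Asymptotics of visit probabilities\<close>

lemma floor_scaling:
  fixes r :: real
  assumes t0: "0 < t0"
  defines "k \<equiv> \<lambda>u. real (nat \<lfloor>t0 * u + sqrt u * r\<rfloor>)"
  shows "((\<lambda>u. k u / u) \<longlongrightarrow> t0) at_top" "((\<lambda>u. (t0 * u - k u) / sqrt u) \<longlongrightarrow> - r) at_top"
    "filterlim (\<lambda>u. t0 * u + sqrt u * r) at_top at_top"
proof -
  define y where "y u = t0 * u + sqrt u * r" for u
  show y: "filterlim (\<lambda>u. t0 * u + sqrt u * r) at_top at_top"
    using t0 by real_asymp
  have k: "eventually (\<lambda>u. k u = y u - frac (y u)) at_top"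
  proof -
    have "eventually (\<lambda>u. 1 \<le> y u) at_top"
      using y unfolding y_def filterlim_at_top by blast
    then show ?thesis
      by eventually_elim (simp add: k_def y_def frac_def)
  qed
  have fr: "((\<lambda>u. frac (y u) / sqrt u) \<longlongrightarrow> 0) at_top"
  proof (rule tendsto_sandwich[where f="\<lambda>_. 0" and h="\<lambda>u. 1 / sqrt u"])
    show "((\<lambda>u. 1 / sqrt u :: real) \<longlongrightarrow> 0) at_top" by real_asymp
    show "eventually (\<lambda>u. 0 \<le> frac (y u) / sqrt u) at_top"
      using eventually_gt_at_top[of 0] by eventually_elim simp
    show "eventually (\<lambda>u. frac (y u) / sqrt u \<le> 1 / sqrt u) at_top"
      using eventually_gt_at_top[of 0]
    proof eventually_elim
      case (elim u)
      then show ?case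
        using frac_lt_1[of "y u"] by (simp add: divide_right_mono)
    qed
  qed simp
  have inv: "((\<lambda>u. 1 / sqrt u :: real) \<longlongrightarrow> 0) at_top" by real_asymp
  have "((\<lambda>u. - r + frac (y u) / sqrt u) \<longlongrightarrow> - r + 0) at_top"
    by (intro tendsto_intros fr)
  moreover have "eventually (\<lambda>u. - r + frac (y u) / sqrt u = (t0 * u - k u) / sqrt u) at_top"
    using k eventually_gt_at_top[of 0]
  proof eventually_elim
    case (elim u)
    have "t0 * u - k u = frac (y u) - sqrt u * r" using elim(1) by (simp add: y_def)
    then show ?case using elim(2) by (simp add: diff_divide_distrib)
  qed
  ultimately show "((\<lambda>u. (t0 * u - k u) / sqrt u) \<longlongrightarrow> - r) at_top"
    using Lim_transform_eventually by fastforce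
  have "((\<lambda>u. t0 + r * (1 / sqrt u) - frac (y u) / sqrt u * (1 / sqrt u)) \<longlongrightarrow> t0 + r * 0 - 0 * 0) at_top"
    by (intro tendsto_intros fr inv)
  moreover have "eventually (\<lambda>u. t0 + r * (1 / sqrt u) - frac (y u) / sqrt u * (1 / sqrt u) = k u / u) at_top"
    using k eventually_gt_at_top[of 0]
  proof eventually_elim
    case (elim u)
    define s where "s = sqrt u"
    have s: "0 < s" "u = s * s" using elim(2) by (simp_all add: s_def)
    have "k u / u = (t0 * (s * s) + s * r - frac (y u)) / (s * s)"
      using elim(1) by (simp only: y_def s_def[symmetric] s(2)[symmetric])
    also have "\<dots> = t0 + r * (1 / s) - frac (y u) / s * (1 / s)"
      using s(1) by (simp add: field_simps)
    finally show ?case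
      by (simp only: s_def)
  qed
  ultimately show "((\<lambda>u. k u / u) \<longlongrightarrow> t0) at_top"
    using Lim_transform_eventually by fastforce
qed

text \<open>The right side involves only \<open>k / u\<close>, \<open>(t0 * u - k) / sqrt u\<close>
  and \<open>w / sqrt u\<close>, which converge when \<open>k\<close> follows
  \<open>t0 * u + sqrt u * r\<close>.\<close>

lemma gauss_rescaled:
  assumes "0 < u" "0 < k"
  shows "sqrt u ^ DIM('b) * gauss k (w + (t0 * u - k) *\<^sub>R v)
    = (1 / sqrt (2 * pi * (k / u))) ^ DIM('b) * exp (- (norm ((1 / sqrt u) *\<^sub>R w + ((t0 * u - k) / sqrt u) *\<^sub>R v))\<^sup>2 / (2 * (k / u)))"
proof -
  have "(1 / sqrt u) *\<^sub>R w + ((t0 * u - k) / sqrt u) *\<^sub>R v = (1 / sqrt u) *\<^sub>R (w + (t0 * u - k) *\<^sub>R v)"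
    by (simp add: scaleR_add_right)
  then have "(norm ((1 / sqrt u) *\<^sub>R w + ((t0 * u - k) / sqrt u) *\<^sub>R v))\<^sup>2 = (norm (w + (t0 * u - k) *\<^sub>R v))\<^sup>2 / u"
    using assms by (simp add: power_divide)
  moreover have "sqrt u ^ DIM('b) * (1 / sqrt (2 * pi * k)) ^ DIM('b) = (1 / sqrt (2 * pi * (k / u))) ^ DIM('b)"
    using assms by (simp add: power_mult_distrib[symmetric] real_sqrt_divide real_sqrt_mult)
  ultimately show ?thesis
    using assms unfolding gauss_def by (simp add: mult.assoc[symmetric])
qed

text \<open>Since \<open>w / sqrt u\<close> tends to 0, the limit is free of \<open>w\<close>. This
  separates the integral over \<open>w\<close>, which yields \<open>mass_inf\<close>, from the
  Gaussian in \<open>r\<close>.\<close>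

lemma gauss_local_limit:
  assumes t0: "0 < t0"
  shows "((\<lambda>u. sqrt u ^ DIM('b) * gauss (real (nat \<lfloor>t0 * u + sqrt u * r\<rfloor>)) (w + (t0 * u - real (nat \<lfloor>t0 * u + sqrt u * r\<rfloor>)) *\<^sub>R v))
     \<longlongrightarrow> (1 / sqrt (2 * pi * t0)) ^ DIM('b) * exp (- (r\<^sup>2 * (norm v)\<^sup>2) / (2 * t0))) at_top"
proof -
  define k where "k u = real (nat \<lfloor>t0 * u + sqrt u * r\<rfloor>)" for u
  have inv: "((\<lambda>u. 1 / sqrt u :: real) \<longlongrightarrow> 0) at_top" by real_asymp
  have lim: "((\<lambda>u. (1 / sqrt (2 * pi * (k u / u))) ^ DIM('b) * exp (- (norm ((1 / sqrt u) *\<^sub>R w + ((t0 * u - k u) / sqrt u) *\<^sub>R v))\<^sup>2 / (2 * (k u / u))))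
     \<longlongrightarrow> (1 / sqrt (2 * pi * t0)) ^ DIM('b) * exp (- (norm (0 *\<^sub>R w + (- r) *\<^sub>R v))\<^sup>2 / (2 * t0))) at_top"
    using t0 unfolding k_def by (intro tendsto_intros floor_scaling inv) auto
  have ev: "eventually (\<lambda>u. (1 / sqrt (2 * pi * (k u / u))) ^ DIM('b) * exp (- (norm ((1 / sqrt u) *\<^sub>R w + ((t0 * u - k u) / sqrt u) *\<^sub>R v))\<^sup>2 / (2 * (k u / u)))
     = sqrt u ^ DIM('b) * gauss (k u) (w + (t0 * u - k u) *\<^sub>R v)) at_top"
  proof -
    have "eventually (\<lambda>u. 1 \<le> t0 * u + sqrt u * r) at_top"
      using floor_scaling(3)[OF t0, of r] unfolding filterlim_at_top by blast
    then show ?thesis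
      using eventually_gt_at_top[of 0]
    proof eventually_elim
      case (elim u)
      then have "0 < k u" by (simp add: k_def)
      then show ?case using gauss_rescaled[OF elim(2)] by simp
    qed
  qed
  have "norm (0 *\<^sub>R w + (- r) *\<^sub>R v) ^ 2 = r\<^sup>2 * (norm v)\<^sup>2"
    by (simp add: power_mult_distrib)
  with Lim_transform_eventually[OF lim ev] show ?thesis
    unfolding k_def by simp
qed

text \<open>The condition on \<open>n\<close> makes the time left after \<open>k\<close> grow
  without bound, so that \<open>tilted (n u - k)\<close> converges to
  \<open>tilted_inf\<close>.\<close>

lemma conv_local_limit:
  assumes t0: "0 < t0" and n: "filterlim (\<lambda>u. real (n u) - (t0 * u + sqrt u * r)) at_top at_top"
  shows "((\<lambda>u. sqrt u ^ DIM('b) * conv (n u - nat \<lfloor>t0 * u + sqrt u * r\<rfloor>) (nat \<lfloor>t0 * u + sqrt u * r\<rfloor>) (- (t0 * u) *\<^sub>R v))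
     \<longlongrightarrow> mass_inf * ((1 / sqrt (2 * pi * t0)) ^ DIM('b) * exp (- (r\<^sup>2 * (norm v)\<^sup>2) / (2 * t0)))) at_top"
proof -
  define k where "k u = nat \<lfloor>t0 * u + sqrt u * r\<rfloor>" for u
  define Q where "Q = (1 / sqrt (2 * pi * t0)) ^ DIM('b) * exp (- (r\<^sup>2 * (norm v)\<^sup>2) / (2 * t0))"
  from conv_dominated[OF t0] obtain C c where C: "0 < C" "0 < c"
    "\<And>u k w j. 1 \<le> u \<Longrightarrow> 1 \<le> k \<Longrightarrow> \<bar>tilted j w * (sqrt u ^ DIM('b) * gauss (real k) (w + (t0 * u - real k) *\<^sub>R v))\<bar>
      \<le> C * exp (- c * \<bar>real k - t0 * u\<bar> / sqrt u) * exp (- (\<epsilon> / 2) * norm w)"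
    by blast
  have y1: "eventually (\<lambda>u. 1 \<le> t0 * u + sqrt u * r) at_top"
    using floor_scaling(3)[OF t0, of r] unfolding filterlim_at_top by blast
  have nk: "filterlim (\<lambda>u. n u - k u) at_top at_top"
    unfolding filterlim_at_top
  proof
    fix Z :: nat
    have "eventually (\<lambda>u. real Z \<le> real (n u) - (t0 * u + sqrt u * r)) at_top"
      using n unfolding filterlim_at_top by blast
    then show "eventually (\<lambda>u. Z \<le> n u - k u) at_top"
      using y1
    proof eventually_elim
      case (elim u)
      have "real (k u) \<le> t0 * u + sqrt u * r"
        using elim(2) by (simp add: k_def)
      then have "real (k u + Z) \<le> real (n u)" using elim(1) by simp
      then have "k u + Z \<le> n u" by (simp only: of_nat_le_iff)
      then show ?case by simp
    qed
  qed
  have "((\<lambda>u. \<integral>w. tilted (n u - k u) w * (sqrt u ^ DIM('b) * gauss (real (k u)) (w + (t0 * u - real (k u)) *\<^sub>R v)) \<partial>lborel)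
      \<longlongrightarrow> (\<integral>w. tilted_inf w * Q \<partial>lborel)) at_top"
  proof (rule integral_dominated_convergence_at_top[where w="\<lambda>w. C * exp (- (\<epsilon> / 2) * norm w)"])
    show "integrable lborel (\<lambda>w::'b. C * exp (- (\<epsilon> / 2) * norm w))"
      by (rule integrable_mult_right[OF integrable_half])
    show "eventually (\<lambda>u. AE w in lborel. norm (tilted (n u - k u) w * (sqrt u ^ DIM('b) * gauss (real (k u)) (w + (t0 * u - real (k u)) *\<^sub>R v)))
        \<le> C * exp (- (\<epsilon> / 2) * norm w)) at_top"
      using y1 eventually_ge_at_top[of 1]
    proof eventually_elim
      case (elim u)
      have k1: "1 \<le> k u" using elim(1) by (simp add: k_def le_nat_floor)
      show ?case
      proof (rule AE_I2)
        fix w :: 'b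
        have "C * exp (- c * \<bar>real (k u) - t0 * u\<bar> / sqrt u) * exp (- (\<epsilon> / 2) * norm w) \<le> C * 1 * exp (- (\<epsilon> / 2) * norm w)"
          using C(1,2) elim(2) by (intro mult_right_mono mult_left_mono) auto
        then show "norm (tilted (n u - k u) w * (sqrt u ^ DIM('b) * gauss (real (k u)) (w + (t0 * u - real (k u)) *\<^sub>R v)))
            \<le> C * exp (- (\<epsilon> / 2) * norm w)"
          using C(3)[OF elim(2) k1, of "n u - k u" w] by simp
      qed
    qed
    show "AE w in lborel. ((\<lambda>u. tilted (n u - k u) w * (sqrt u ^ DIM('b) * gauss (real (k u)) (w + (t0 * u - real (k u)) *\<^sub>R v))) \<longlongrightarrow> tilted_inf w * Q) at_top"
      unfolding Q_def
      by (intro AE_I2 tendsto_mult filterlim_compose[OF tilted_tendsto nk] gauss_local_limit[OF t0, of r, folded k_def])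
  qed measurable
  moreover have "(\<integral>w. tilted_inf w * Q \<partial>lborel) = mass_inf * Q"
    by (simp add: mass_inf_def)
  moreover have "(\<integral>w. tilted (n u - k u) w * (sqrt u ^ DIM('b) * gauss (real (k u)) (w + (t0 * u - real (k u)) *\<^sub>R v)) \<partial>lborel)
      = sqrt u ^ DIM('b) * conv (n u - k u) (k u) (- (t0 * u) *\<^sub>R v)" for u
  proof -
    have "w - (- (t0 * u) *\<^sub>R v) - real (k u) *\<^sub>R v = w + (t0 * u - real (k u)) *\<^sub>R v" for w :: 'b
      by (simp add: scaleR_diff_left)
    then have "conv (n u - k u) (k u) (- (t0 * u) *\<^sub>R v) = (\<integral>w. tilted (n u - k u) w * gauss (real (k u)) (w + (t0 * u - real (k u)) *\<^sub>R v) \<partial>lborel)"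
      by (simp only: conv_def)
    then show ?thesis
      by (simp only: mult.left_commute[of _ "sqrt u ^ DIM('b)"] integral_mult_right_zero)
  qed
  ultimately show ?thesis
    unfolding Q_def k_def by (simp only:)
qed

text \<open>\<open>R\<close> collects the rescaled last-visit times that eventually lie before the
  horizon \<open>n u\<close>. Two choices are used: \<open>UNIV\<close> for visits at any time, and
  a half line for the law of the hitting time.\<close>

theorem Psi_asymptotics:
  fixes n :: "real \<Rightarrow> nat"
  assumes t0: "0 < t0" and R [measurable]: "R \<in> sets borel"
    and lim: "AE r in lborel. (r \<in> R \<and> filterlim (\<lambda>u. real (n u) - (t0 * u + sqrt u * r)) at_top at_top)
        \<or> (r \<notin> R \<and> filterlim (\<lambda>u. real (n u) - (t0 * u + sqrt u * r)) at_bot at_top)"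
  shows "((\<lambda>u. sqrt u ^ (DIM('b) - 1) * (exp (t0 * u * (\<gamma> \<bullet> v)) * Psi 0 (real (n u)) (- (t0 * u) *\<^sub>R v)))
     \<longlongrightarrow> mass_inf * ((1 / sqrt (2 * pi * t0)) ^ DIM('b) * (\<integral>r. indicator R r * exp (- (r\<^sup>2 * (norm v)\<^sup>2) / (2 * t0)) \<partial>lborel))) at_top"
proof -
  define z where "z u = - (t0 * u) *\<^sub>R v" for u
  define y where "y u r = t0 * u + sqrt u * r" for u r
  define T where "T u r = (if 1 \<le> \<lfloor>y u r\<rfloor> \<and> \<lfloor>y u r\<rfloor> \<le> int (n u)
     then sqrt u ^ DIM('b) * conv (n u - nat \<lfloor>y u r\<rfloor>) (nat \<lfloor>y u r\<rfloor>) (z u) else 0)" for u r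
  define Q where "Q r = (1 / sqrt (2 * pi * t0)) ^ DIM('b) * exp (- (r\<^sup>2 * (norm v)\<^sup>2) / (2 * t0))" for r
  from conv_bound[OF t0] obtain C c where C: "0 < C" "0 < c"
    "\<And>u k j. 1 \<le> u \<Longrightarrow> 1 \<le> k \<Longrightarrow> sqrt u ^ DIM('b) * conv j k (z u) \<le> C * exp_mass * exp (- c * \<bar>real k - t0 * u\<bar> / sqrt u)"
    unfolding z_def by blast
  \<comment> \<open>One factor \<open>sqrt u\<close> is consumed by the substitution for
    \<open>k\<close>, whence the exponent \<open>DIM('b) - 1\<close>.\<close>
  have sum_eq: "sqrt u ^ (DIM('b) - 1) * (\<Sum>k=1..n u. conv (n u - k) k (z u)) = (\<integral>r. T u r \<partial>lborel)" if u: "1 \<le> u" for u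
  proof -
    have su: "sqrt u \<noteq> 0" "\<bar>sqrt u\<bar> = sqrt u" using u by auto
    have "sqrt u ^ (DIM('b) - 1) * (\<Sum>k=1..n u. conv (n u - k) k (z u))
        = sqrt u ^ (DIM('b) - 1) * (sqrt u * (\<integral>r. (if 1 \<le> \<lfloor>y u r\<rfloor> \<and> \<lfloor>y u r\<rfloor> \<le> int (n u)
           then conv (n u - nat \<lfloor>y u r\<rfloor>) (nat \<lfloor>y u r\<rfloor>) (z u) else 0) \<partial>lborel))"
      unfolding sum_eq_integral_floor[of "\<lambda>k. conv (n u - k) k (z u)"] y_def
      by (subst lborel_integral_real_affine[OF su(1), of _ "t0 * u"]) (simp add: su)
    also have "\<dots> = sqrt u ^ DIM('b) * (\<integral>r. (if 1 \<le> \<lfloor>y u r\<rfloor> \<and> \<lfloor>y u r\<rfloor> \<le> int (n u)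
           then conv (n u - nat \<lfloor>y u r\<rfloor>) (nat \<lfloor>y u r\<rfloor>) (z u) else 0) \<partial>lborel)"
      by (simp only: mult.assoc[symmetric] power_Suc2[symmetric] Suc_diff_1[OF DIM_positive])
    also have "\<dots> = (\<integral>r. T u r \<partial>lborel)"
      unfolding T_def by (subst integral_mult_right_zero[symmetric]) (intro Bochner_Integration.integral_cong, auto)
    finally show ?thesis .
  qed
  have T_meas: "(\<lambda>r. T u r) \<in> borel_measurable lborel" for u
  proof -
    have y: "(\<lambda>r. \<lfloor>y u r\<rfloor>) \<in> measurable lborel (count_space UNIV)"
      unfolding y_def by measurable
    show ?thesis
      unfolding T_def
      by (rule measurable_compose[OF y, of "\<lambda>i. if 1 \<le> i \<and> i \<le> int (n u)
        then sqrt u ^ DIM('b) * conv (n u - nat i) (nat i) (z u) else 0"]) simp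
  qed
  \<comment> \<open>Rounding displaces \<open>k\<close> by less than 1, hence \<open>r\<close> by
    less than 1 as \<open>u\<close> is at least 1; this costs the factor
    \<open>exp c\<close>.\<close>
  have T_bound: "norm (T u r) \<le> C * exp_mass * exp c * exp (- c * \<bar>r\<bar>)" if u: "1 \<le> u" for u r
  proof (cases "1 \<le> \<lfloor>y u r\<rfloor> \<and> \<lfloor>y u r\<rfloor> \<le> int (n u)")
    case True
    define k where "k = nat \<lfloor>y u r\<rfloor>"
    have k: "1 \<le> k" "real k \<le> y u r" "y u r < real k + 1"
      using True by (simp_all add: k_def le_nat_iff)
    have su: "1 \<le> sqrt u" using u by simp
    have "sqrt u * \<bar>r\<bar> - 1 \<le> \<bar>real k - t0 * u\<bar>"
    proof -
      have "\<bar>sqrt u * r\<bar> = sqrt u * \<bar>r\<bar>" using su by (simp add: abs_mult)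
      moreover have "\<bar>sqrt u * r\<bar> \<le> \<bar>real k - t0 * u\<bar> + 1"
        using k(2,3) unfolding y_def by linarith
      ultimately show ?thesis by linarith
    qed
    then have "sqrt u * (\<bar>r\<bar> - 1) \<le> \<bar>real k - t0 * u\<bar>"
      unfolding right_diff_distrib using su by linarith
    then have "\<bar>r\<bar> - 1 \<le> \<bar>real k - t0 * u\<bar> / sqrt u"
      using su by (simp add: le_divide_eq mult.commute)
    then have "c * (\<bar>r\<bar> - 1) \<le> c * (\<bar>real k - t0 * u\<bar> / sqrt u)"
      using C(2) by (intro mult_left_mono) auto
    then have "exp (- c * \<bar>real k - t0 * u\<bar> / sqrt u) \<le> exp (c + - c * \<bar>r\<bar>)"
      by (simp add: algebra_simps)
    then have "C * exp_mass * exp (- c * \<bar>real k - t0 * u\<bar> / sqrt u) \<le> C * exp_mass * exp (c + - c * \<bar>r\<bar>)"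
      using C(1) exp_mass_nonneg by (intro mult_left_mono) auto
    also have "\<dots> = C * exp_mass * exp c * exp (- c * \<bar>r\<bar>)"
      by (subst exp_add) simp
    finally have "sqrt u ^ DIM('b) * conv (n u - k) k (z u) \<le> C * exp_mass * exp c * exp (- c * \<bar>r\<bar>)"
      using C(3)[OF u k(1), of "n u - k"] by linarith
    then show ?thesis
      using True conv_nonneg[of "n u - k" k "z u"] u by (simp add: T_def k_def)
  next
    case False
    then have "T u r = 0" unfolding T_def by (rule if_not_P)
    then show ?thesis using C(1) exp_mass_nonneg by simp
  qed
  have "((\<lambda>u. \<integral>r. T u r \<partial>lborel) \<longlongrightarrow> (\<integral>r. indicator R r * (mass_inf * Q r) \<partial>lborel)) at_top"
  proof (rule integral_dominated_convergence_at_top[where w="\<lambda>r. C * exp_mass * exp c * exp (- c * \<bar>r\<bar>)"])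
    show "integrable lborel (\<lambda>r. C * exp_mass * exp c * exp (- c * \<bar>r\<bar>))"
      using integrable_exp_norm[OF C(2), where 'b=real] by (intro integrable_mult_right) simp
    show "eventually (\<lambda>u. AE r in lborel. norm (T u r) \<le> C * exp_mass * exp c * exp (- c * \<bar>r\<bar>)) at_top"
      using eventually_ge_at_top[of 1] by eventually_elim (intro AE_I2 T_bound)
    show "AE r in lborel. ((\<lambda>u. T u r) \<longlongrightarrow> indicator R r * (mass_inf * Q r)) at_top"
      using lim
    proof (rule AE_mp, intro AE_I2 impI)
      fix r
      assume "(r \<in> R \<and> filterlim (\<lambda>u. real (n u) - (t0 * u + sqrt u * r)) at_top at_top)
        \<or> (r \<notin> R \<and> filterlim (\<lambda>u. real (n u) - (t0 * u + sqrt u * r)) at_bot at_top)"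
      then show "((\<lambda>u. T u r) \<longlongrightarrow> indicator R r * (mass_inf * Q r)) at_top"
      proof
        assume r: "r \<in> R \<and> filterlim (\<lambda>u. real (n u) - (t0 * u + sqrt u * r)) at_top at_top"
        have "eventually (\<lambda>u. 1 \<le> y u r) at_top"
          using floor_scaling(3)[OF t0, of r] unfolding filterlim_at_top y_def by blast
        moreover have "eventually (\<lambda>u. 0 \<le> real (n u) - y u r) at_top"
          using r unfolding filterlim_at_top y_def by blast
        ultimately have "eventually (\<lambda>u. sqrt u ^ DIM('b) * conv (n u - nat \<lfloor>y u r\<rfloor>) (nat \<lfloor>y u r\<rfloor>) (z u) = T u r) at_top"
        proof eventually_elim
          case (elim u)
          have "\<lfloor>y u r\<rfloor> \<le> int (n u)" using elim(2) by (simp add: floor_le_iff)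
          then show ?case using elim(1) by (simp add: T_def)
        qed
        moreover have "((\<lambda>u. sqrt u ^ DIM('b) * conv (n u - nat \<lfloor>y u r\<rfloor>) (nat \<lfloor>y u r\<rfloor>) (z u)) \<longlongrightarrow> mass_inf * Q r) at_top"
          unfolding y_def z_def Q_def using r by (intro conv_local_limit t0) auto
        ultimately have "((\<lambda>u. T u r) \<longlongrightarrow> mass_inf * Q r) at_top"
          by (rule Lim_transform_eventually[rotated])
        then show ?thesis using r by simp
      next
        assume r: "r \<notin> R \<and> filterlim (\<lambda>u. real (n u) - (t0 * u + sqrt u * r)) at_bot at_top"
        then have "eventually (\<lambda>u. real (n u) - y u r \<le> - 1) at_top"
          unfolding filterlim_at_bot y_def by blast
        then have "eventually (\<lambda>u. 0 = T u r) at_top"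
        proof eventually_elim
          case (elim u)
          then have "real_of_int (int (n u) + 1) \<le> y u r" by simp
          then have "int (n u) + 1 \<le> \<lfloor>y u r\<rfloor>" by (simp only: le_floor_iff)
          then show ?case by (simp add: T_def)
        qed
        then have "((\<lambda>u. T u r) \<longlongrightarrow> 0) at_top"
          by (rule Lim_transform_eventually[OF tendsto_const])
        then show ?thesis using r by simp
      qed
    qed
    show "(\<lambda>r. indicator R r * (mass_inf * Q r)) \<in> borel_measurable lborel"
      unfolding Q_def by measurable
  qed (rule T_meas)
  \<comment> \<open>The term of time 0: the start \<open>z u\<close> has norm proportional to
    \<open>u\<close>, so \<open>tilted\<close> is exponentially small there, and half of its rate
    absorbs the power of \<open>u\<close>.\<close>
  moreover have "((\<lambda>u. sqrt u ^ (DIM('b) - 1) * tilted (n u) (z u)) \<longlongrightarrow> 0) at_top"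
  proof -
    define e where "e = \<epsilon> * t0 * norm v / 2"
    have e: "0 < e" using \<epsilon>_pos t0 v_ne by (simp add: e_def)
    define D where "D = (real (DIM('b) - 1) / e + 1) ^ (DIM('b) - 1) * tilt_bound"
    show ?thesis
    proof (rule tendsto_sandwich[where f="\<lambda>_. 0" and h="\<lambda>u. D * exp (- (e * u))"])
      show "((\<lambda>u. D * exp (- (e * u))) \<longlongrightarrow> 0) at_top"
        using e by real_asymp
      show "eventually (\<lambda>u. 0 \<le> sqrt u ^ (DIM('b) - 1) * tilted (n u) (z u)) at_top"
        using eventually_ge_at_top[of 1] by eventually_elim (simp add: tilted_bounds)
      show "eventually (\<lambda>u. sqrt u ^ (DIM('b) - 1) * tilted (n u) (z u) \<le> D * exp (- (e * u))) at_top"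
        using eventually_ge_at_top[of 1]
      proof eventually_elim
        case (elim u)
        have "sqrt u \<le> u" using elim by (intro real_le_lsqrt) (auto simp: power2_eq_square)
        then have "sqrt u ^ (DIM('b) - 1) \<le> u ^ (DIM('b) - 1)" using elim by (intro power_mono) auto
        also have "\<dots> \<le> (real (DIM('b) - 1) / e + 1) ^ (DIM('b) - 1) * exp (e * u)"
          using e elim by (intro power_le_exp) auto
        finally have 1: "sqrt u ^ (DIM('b) - 1) \<le> (real (DIM('b) - 1) / e + 1) ^ (DIM('b) - 1) * exp (e * u)" .
        have "\<epsilon> * norm (z u) = 2 * e * u"
          using t0 elim by (simp add: z_def e_def)
        then have 2: "tilted (n u) (z u) \<le> tilt_bound * exp (- (2 * e * u))"
          using tilted_bounds(2)[of "n u" "z u"] by simp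
        have "sqrt u ^ (DIM('b) - 1) * tilted (n u) (z u)
            \<le> ((real (DIM('b) - 1) / e + 1) ^ (DIM('b) - 1) * exp (e * u)) * (tilt_bound * exp (- (2 * e * u)))"
          using elim e by (intro mult_mono 1 2 tilted_bounds) auto
        also have "\<dots> = D * (exp (e * u) * exp (- (2 * e * u)))"
          by (simp add: D_def)
        also have "exp (e * u) * exp (- (2 * e * u)) = exp (- (e * u))"
          by (simp add: exp_add[symmetric])
        finally show ?case .
      qed
    qed simp
  qed
  ultimately have "((\<lambda>u. sqrt u ^ (DIM('b) - 1) * tilted (n u) (z u) + (\<integral>r. T u r \<partial>lborel))
      \<longlongrightarrow> 0 + (\<integral>r. indicator R r * (mass_inf * Q r) \<partial>lborel)) at_top"
    by (intro tendsto_add)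
  moreover have "eventually (\<lambda>u. sqrt u ^ (DIM('b) - 1) * tilted (n u) (z u) + (\<integral>r. T u r \<partial>lborel)
      = sqrt u ^ (DIM('b) - 1) * (exp (t0 * u * (\<gamma> \<bullet> v)) * Psi 0 (real (n u)) (- (t0 * u) *\<^sub>R v))) at_top"
    using eventually_ge_at_top[of 1]
  proof eventually_elim
    case (elim u)
    have "- (\<gamma> \<bullet> z u) = t0 * u * (\<gamma> \<bullet> v)" by (simp add: z_def)
    then show ?case
      unfolding z_def[symmetric]
      using decomposition[of "z u" "n u"] sum_eq[OF elim]
      by (simp add: distrib_left)
  qed
  moreover have "(\<integral>r. indicator R r * (mass_inf * Q r) \<partial>lborel)
      = mass_inf * ((1 / sqrt (2 * pi * t0)) ^ DIM('b) * (\<integral>r. indicator R r * exp (- (r\<^sup>2 * (norm v)\<^sup>2) / (2 * t0)) \<partial>lborel))"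
  proof -
    have "(\<integral>r. indicator R r * (mass_inf * Q r) \<partial>lborel)
      = (\<integral>r. (mass_inf * (1 / sqrt (2 * pi * t0)) ^ DIM('b)) * (indicator R r * exp (- (r\<^sup>2 * (norm v)\<^sup>2) / (2 * t0))) \<partial>lborel)"
      unfolding Q_def by (intro Bochner_Integration.integral_cong) auto
    then show ?thesis by simp
  qed
  ultimately show ?thesis
    using Lim_transform_eventually by fastforce
qed

end

section \<open>Infima of sets of times, Cesaro means and Gaussian integrals\<close>

lemma Inf_ereal_image_le_iff:
  "Inf (ereal ` S) \<le> ereal L \<longleftrightarrow> (\<forall>m::nat. \<exists>t\<in>S. t \<le> L + 1 / real (Suc m))"
proof
  assume le: "Inf (ereal ` S) \<le> ereal L"
  show "\<forall>m::nat. \<exists>t\<in>S. t \<le> L + 1 / real (Suc m)"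
  proof
    fix m :: nat
    have "ereal L < ereal (L + 1 / real (Suc m))" by simp
    with le have "Inf (ereal ` S) < ereal (L + 1 / real (Suc m))" by (rule le_less_trans)
    then obtain t where "t \<in> S" "ereal t < ereal (L + 1 / real (Suc m))"
      by (auto simp: Inf_less_iff)
    then show "\<exists>t\<in>S. t \<le> L + 1 / real (Suc m)" by (auto intro!: bexI[of _ t])
  qed
next
  assume *: "\<forall>m::nat. \<exists>t\<in>S. t \<le> L + 1 / real (Suc m)"
  show "Inf (ereal ` S) \<le> ereal L"
  proof (rule ereal_le_epsilon2)
    fix e :: real assume "0 < e"
    then obtain m where m: "1 / real (Suc m) < e" using nat_approx_posE by blast
    obtain t where t: "t \<in> S" "t \<le> L + 1 / real (Suc m)" using * by blast
    then have "Inf (ereal ` S) \<le> ereal t" by (intro Inf_lower) auto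
    also have "ereal t \<le> ereal L + ereal e" using t m by simp
    finally show "Inf (ereal ` S) \<le> ereal L + ereal e" .
  qed
qed

lemma cesaro_mean:
  fixes X :: "nat \<Rightarrow> real"
  assumes "X \<longlonglongrightarrow> l"
  shows "(\<lambda>n. (\<Sum>j<n. X j) / real n) \<longlonglongrightarrow> l"
proof -
  have "(\<lambda>n. (\<Sum>j<n. X j - l) / real n) \<longlonglongrightarrow> 0"
  proof (rule LIMSEQ_I)
    fix r :: real assume r: "0 < r"
    have "(\<lambda>n. X n - l) \<longlonglongrightarrow> 0" using assms by (simp add: LIM_zero)
    from LIMSEQ_D[OF this, of "r / 2"] r obtain N where N: "\<And>n. n \<ge> N \<Longrightarrow> \<bar>X n - l\<bar> < r / 2"
      by auto
    define K where "K = (\<Sum>j<N. \<bar>X j - l\<bar>)"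
    obtain n0 :: nat where n0: "2 * K / r < real n0" using reals_Archimedean2 by blast
    have "norm ((\<Sum>j<n. X j - l) / real n - 0) < r" if n: "n \<ge> N + n0 + 1" for n
    proof -
      have "\<bar>\<Sum>j<n. X j - l\<bar> \<le> (\<Sum>j<n. \<bar>X j - l\<bar>)" by (rule sum_abs)
      also have "\<dots> = K + (\<Sum>j=N..<n. \<bar>X j - l\<bar>)"
        unfolding K_def using n by (simp add: lessThan_atLeast0 sum.atLeastLessThan_concat)
      also have "\<dots> \<le> K + (\<Sum>j=N..<n. r / 2)"
        using N by (intro add_left_mono sum_mono) (auto intro: less_imp_le)
      also have "\<dots> = K + real (n - N) * (r / 2)" by simp
      also have "\<dots> \<le> K + real n * (r / 2)"
        using r by (intro add_left_mono mult_right_mono) auto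
      also have "K < real n * (r / 2)"
      proof -
        have "2 * K / r < real n" using n0 n by linarith
        then show ?thesis using r by (simp add: field_simps)
      qed
      finally have "\<bar>\<Sum>j<n. X j - l\<bar> < real n * r" by (simp add: field_simps)
      then show ?thesis using n by (simp add: divide_less_eq mult.commute)
    qed
    then show "\<exists>no. \<forall>n\<ge>no. norm ((\<Sum>j<n. X j - l) / real n - 0) < r" by blast
  qed
  from tendsto_add[OF this tendsto_const[of l]]
  have "(\<lambda>n. (\<Sum>j<n. X j - l) / real n + l) \<longlonglongrightarrow> l" by simp
  then show ?thesis
  proof (rule Lim_transform_eventually)
    have "eventually (\<lambda>n::nat. 1 \<le> n) sequentially" by (rule eventually_ge_at_top)
    then show "eventually (\<lambda>n. (\<Sum>j<n. X j - l) / real n + l = (\<Sum>j<n. X j) / real n) sequentially"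
      by eventually_elim (simp add: sum_subtractf diff_divide_distrib)
  qed
qed

lemma gaussian_integral_scaled:
  fixes \<sigma> :: real
  assumes \<sigma>: "0 < \<sigma>"
  shows "(\<integral>r. indicator {..s * \<sigma>} r * exp (- (r\<^sup>2) / (2 * \<sigma>\<^sup>2)) \<partial>lborel) = \<sigma> * sqrt (2 * pi) * cdf std_normal_distribution s"
    and "(\<integral>r. exp (- (r\<^sup>2) / (2 * \<sigma>\<^sup>2)) \<partial>lborel) = \<sigma> * sqrt (2 * pi)"
proof -
  have e: "exp (- ((\<sigma> * x)\<^sup>2) / (2 * \<sigma>\<^sup>2)) = sqrt (2 * pi) * std_normal_density x" for x
    using \<sigma> by (simp add: std_normal_density_def power_mult_distrib)
  have "(\<integral>r. indicator {..s * \<sigma>} r * exp (- (r\<^sup>2) / (2 * \<sigma>\<^sup>2)) \<partial>lborel)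
     = \<bar>\<sigma>\<bar> *\<^sub>R (\<integral>x. indicator {..s * \<sigma>} (0 + \<sigma> * x) * exp (- ((0 + \<sigma> * x)\<^sup>2) / (2 * \<sigma>\<^sup>2)) \<partial>lborel)"
    using \<sigma> by (intro lborel_integral_real_affine) simp
  also have "\<dots> = \<sigma> * (\<integral>x. sqrt (2 * pi) * (std_normal_density x * indicator {..s} x) \<partial>lborel)"
  proof -
    have ind: "indicator {..s * \<sigma>} (0 + \<sigma> * x) = (indicator {..s} x :: real)" for x
      using \<sigma> by (auto simp: indicator_def mult.commute)
    have "indicator {..s * \<sigma>} (0 + \<sigma> * x) * exp (- ((0 + \<sigma> * x)\<^sup>2) / (2 * \<sigma>\<^sup>2))
        = sqrt (2 * pi) * (std_normal_density x * indicator {..s} x)" for x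
      unfolding ind unfolding add_0 e by (simp only: mult_ac)
    then show ?thesis using \<sigma> by (simp only:) simp
  qed
  also have "(\<integral>x. sqrt (2 * pi) * (std_normal_density x * indicator {..s} x) \<partial>lborel) = sqrt (2 * pi) * cdf std_normal_distribution s"
  proof -
    have "cdf std_normal_distribution s = (\<integral>x. indicator {..s} x \<partial>std_normal_distribution)"
      by (simp add: cdf_def)
    also have "\<dots> = (\<integral>x. std_normal_density x * indicator {..s} x \<partial>lborel)"
      by (subst integral_density) auto
    finally show ?thesis by simp
  qed
  finally show "(\<integral>r. indicator {..s * \<sigma>} r * exp (- (r\<^sup>2) / (2 * \<sigma>\<^sup>2)) \<partial>lborel) = \<sigma> * sqrt (2 * pi) * cdf std_normal_distribution s"
    by simp
  have "(\<integral>r. exp (- (r\<^sup>2) / (2 * \<sigma>\<^sup>2)) \<partial>lborel)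
     = \<bar>\<sigma>\<bar> *\<^sub>R (\<integral>x. exp (- ((0 + \<sigma> * x)\<^sup>2) / (2 * \<sigma>\<^sup>2)) \<partial>lborel)"
    using \<sigma> by (intro lborel_integral_real_affine) simp
  also have "\<dots> = \<sigma> * (\<integral>x. sqrt (2 * pi) * std_normal_density x \<partial>lborel)"
    using \<sigma> unfolding add_0 e by simp
  also have "\<dots> = \<sigma> * sqrt (2 * pi)"
    by simp
  finally show "(\<integral>r. exp (- (r\<^sup>2) / (2 * \<sigma>\<^sup>2)) \<partial>lborel) = \<sigma> * sqrt (2 * pi)" .
qed

section \<open>Visits at any time, law of the hitting time, and the constant H\<close>

context cone_hitting begin

definition Pinf :: "'b \<Rightarrow> real" where
  "Pinf z = prob {\<omega> \<in> space M. \<exists>t\<ge>0. z + W t \<omega> \<in> C}"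

lemma Pinf_eq: "{\<omega> \<in> space M. \<exists>t\<ge>0. z + W t \<omega> \<in> C} = (\<Union>n. visit 0 (real n) z)"
proof (intro subset_antisym subsetI)
  fix \<omega> assume "\<omega> \<in> {\<omega> \<in> space M. \<exists>t\<ge>0. z + W t \<omega> \<in> C}"
  then obtain t where t: "\<omega> \<in> space M" "0 \<le> t" "z + W t \<omega> \<in> C" by blast
  obtain n where "t \<le> real n" using real_arch_simple by blast
  then have "\<omega> \<in> visit 0 (real n) z" using t unfolding visit_def by auto
  then show "\<omega> \<in> (\<Union>n. visit 0 (real n) z)" by blast
qed (auto simp: visit_def)

lemma Psi_tendsto_Pinf: "(\<lambda>n. Psi 0 (real n) z) \<longlonglongrightarrow> Pinf z"
  unfolding Psi_eq_visit Pinf_def Pinf_eq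
  by (intro finite_Lim_measure_incseq incseq_SucI visit_mono) auto

lemma Psi_le_Pinf: "Psi 0 (real n) z \<le> Pinf z"
  unfolding Psi_eq_visit Pinf_def Pinf_eq by (intro finite_measure_mono) auto

abbreviation scaled :: "real \<Rightarrow> real \<Rightarrow> real \<Rightarrow> real" where
  "scaled t0 u p \<equiv> sqrt u ^ (DIM('b) - 1) * (exp (t0 * u * (\<gamma> \<bullet> v)) * p)"

text \<open>The limit in \<open>Psi_asymptotics\<close> for \<open>R = UNIV\<close>: the Gaussian in
  \<open>r\<close> has standard deviation \<open>sqrt t0 / norm v\<close>, and the last factor is
  its total integral.\<close>

definition limit_const :: "real \<Rightarrow> real" where
  "limit_const t0 = mass_inf * ((1 / sqrt (2 * pi * t0)) ^ DIM('b) * (sqrt t0 / norm v * sqrt (2 * pi)))"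

lemma limit_const_pos: "0 < t0 \<Longrightarrow> 0 < limit_const t0"
  using mass_inf_pos v_ne by (simp add: limit_const_def)

lemma exponent_rewrite:
  assumes "0 < t0"
  shows "- (r\<^sup>2 * (norm v)\<^sup>2) / (2 * t0) = - (r\<^sup>2) / (2 * (sqrt t0 / norm v)\<^sup>2)"
  using assms v_ne by (simp add: power_divide field_simps)

theorem Pinf_asymptotics:
  assumes t0: "0 < t0"
  shows "((\<lambda>u. scaled t0 u (Pinf (- (t0 * u) *\<^sub>R v))) \<longlongrightarrow> limit_const t0) at_top"
proof -
  let ?z = "\<lambda>u. - (t0 * u) *\<^sub>R v"
  \<comment> \<open>The horizon depends on \<open>u\<close>: beyond \<open>u\<^sup>2\<close> it
    eventually exceeds \<open>t0 * u + sqrt u * r\<close> for every \<open>r\<close>, and the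
    weighted remainder is below \<open>exp (- u)\<close>. Choosing it for each \<open>u\<close>
    separately avoids a uniform estimate of late visits.\<close>
  have "\<exists>n. real n \<ge> u\<^sup>2 \<and> exp (t0 * u * (\<gamma> \<bullet> v)) * (Pinf (?z u) - Psi 0 (real n) (?z u)) \<le> exp (- u)" for u
  proof -
    have "(\<lambda>n. exp (t0 * u * (\<gamma> \<bullet> v)) * (Pinf (?z u) - Psi 0 (real n) (?z u))) \<longlonglongrightarrow> exp (t0 * u * (\<gamma> \<bullet> v)) * (Pinf (?z u) - Pinf (?z u))"
      by (intro tendsto_intros Psi_tendsto_Pinf)
    from order_tendstoD(2)[OF this, of "exp (- u)"]
    have "eventually (\<lambda>n. exp (t0 * u * (\<gamma> \<bullet> v)) * (Pinf (?z u) - Psi 0 (real n) (?z u)) < exp (- u)) sequentially"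
      by simp
    moreover have "eventually (\<lambda>n. real n \<ge> u\<^sup>2) sequentially"
      using filterlim_real_sequentially unfolding filterlim_at_top by blast
    ultimately have "eventually (\<lambda>n. real n \<ge> u\<^sup>2 \<and> exp (t0 * u * (\<gamma> \<bullet> v)) * (Pinf (?z u) - Psi 0 (real n) (?z u)) \<le> exp (- u)) sequentially"
      by eventually_elim auto
    then show ?thesis by (rule eventually_happens'[rotated]) simp
  qed
  then obtain n where n: "\<And>u. real (n u) \<ge> u\<^sup>2"
    "\<And>u. exp (t0 * u * (\<gamma> \<bullet> v)) * (Pinf (?z u) - Psi 0 (real (n u)) (?z u)) \<le> exp (- u)"
    by metis
  have fl: "filterlim (\<lambda>u. real (n u) - (t0 * u + sqrt u * r)) at_top at_top" for r
  proof (rule filterlim_at_top_mono)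
    show "filterlim (\<lambda>u. u\<^sup>2 - (t0 * u + sqrt u * r)) at_top at_top" by real_asymp
    show "eventually (\<lambda>u. u\<^sup>2 - (t0 * u + sqrt u * r) \<le> real (n u) - (t0 * u + sqrt u * r)) at_top"
      using n(1) by (intro always_eventually) simp
  qed
  have "((\<lambda>u. scaled t0 u (Psi 0 (real (n u)) (?z u)))
     \<longlongrightarrow> mass_inf * ((1 / sqrt (2 * pi * t0)) ^ DIM('b) * (\<integral>r. indicator UNIV r * exp (- (r\<^sup>2 * (norm v)\<^sup>2) / (2 * t0)) \<partial>lborel))) at_top"
    using fl by (intro Psi_asymptotics t0) auto
  also have "(\<integral>r. indicator UNIV r * exp (- (r\<^sup>2 * (norm v)\<^sup>2) / (2 * t0)) \<partial>lborel) = sqrt t0 / norm v * sqrt (2 * pi)"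
    unfolding exponent_rewrite[OF t0] using gaussian_integral_scaled(2)[of "sqrt t0 / norm v"] t0 v_ne by simp
  finally have 1: "((\<lambda>u. scaled t0 u (Psi 0 (real (n u)) (?z u))) \<longlongrightarrow> limit_const t0) at_top"
    by (simp add: limit_const_def)
  have 2: "((\<lambda>u. sqrt u ^ (DIM('b) - 1) * (exp (t0 * u * (\<gamma> \<bullet> v)) * (Pinf (?z u) - Psi 0 (real (n u)) (?z u)))) \<longlongrightarrow> 0) at_top"
  proof (rule tendsto_sandwich[where f="\<lambda>_. 0" and h="\<lambda>u. sqrt u ^ (DIM('b) - 1) * exp (- u)"])
    show "eventually (\<lambda>u. 0 \<le> sqrt u ^ (DIM('b) - 1) * (exp (t0 * u * (\<gamma> \<bullet> v)) * (Pinf (?z u) - Psi 0 (real (n u)) (?z u)))) at_top"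
      using eventually_ge_at_top[of 0] by eventually_elim (simp add: Psi_le_Pinf)
    show "eventually (\<lambda>u. sqrt u ^ (DIM('b) - 1) * (exp (t0 * u * (\<gamma> \<bullet> v)) * (Pinf (?z u) - Psi 0 (real (n u)) (?z u)))
        \<le> sqrt u ^ (DIM('b) - 1) * exp (- u)) at_top"
      using eventually_ge_at_top[of 0] by eventually_elim (intro mult_left_mono n(2), simp)
    show "((\<lambda>u. sqrt u ^ (DIM('b) - 1) * exp (- u)) \<longlongrightarrow> 0) at_top"
    proof (rule tendsto_sandwich[where f="\<lambda>_. 0" and h="\<lambda>u. u ^ (DIM('b) - 1) / exp u"])
      show "eventually (\<lambda>u::real. sqrt u ^ (DIM('b) - 1) * exp (- u) \<le> u ^ (DIM('b) - 1) / exp u) at_top"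
        using eventually_ge_at_top[of 1]
      proof eventually_elim
        case (elim u)
        have "sqrt u \<le> u" using elim by (intro real_le_lsqrt) (auto simp: power2_eq_square)
        then show ?case using elim by (simp add: exp_minus field_simps power_mono)
      qed
      show "eventually (\<lambda>u. 0 \<le> sqrt u ^ (DIM('b) - 1) * exp (- u)) at_top"
        using eventually_ge_at_top[of 0] by eventually_elim simp
    qed (auto intro: tendsto_power_div_exp_0)
  qed simp
  from tendsto_add[OF 1 2] show ?thesis
    by (simp add: algebra_simps)
qed

definition hit :: "real \<Rightarrow> 'b \<Rightarrow> 'a set" where
  "hit L z = {\<omega> \<in> space M. Inf (ereal ` {t. 0 \<le> t \<and> z + W t \<omega> \<in> C}) \<le> ereal L}"

text \<open>As \<open>C\<close> is open, the infimum of the visiting times need not be attained: a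
  hitting time at most \<open>L\<close> guarantees visits only by times slightly larger than
  \<open>L\<close>. Countably many margins keep the event measurable.\<close>

lemma hit_eq: "hit L z = (\<Inter>m. visit 0 (L + 1 / real (Suc m)) z)"
  unfolding hit_def visit_def Inf_ereal_image_le_iff by fastforce

lemma hit_sets [measurable]: "hit L z \<in> sets M"
  unfolding hit_eq by measurable

text \<open>The decomposition works with integer horizons. The gap of two time units disappears on
  the scale \<open>sqrt u\<close>.\<close>

lemma hit_sandwich:
  assumes "0 \<le> L"
  shows "Psi 0 (real (nat \<lfloor>L\<rfloor>)) z \<le> prob (hit L z)" "prob (hit L z) \<le> Psi 0 (real (nat \<lfloor>L\<rfloor> + 2)) z"
proof -
  have n: "real (nat \<lfloor>L\<rfloor>) \<le> L" "L \<le> real (nat \<lfloor>L\<rfloor>) + 1"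
  proof -
    show "real (nat \<lfloor>L\<rfloor>) \<le> L" using assms by simp
    show "L \<le> real (nat \<lfloor>L\<rfloor>) + 1" using assms by linarith
  qed
  have "visit 0 (real (nat \<lfloor>L\<rfloor>)) z \<subseteq> visit 0 (L + 1 / real (Suc m)) z" for m
    by (intro visit_mono add_increasing2 n) auto
  then have "visit 0 (real (nat \<lfloor>L\<rfloor>)) z \<subseteq> hit L z" unfolding hit_eq by blast
  then show "Psi 0 (real (nat \<lfloor>L\<rfloor>)) z \<le> prob (hit L z)"
    unfolding Psi_eq_visit by (intro finite_measure_mono) auto
  \<comment> \<open>The instance \<open>m = 0\<close>: a margin of 1, and at most 1 lost in
    rounding, make the 2.\<close>
  have "hit L z \<subseteq> visit 0 (L + 1 / real (Suc 0)) z" unfolding hit_eq by blast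
  also have "\<dots> \<subseteq> visit 0 (real (nat \<lfloor>L\<rfloor> + 2)) z"
  proof (rule visit_mono)
    have "L + 1 \<le> real (nat \<lfloor>L\<rfloor>) + 2" using n(2) by linarith
    then show "L + 1 / real (Suc 0) \<le> real (nat \<lfloor>L\<rfloor> + 2)"
      unfolding of_nat_add of_nat_numeral by (simp only: of_nat_Suc of_nat_0 add_0 add_0_right div_by_1)
  qed simp
  finally show "prob (hit L z) \<le> Psi 0 (real (nat \<lfloor>L\<rfloor> + 2)) z"
    unfolding Psi_eq_visit by (intro finite_measure_mono) auto
qed

text \<open>The offset \<open>a\<close> serves both sides of \<open>hit_sandwich\<close>, as 0 and
  as 2. At \<open>r = s * \<sigma>\<close> neither alternative of \<open>Psi_asymptotics\<close>
  holds, but this is a null set.\<close>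

lemma Psi_window_asymptotics:
  assumes t0: "0 < t0"
  defines "\<sigma> \<equiv> sqrt t0 / norm v"
  shows "((\<lambda>u. scaled t0 u (Psi 0 (real (nat \<lfloor>t0 * u + sqrt u * (s * \<sigma>)\<rfloor> + a)) (- (t0 * u) *\<^sub>R v)))
     \<longlongrightarrow> limit_const t0 * cdf std_normal_distribution s) at_top"
proof -
  have \<sigma>: "0 < \<sigma>" using t0 v_ne by (simp add: \<sigma>_def)
  define n where "n u = nat \<lfloor>t0 * u + sqrt u * (s * \<sigma>)\<rfloor> + a" for u
  have y1: "eventually (\<lambda>u. 1 \<le> t0 * u + sqrt u * (s * \<sigma>)) at_top"
    using floor_scaling(3)[OF t0, of "s * \<sigma>"] unfolding filterlim_at_top by blast
  have "((\<lambda>u. scaled t0 u (Psi 0 (real (n u)) (- (t0 * u) *\<^sub>R v)))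
     \<longlongrightarrow> mass_inf * ((1 / sqrt (2 * pi * t0)) ^ DIM('b) * (\<integral>r. indicator {..s * \<sigma>} r * exp (- (r\<^sup>2 * (norm v)\<^sup>2) / (2 * t0)) \<partial>lborel))) at_top"
  proof (rule Psi_asymptotics[OF t0])
    have "AE r in lborel. r \<noteq> s * \<sigma>" by (rule AE_lborel_singleton)
    then show "AE r in lborel. (r \<in> {..s * \<sigma>} \<and> filterlim (\<lambda>u. real (n u) - (t0 * u + sqrt u * r)) at_top at_top)
        \<or> (r \<notin> {..s * \<sigma>} \<and> filterlim (\<lambda>u. real (n u) - (t0 * u + sqrt u * r)) at_bot at_top)"
    proof (rule AE_mp, intro AE_I2 impI)
      fix r :: real assume "r \<noteq> s * \<sigma>"
      then consider "r < s * \<sigma>" | "s * \<sigma> < r" by linarith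
      then show "(r \<in> {..s * \<sigma>} \<and> filterlim (\<lambda>u. real (n u) - (t0 * u + sqrt u * r)) at_top at_top)
        \<or> (r \<notin> {..s * \<sigma>} \<and> filterlim (\<lambda>u. real (n u) - (t0 * u + sqrt u * r)) at_bot at_top)"
      proof cases
        case 1
        have "filterlim (\<lambda>u. real (n u) - (t0 * u + sqrt u * r)) at_top at_top"
        proof (rule filterlim_at_top_mono)
          have d: "0 < s * \<sigma> - r" using 1 by simp
          show "filterlim (\<lambda>u. sqrt u * (s * \<sigma> - r) - 1) at_top at_top"
            using d by real_asymp
          show "eventually (\<lambda>u. sqrt u * (s * \<sigma> - r) - 1 \<le> real (n u) - (t0 * u + sqrt u * r)) at_top"
            using y1
          proof eventually_elim
            case (elim u)
            have "t0 * u + sqrt u * (s * \<sigma>) \<le> real (n u) + 1"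
              using elim unfolding n_def by linarith
            then show ?case by (simp add: algebra_simps)
          qed
        qed
        then show ?thesis using 1 by simp
      next
        case 2
        have "filterlim (\<lambda>u. - (real (n u) - (t0 * u + sqrt u * r))) at_top at_top"
        proof (rule filterlim_at_top_mono)
          have d: "0 < r - s * \<sigma>" using 2 by simp
          show "filterlim (\<lambda>u. sqrt u * (r - s * \<sigma>) - real a) at_top at_top"
            using d by real_asymp
          show "eventually (\<lambda>u. sqrt u * (r - s * \<sigma>) - real a \<le> - (real (n u) - (t0 * u + sqrt u * r))) at_top"
            using y1
          proof eventually_elim
            case (elim u)
            have "real (n u) \<le> t0 * u + sqrt u * (s * \<sigma>) + real a"
              using elim unfolding n_def by simp
            then show ?case by (simp add: algebra_simps)
          qed
        qed
        then have "filterlim (\<lambda>u. real (n u) - (t0 * u + sqrt u * r)) at_bot at_top"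
          by (subst filterlim_uminus_at_bot) simp
        then show ?thesis using 2 by simp
      qed
    qed
  qed simp
  also have "(\<integral>r. indicator {..s * \<sigma>} r * exp (- (r\<^sup>2 * (norm v)\<^sup>2) / (2 * t0)) \<partial>lborel) = \<sigma> * sqrt (2 * pi) * cdf std_normal_distribution s"
    unfolding exponent_rewrite[OF t0] \<sigma>_def[symmetric] by (rule gaussian_integral_scaled(1)[OF \<sigma>])
  finally show ?thesis
    by (simp add: limit_const_def n_def \<sigma>_def mult_ac)
qed

theorem hit_asymptotics:
  assumes t0: "0 < t0"
  defines "\<sigma> \<equiv> sqrt t0 / norm v"
  shows "((\<lambda>u. prob (hit (t0 * u + sqrt u * (s * \<sigma>)) (- (t0 * u) *\<^sub>R v)) / Pinf (- (t0 * u) *\<^sub>R v))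
     \<longlongrightarrow> cdf std_normal_distribution s) at_top"
proof -
  have "((\<lambda>u. scaled t0 u (prob (hit (t0 * u + sqrt u * (s * \<sigma>)) (- (t0 * u) *\<^sub>R v))))
     \<longlongrightarrow> limit_const t0 * cdf std_normal_distribution s) at_top"
  proof (rule tendsto_sandwich)
    show "((\<lambda>u. scaled t0 u (Psi 0 (real (nat \<lfloor>t0 * u + sqrt u * (s * \<sigma>)\<rfloor> + 0)) (- (t0 * u) *\<^sub>R v)))
     \<longlongrightarrow> limit_const t0 * cdf std_normal_distribution s) at_top"
      unfolding \<sigma>_def by (rule Psi_window_asymptotics[OF t0])
    show "((\<lambda>u. scaled t0 u (Psi 0 (real (nat \<lfloor>t0 * u + sqrt u * (s * \<sigma>)\<rfloor> + 2)) (- (t0 * u) *\<^sub>R v)))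
     \<longlongrightarrow> limit_const t0 * cdf std_normal_distribution s) at_top"
      unfolding \<sigma>_def by (rule Psi_window_asymptotics[OF t0])
    have y1: "eventually (\<lambda>u. 0 \<le> t0 * u + sqrt u * (s * \<sigma>)) at_top"
      using floor_scaling(3)[OF t0, of "s * \<sigma>"] unfolding filterlim_at_top by blast
    show "eventually (\<lambda>u. scaled t0 u (Psi 0 (real (nat \<lfloor>t0 * u + sqrt u * (s * \<sigma>)\<rfloor> + 0)) (- (t0 * u) *\<^sub>R v))
        \<le> scaled t0 u (prob (hit (t0 * u + sqrt u * (s * \<sigma>)) (- (t0 * u) *\<^sub>R v)))) at_top"
      using y1 eventually_ge_at_top[of 0]
      by eventually_elim (unfold add_0_right, intro mult_left_mono hit_sandwich(1), auto)
    show "eventually (\<lambda>u. scaled t0 u (prob (hit (t0 * u + sqrt u * (s * \<sigma>)) (- (t0 * u) *\<^sub>R v)))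
        \<le> scaled t0 u (Psi 0 (real (nat \<lfloor>t0 * u + sqrt u * (s * \<sigma>)\<rfloor> + 2)) (- (t0 * u) *\<^sub>R v))) at_top"
      using y1 eventually_ge_at_top[of 0]
      by eventually_elim (intro mult_left_mono hit_sandwich(2), auto)
  qed
  from tendsto_divide[OF this Pinf_asymptotics[OF t0]] limit_const_pos[OF t0]
  have "((\<lambda>u. scaled t0 u (prob (hit (t0 * u + sqrt u * (s * \<sigma>)) (- (t0 * u) *\<^sub>R v))) / scaled t0 u (Pinf (- (t0 * u) *\<^sub>R v)))
     \<longlongrightarrow> cdf std_normal_distribution s) at_top" by simp
  then show ?thesis
  proof (rule Lim_transform_eventually)
    show "eventually (\<lambda>u. scaled t0 u (prob (hit (t0 * u + sqrt u * (s * \<sigma>)) (- (t0 * u) *\<^sub>R v))) / scaled t0 u (Pinf (- (t0 * u) *\<^sub>R v))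
       = prob (hit (t0 * u + sqrt u * (s * \<sigma>)) (- (t0 * u) *\<^sub>R v)) / Pinf (- (t0 * u) *\<^sub>R v)) at_top"
      using eventually_gt_at_top[of 0] by eventually_elim simp
  qed
qed

text \<open>The integral is monotone in \<open>T\<close> and equals a partial sum of
  \<open>mass\<close> at integer horizons, so its mean is squeezed between Cesaro means.\<close>

lemma tilted_mean_tendsto:
  "((\<lambda>T. (\<integral>\<^sup>+z. ennreal (exp (- (\<gamma> \<bullet> z)) * Psi 0 T z) \<partial>lborel) / ennreal T) \<longlongrightarrow> ennreal mass_inf) at_top"
proof -
  define h where "h T = (\<integral>\<^sup>+z. ennreal (exp (- (\<gamma> \<bullet> z)) * Psi 0 T z) \<partial>lborel)" for T
  have mono: "h T \<le> h T'" if "T \<le> T'" for T T'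
    unfolding h_def Psi_eq_visit using that
    by (intro nn_integral_mono ennreal_leI mult_left_mono finite_measure_mono visit_mono) auto
  have hn: "h (real n) = ennreal (\<Sum>j<Suc n. mass j)" for n
    unfolding h_def tilted_total by (simp add: lessThan_Suc_atMost)
  \<comment> \<open>Horizon \<open>n\<close> has \<open>n + 1\<close> summands; therefore
    \<open>a = 1\<close> gives the lower and \<open>a = 2\<close> the upper bound.\<close>
  have mean: "((\<lambda>T. (\<Sum>j<nat \<lfloor>T\<rfloor> + a. mass j) / T) \<longlongrightarrow> mass_inf) at_top" for a
  proof -
    have fl: "filterlim (\<lambda>T::real. nat \<lfloor>T\<rfloor> + a) at_top at_top"
      unfolding filterlim_at_top
    proof
      fix Z :: nat
      show "eventually (\<lambda>T::real. Z \<le> nat \<lfloor>T\<rfloor> + a) at_top"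
        using eventually_ge_at_top[of "real Z"] by eventually_elim (simp add: le_nat_floor trans_le_add1)
    qed
    have 1: "((\<lambda>T::real. (\<Sum>j<nat \<lfloor>T\<rfloor> + a. mass j) / real (nat \<lfloor>T\<rfloor> + a)) \<longlongrightarrow> mass_inf) at_top"
      using filterlim_compose[OF cesaro_mean[OF mass_tendsto] fl] by (simp only:)
    have 2: "((\<lambda>T. real (nat \<lfloor>T\<rfloor> + a) / T) \<longlongrightarrow> 1) at_top"
    proof (rule tendsto_sandwich)
      show "((\<lambda>T. (T - 1) / T) \<longlongrightarrow> (1::real)) at_top" by real_asymp
      show "((\<lambda>T. (T + real a) / T) \<longlongrightarrow> 1) at_top" by real_asymp
      show "eventually (\<lambda>T. (T - 1) / T \<le> real (nat \<lfloor>T\<rfloor> + a) / T) at_top"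
        using eventually_ge_at_top[of 1] by eventually_elim (intro divide_right_mono, linarith+)
      show "eventually (\<lambda>T. real (nat \<lfloor>T\<rfloor> + a) / T \<le> (T + real a) / T) at_top"
        using eventually_ge_at_top[of 1] by eventually_elim (intro divide_right_mono, auto)
    qed
    from tendsto_mult[OF 1 2]
    have "((\<lambda>T. (\<Sum>j<nat \<lfloor>T\<rfloor> + a. mass j) / real (nat \<lfloor>T\<rfloor> + a) * (real (nat \<lfloor>T\<rfloor> + a) / T)) \<longlongrightarrow> mass_inf) at_top" by simp
    then show ?thesis
    proof (rule Lim_transform_eventually)
      show "eventually (\<lambda>T. (\<Sum>j<nat \<lfloor>T\<rfloor> + a. mass j) / real (nat \<lfloor>T\<rfloor> + a) * (real (nat \<lfloor>T\<rfloor> + a) / T) = (\<Sum>j<nat \<lfloor>T\<rfloor> + a. mass j) / T) at_top"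
        using eventually_ge_at_top[of 1]
      proof eventually_elim
        case (elim T)
        then have "1 \<le> nat \<lfloor>T\<rfloor>" by (simp add: le_nat_floor)
        then have "real (nat \<lfloor>T\<rfloor> + a) \<noteq> 0" by linarith
        then show ?case by (simp only: times_divide_eq_right nonzero_divide_eq_eq times_divide_eq_left nonzero_mult_div_cancel_right not_False_eq_True mult.commute nonzero_mult_div_cancel_left)
      qed
    qed
  qed
  show ?thesis
    unfolding h_def[symmetric]
  proof (rule tendsto_sandwich)
    show "((\<lambda>T. ennreal ((\<Sum>j<nat \<lfloor>T\<rfloor> + 1. mass j) / T)) \<longlongrightarrow> ennreal mass_inf) at_top"
      by (intro tendsto_ennrealI mean)
    show "((\<lambda>T. ennreal ((\<Sum>j<nat \<lfloor>T\<rfloor> + 2. mass j) / T)) \<longlongrightarrow> ennreal mass_inf) at_top"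
      by (intro tendsto_ennrealI mean)
    have S: "0 \<le> (\<Sum>j<n. mass j)" for n by (intro sum_nonneg mass_nonneg)
    show "eventually (\<lambda>T. ennreal ((\<Sum>j<nat \<lfloor>T\<rfloor> + 1. mass j) / T) \<le> h T / ennreal T) at_top"
      using eventually_ge_at_top[of 1]
    proof eventually_elim
      case (elim T)
      have "ennreal ((\<Sum>j<nat \<lfloor>T\<rfloor> + 1. mass j) / T) = h (real (nat \<lfloor>T\<rfloor>)) / ennreal T"
        using elim S[of "Suc (nat \<lfloor>T\<rfloor>)"] by (simp only: hn divide_ennreal Suc_eq_plus1)
      also have "\<dots> \<le> h T / ennreal T"
        using elim by (intro divide_right_mono_ennreal mono) simp
      finally show ?case .
    qed
    show "eventually (\<lambda>T. h T / ennreal T \<le> ennreal ((\<Sum>j<nat \<lfloor>T\<rfloor> + 2. mass j) / T)) at_top"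
      using eventually_ge_at_top[of 1]
    proof eventually_elim
      case (elim T)
      have "h T / ennreal T \<le> h (real (nat \<lfloor>T\<rfloor> + 1)) / ennreal T"
        using elim by (intro divide_right_mono_ennreal mono) linarith
      also have "\<dots> = ennreal ((\<Sum>j<nat \<lfloor>T\<rfloor> + 2. mass j) / T)"
        using elim S[of "Suc (nat \<lfloor>T\<rfloor> + 1)"] by (subst hn) (simp add: divide_ennreal)
      finally show ?case .
    qed
  qed
qed

end

subsection \<open>Linear change of variables\<close>

lemma nn_integral_lborel_PiM:
  fixes f :: "'b::euclidean_space \<Rightarrow> ennreal"
  assumes [measurable]: "f \<in> borel_measurable borel"
  shows "(\<integral>\<^sup>+z. f z \<partial>lborel) = (\<integral>\<^sup>+x. f (\<Sum>b\<in>Basis. x b *\<^sub>R b) \<partial>(\<Pi>\<^sub>M b\<in>Basis. lborel))"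
proof -
  have "(\<lambda>x. \<Sum>b\<in>Basis. x b *\<^sub>R b) \<in> measurable (\<Pi>\<^sub>M b\<in>Basis. lborel) (borel :: 'b measure)"
    by measurable
  then have "(\<integral>\<^sup>+z. f z \<partial>distr (\<Pi>\<^sub>M b\<in>Basis. lborel) borel (\<lambda>x. \<Sum>b\<in>Basis. x b *\<^sub>R b))
      = (\<integral>\<^sup>+x. f (\<Sum>b\<in>Basis. x b *\<^sub>R b) \<partial>(\<Pi>\<^sub>M b\<in>Basis. lborel))"
    by (rule nn_integral_distr) simp
  then show ?thesis
    unfolding lborel_eq[where 'a='b, symmetric] .
qed

text \<open>With the other coordinates held fixed the shear translates coordinate \<open>m\<close>
  by a constant, since \<open>z \<bullet> n\<close> does not involve that coordinate.\<close>

lemma nn_integral_shear: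
  fixes f :: "'b::euclidean_space \<Rightarrow> ennreal"
  assumes f[measurable]: "f \<in> borel_measurable borel" and m: "m \<in> Basis" "n \<in> Basis" "m \<noteq> n"
  shows "(\<integral>\<^sup>+z. f (z + (z \<bullet> n) *\<^sub>R m) \<partial>lborel) = (\<integral>\<^sup>+z. f z \<partial>lborel)"
proof -
  interpret product_sigma_finite "\<lambda>_::'b. lborel :: real measure" by unfold_locales
  let ?I = "Basis - {m}"
  have I: "finite ?I" "m \<notin> ?I" "insert m ?I = Basis" using m by auto
  define S where "S x y = y *\<^sub>R m + (\<Sum>b\<in>?I. x b *\<^sub>R b)" for x :: "'b \<Rightarrow> real" and y
  have S: "(\<Sum>b\<in>Basis. (x(m := y)) b *\<^sub>R b) = S x y" for x y
  proof -
    have "(\<Sum>b\<in>Basis. (x(m := y)) b *\<^sub>R b) = (x(m := y)) m *\<^sub>R m + (\<Sum>b\<in>?I. (x(m := y)) b *\<^sub>R b)"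
      by (rule sum.remove) (use m in auto)
    also have "(\<Sum>b\<in>?I. (x(m := y)) b *\<^sub>R b) = (\<Sum>b\<in>?I. x b *\<^sub>R b)"
      by (rule sum.cong) auto
    finally show ?thesis by (simp add: S_def)
  qed
  have split: "(\<integral>\<^sup>+z. g z \<partial>lborel) = (\<integral>\<^sup>+x. \<integral>\<^sup>+y. g (S x y) \<partial>lborel \<partial>(\<Pi>\<^sub>M b\<in>?I. lborel))"
    if g[measurable]: "g \<in> borel_measurable borel" for g :: "'b \<Rightarrow> ennreal"
  proof -
    have "(\<integral>\<^sup>+z. g z \<partial>lborel) = (\<integral>\<^sup>+x. g (\<Sum>b\<in>Basis. x b *\<^sub>R b) \<partial>(\<Pi>\<^sub>M b\<in>insert m ?I. lborel))"
      unfolding I(3) by (rule nn_integral_lborel_PiM) measurable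
    also have "\<dots> = (\<integral>\<^sup>+x. \<integral>\<^sup>+y. g (\<Sum>b\<in>Basis. (x(m := y)) b *\<^sub>R b) \<partial>lborel \<partial>(\<Pi>\<^sub>M b\<in>?I. lborel))"
      by (rule product_nn_integral_insert[OF I(1,2)]) (unfold I(3), measurable)
    finally show ?thesis unfolding S .
  qed
  have "(\<integral>\<^sup>+z. f (z + (z \<bullet> n) *\<^sub>R m) \<partial>lborel)
      = (\<integral>\<^sup>+x. \<integral>\<^sup>+y. f (S x y + (S x y \<bullet> n) *\<^sub>R m) \<partial>lborel \<partial>(\<Pi>\<^sub>M b\<in>?I. lborel))"
    by (rule split) measurable
  also have "\<dots> = (\<integral>\<^sup>+x. \<integral>\<^sup>+y. f (S x y) \<partial>lborel \<partial>(\<Pi>\<^sub>M b\<in>?I. lborel))"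
  proof (rule nn_integral_cong)
    fix x :: "'b \<Rightarrow> real"
    have "S x y \<bullet> n = x n" for y
    proof -
      have "(\<Sum>b\<in>?I. x b *\<^sub>R b) \<bullet> n = (\<Sum>b\<in>?I. if b = n then x n else 0)"
        unfolding inner_sum_left using m by (intro sum.cong) (auto simp: inner_Basis)
      also have "\<dots> = x n" using m by (simp add: I)
      finally show ?thesis using m by (simp add: S_def inner_add_left inner_Basis)
    qed
    then have "S x y + (S x y \<bullet> n) *\<^sub>R m = S x (x n + y)" for y
      by (simp add: S_def scaleR_add_left)
    then have "(\<integral>\<^sup>+y. f (S x y + (S x y \<bullet> n) *\<^sub>R m) \<partial>lborel) = (\<integral>\<^sup>+y. f (S x (x n + 1 * y)) \<partial>lborel)"
      by simp
    also have "\<dots> = (\<integral>\<^sup>+y. f (S x y) \<partial>lborel)"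
      by (subst nn_integral_real_affine[where c=1 and t="x n" and f="\<lambda>y. f (S x y)"]) (simp_all add: S_def)
    finally show "(\<integral>\<^sup>+y. f (S x y + (S x y \<bullet> n) *\<^sub>R m) \<partial>lborel) = (\<integral>\<^sup>+y. f (S x y) \<partial>lborel)" .
  qed
  also have "\<dots> = (\<integral>\<^sup>+z. f z \<partial>lborel)"
    by (rule split[symmetric]) measurable
  finally show ?thesis .
qed

text \<open>Preimages of boxes are boxes with permuted sides, and the volumes of boxes determine
  Lebesgue measure.\<close>

lemma distr_lborel_permute:
  fixes \<pi> :: "'n::finite \<Rightarrow> 'n"
  assumes \<pi>: "\<pi> permutes UNIV"
  shows "distr lborel borel (\<lambda>x::real^'n. \<chi> i. x $ \<pi> i) = lborel"
proof (rule lborel_eqI[symmetric])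
  have bij: "bij \<pi>" using \<pi> by (rule permutes_bij)
  have T[measurable]: "(\<lambda>x::real^'n. \<chi> i. x $ \<pi> i) \<in> borel_measurable borel"
    by (intro borel_measurable_continuous_onI continuous_on_vec_lambda continuous_intros)
  fix l u :: "real^'n" assume le: "\<And>b. b \<in> Basis \<Longrightarrow> l \<bullet> b \<le> u \<bullet> b"
  define l' where "l' = (\<chi> i. l $ inv \<pi> i)"
  define u' where "u' = (\<chi> i. u $ inv \<pi> i)"
  have inv: "inv \<pi> (\<pi> i) = i" "\<pi> (inv \<pi> i) = i" for i
    using permutes_inverses[OF \<pi>] by auto
  have "(\<lambda>x. \<chi> i. x $ \<pi> i) -` box l u = box l' u'"
    unfolding l'_def u'_def by (auto simp: mem_box_cart) (metis inv)+
  then have "emeasure (distr lborel borel (\<lambda>x::real^'n. \<chi> i. x $ \<pi> i)) (box l u) = emeasure lborel (box l' u')"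
    by (subst emeasure_distr) auto
  also have "\<dots> = (\<Prod>b\<in>Basis. (u' - l') \<bullet> b)"
  proof (rule emeasure_lborel_box)
    fix b :: "real^'n" assume "b \<in> Basis"
    then obtain i where "b = axis i 1" by (auto simp: Basis_vec_def)
    then show "l' \<bullet> b \<le> u' \<bullet> b"
      using le[of "axis (inv \<pi> i) 1"] by (simp add: l'_def u'_def inner_axis)
  qed
  also have "(\<Prod>b\<in>Basis. (u' - l') \<bullet> b) = (\<Prod>i\<in>UNIV. u $ inv \<pi> i - l $ inv \<pi> i)"
    by (simp add: prod_Basis_vec inner_axis l'_def u'_def)
  also have "\<dots> = (\<Prod>i\<in>UNIV. u $ i - l $ i)"
    using prod.permute[OF permutes_inv[OF \<pi>], of "\<lambda>i. u $ i - l $ i"] by (simp add: o_def)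
  also have "\<dots> = (\<Prod>b\<in>Basis. (u - l) \<bullet> b)"
    by (simp add: prod_Basis_vec inner_axis)
  finally show "emeasure (distr lborel borel (\<lambda>x::real^'n. \<chi> i. x $ \<pi> i)) (box l u) = ennreal (\<Prod>b\<in>Basis. (u - l) \<bullet> b)" .
qed simp

lemma matrix_measurable: "((*v) A :: real^'n \<Rightarrow> real^'m) \<in> borel_measurable borel"
  by (intro borel_measurable_continuous_onI linear_continuous_on matrix_vector_mul_bounded_linear)

text \<open>The change of variables theorem of the library is restricted to well-ordered index types;
  elementary matrices give it for all finite ones.\<close>

lemma nn_integral_matrix:
  fixes A :: "real^'n^'n"
  shows "\<forall>f\<in>borel_measurable borel. det A \<noteq> 0 \<longrightarrow> (\<integral>\<^sup>+x. f x \<partial>lborel) = ennreal \<bar>det A\<bar> * (\<integral>\<^sup>+x. f (A *v x) \<partial>lborel)"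
proof (induction A rule: induct_matrix_elementary_alt)
  case (1 A B)
  show ?case
  proof (intro ballI impI)
    fix f :: "real^'n \<Rightarrow> ennreal" assume f: "f \<in> borel_measurable borel" and det: "det (A ** B) \<noteq> 0"
    have "det A \<noteq> 0" "det B \<noteq> 0" using det by (auto simp: det_mul)
    moreover have fA: "(\<lambda>x. f (A *v x)) \<in> borel_measurable borel"
      using measurable_compose[OF matrix_measurable f] .
    ultimately have "(\<integral>\<^sup>+x. f x \<partial>lborel) = ennreal \<bar>det A\<bar> * (ennreal \<bar>det B\<bar> * (\<integral>\<^sup>+x. f (A *v (B *v x)) \<partial>lborel))"
      using 1(1)[rule_format, OF f] 1(2)[rule_format, OF fA] by simp
    then show "(\<integral>\<^sup>+x. f x \<partial>lborel) = ennreal \<bar>det (A ** B)\<bar> * (\<integral>\<^sup>+x. f ((A ** B) *v x) \<partial>lborel)"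
      by (simp add: det_mul abs_mult ennreal_mult mult.assoc matrix_vector_mul_assoc)
  qed
next
  \<comment> \<open>The induction passes through singular matrices, hence the premise on the
    determinant inside the claim.\<close>
  case (2 A i)
  then show ?case using det_zero_row[of i A] by simp
next
  case (3 A)
  show ?case
  proof (intro ballI impI)
    fix f :: "real^'n \<Rightarrow> ennreal" assume f[measurable]: "f \<in> borel_measurable borel" and det: "det A \<noteq> 0"
    have dA: "det A = (\<Prod>i\<in>UNIV. A $ i $ i)" by (rule det_diagonal[OF 3])
    then have nz: "A $ i $ i \<noteq> 0" for i using det by (simp add: prod_zero_iff)
    \<comment> \<open>\<open>lborel_affine_euclidean\<close> scales along basis vectors, so the
      diagonal entries are reindexed by them.\<close>
    define c where "c b = A $ (THE i. b = axis i 1) $ (THE i. b = axis i (1::real))" for b :: "real^'n"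
    have c: "c (axis i 1) = A $ i $ i" for i
      by (simp add: c_def axis_eq_axis)
    have Av: "A *v x = 0 + (\<Sum>j\<in>Basis. (c j * (x \<bullet> j)) *\<^sub>R j)" for x
    proof (rule vec_eq_iff[THEN iffD2], rule allI)
      fix i
      have "(A *v x) $ i = (\<Sum>j\<in>UNIV. if j = i then A $ i $ i * x $ i else 0)"
      proof -
        have "A $ i $ j * x $ j = (if j = i then A $ i $ i * x $ i else 0)" for j
          using 3[of i j] by auto
        then show ?thesis unfolding matrix_vector_mult_def vec_lambda_beta by (intro sum.cong refl)
      qed
      also have "\<dots> = c (axis i 1) * (x \<bullet> axis i 1)"
        by (simp add: c inner_axis)
      also have "\<dots> = (\<Sum>j\<in>Basis. (c j * (x \<bullet> j)) *\<^sub>R j) \<bullet> axis i 1"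
        by (subst inner_sum_left_Basis) (auto simp: axis_in_Basis_iff)
      finally show "(A *v x) $ i = (0 + (\<Sum>j\<in>Basis. (c j * (x \<bullet> j)) *\<^sub>R j)) $ i"
        by (simp add: inner_axis)
    qed
    have "lborel = density (distr lborel borel (\<lambda>x. A *v x)) (\<lambda>_. (\<Prod>j\<in>Basis. \<bar>c j\<bar>))"
      unfolding Av by (rule lborel_affine_euclidean) (auto simp: Basis_vec_def c nz)
    also have "(\<Prod>j\<in>Basis. \<bar>c j\<bar>) = \<bar>det A\<bar>"
      by (simp add: prod_Basis_vec c dA abs_prod)
    finally have "(\<integral>\<^sup>+x. f x \<partial>lborel) = (\<integral>\<^sup>+x. f x \<partial>density (distr lborel borel (\<lambda>x. A *v x)) (\<lambda>_. ennreal \<bar>det A\<bar>))"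
      by (rule arg_cong)
    also have "\<dots> = ennreal \<bar>det A\<bar> * (\<integral>\<^sup>+x. f (A *v x) \<partial>lborel)"
      using matrix_measurable[of A] measurable_compose[OF matrix_measurable[of A] f]
      by (simp add: nn_integral_density nn_integral_distr nn_integral_cmult)
    finally show "(\<integral>\<^sup>+x. f x \<partial>lborel) = ennreal \<bar>det A\<bar> * (\<integral>\<^sup>+x. f (A *v x) \<partial>lborel)" .
  qed
next
  case (4 m n)
  let ?p = "Transposition.transpose m n"
  have p: "?p permutes UNIV" by (rule permutes_swap_id) auto
  let ?A = "\<chi> i j. mat 1 $ i $ ?p j :: real^'n^'n"
  have "det ?A = of_int (sign ?p)"
    using det_permute_columns[OF p, of "mat 1 :: real^'n^'n"] by simp
  then have det: "\<bar>det ?A\<bar> = 1" by (simp add: sign_def)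
  have Av: "?A *v x = (\<chi> i. x $ ?p i)" for x
  proof (rule vec_eq_iff[THEN iffD2], rule allI)
    fix i
    have "i = ?p j \<longleftrightarrow> j = ?p i" for j by (metis transpose_involutory)
    then have "mat 1 $ i $ ?p j * x $ j = (if j = ?p i then x $ ?p i else 0)" for j
      by (auto simp: mat_def)
    then have "(?A *v x) $ i = (\<Sum>j\<in>UNIV. if j = ?p i then x $ ?p i else 0)"
      unfolding matrix_vector_mult_def vec_lambda_beta by (intro sum.cong refl)
    then show "(?A *v x) $ i = (\<chi> i. x $ ?p i) $ i" by simp
  qed
  show ?case
  proof (intro ballI impI)
    fix f :: "real^'n \<Rightarrow> ennreal" assume f: "f \<in> borel_measurable borel"
    have "(\<integral>\<^sup>+x. f x \<partial>lborel) = (\<integral>\<^sup>+x. f x \<partial>distr lborel borel (\<lambda>x::real^'n. \<chi> i. x $ ?p i))"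
      unfolding distr_lborel_permute[OF p] ..
    also have "\<dots> = (\<integral>\<^sup>+x. f (\<chi> i. x $ ?p i) \<partial>lborel)"
      using f by (intro nn_integral_distr) (auto intro!: borel_measurable_continuous_onI continuous_on_vec_lambda continuous_intros)
    finally show "(\<integral>\<^sup>+x. f x \<partial>lborel) = ennreal \<bar>det ?A\<bar> * (\<integral>\<^sup>+x. f (?A *v x) \<partial>lborel)"
      unfolding det Av by simp
  qed
next
  case (5 m n)
  let ?A = "\<chi> i j. of_bool (i = m \<and> j = n \<or> i = j) :: real^'n^'n"
  have "?A = (\<chi> k. if k = m then row m (mat 1) + 1 *s row n (mat 1) else row k (mat 1))"
    using 5 by (auto simp: vec_eq_iff row_def mat_def)
  then have det: "det ?A = 1"
    using det_row_operation[OF 5, of "mat 1 :: real^'n^'n" 1] by simp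
  have Av: "?A *v x = x + (x \<bullet> axis n 1) *\<^sub>R axis m 1" for x
  proof (rule vec_eq_iff[THEN iffD2], rule allI)
    fix i
    have "of_bool (i = m \<and> j = n \<or> i = j) * x $ j
        = (if j = i then x $ i else 0) + (if j = n then (if i = m then x $ n else 0) else 0)" for j
      using 5 by auto
    then have "(?A *v x) $ i = (\<Sum>j\<in>UNIV. (if j = i then x $ i else 0) + (if j = n then (if i = m then x $ n else 0) else 0))"
      unfolding matrix_vector_mult_def vec_lambda_beta by (intro sum.cong refl)
    also have "\<dots> = x $ i + (if i = m then x $ n else 0)"
      by (simp add: sum.distrib)
    finally show "(?A *v x) $ i = (x + (x \<bullet> axis n 1) *\<^sub>R axis m 1) $ i"
      by (simp only: vector_add_component vector_scaleR_component inner_axis) (simp add: axis_def)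
  qed
  show ?case
  proof (intro ballI impI)
    fix f :: "real^'n \<Rightarrow> ennreal" assume f: "f \<in> borel_measurable borel"
    show "(\<integral>\<^sup>+x. f x \<partial>lborel) = ennreal \<bar>det ?A\<bar> * (\<integral>\<^sup>+x. f (?A *v x) \<partial>lborel)"
      unfolding det Av using nn_integral_shear[OF f, of "axis m 1" "axis n 1"] 5
      by (simp add: axis_in_Basis_iff axis_eq_axis)
  qed
qed

subsection \<open>Reduction to the cone problem\<close>

lemma (in standard_brownian_motion) gaussian_walk_drift:
  "gaussian_walk M (\<lambda>t \<omega>. B t \<omega> - t *\<^sub>R \<nu>) \<nu>"
proof
  show "(\<lambda>\<omega>. B t \<omega> - t *\<^sub>R \<nu>) \<in> borel_measurable M" if "0 \<le> t" for t
    using measurable_B[OF that] by measurable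
  show "B 0 \<omega> - 0 *\<^sub>R \<nu> = 0" if "\<omega> \<in> space M" for \<omega>
    using at_zero[OF that] by simp
  show "continuous_on {0..} (\<lambda>t. B t \<omega> - t *\<^sub>R \<nu>)" if "\<omega> \<in> space M" for \<omega>
    by (intro continuous_intros continuous_path that)
  show "distr M borel (\<lambda>\<omega>. B t \<omega> - t *\<^sub>R \<nu>) = density lborel (\<lambda>y. ennreal (gauss t (y + t *\<^sub>R \<nu>)))" if t: "0 < t" for t
  proof -
    have BM: "B t \<in> borel_measurable M" using t by (intro measurable_B) simp
    have "density lborel (\<lambda>y. ennreal (gauss t (y + t *\<^sub>R \<nu>)))
        = density (distr lborel borel ((+) (- (t *\<^sub>R \<nu>)))) (\<lambda>y. ennreal (gauss t (y + t *\<^sub>R \<nu>)))"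
      by (simp add: lborel_distr_plus)
    also have "\<dots> = distr (density lborel (\<lambda>x. ennreal (gauss t (- (t *\<^sub>R \<nu>) + x + t *\<^sub>R \<nu>)))) borel ((+) (- (t *\<^sub>R \<nu>)))"
      by (rule density_distr) measurable
    also have "\<dots> = distr (distr M borel (B t)) borel ((+) (- (t *\<^sub>R \<nu>)))"
      by (simp add: distr_B[OF t])
    also have "\<dots> = distr M borel (\<lambda>\<omega>. B t \<omega> - t *\<^sub>R \<nu>)"
      using BM by (subst distr_distr) (auto simp: o_def)
    finally show ?thesis ..
  qed
  fix h :: real and K :: nat and F :: "(nat \<Rightarrow> real^'n) \<Rightarrow> ennreal"
  assume h: "0 < h" and F: "F \<in> borel_measurable (PiM (UNIV::nat set) (\<lambda>_. borel))"
  let ?S = "PiM (UNIV::nat set) (\<lambda>_. borel :: (real^'n) measure)"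
  have BM: "B (real i * h) \<in> borel_measurable M" for i using h by (intro measurable_B) simp
  \<comment> \<open>The deterministic drift is put into the functional so that the Markov property
    of \<open>B\<close> applies; afterwards it is split at index \<open>K\<close> and returned to
    the two pieces.\<close>
  have sh: "(\<lambda>x i. x i - (real (k + i) * h) *\<^sub>R \<nu>) \<in> measurable ?S ?S" for k
    by (rule measurable_PiM_single') auto
  have Fk: "(\<lambda>x. F (\<lambda>i. x i - (real (k + i) * h) *\<^sub>R \<nu>)) \<in> borel_measurable ?S" for k
    by (rule measurable_compose[OF sh F])
  have meas: "(\<lambda>y. \<integral>\<^sup>+\<omega>. F (\<lambda>i. y + B (real i * h) \<omega> - (real (k + i) * h) *\<^sub>R \<nu>) \<partial>M) \<in> borel_measurable borel" for k
  proof -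
    have p: "(\<lambda>p i. fst p + B (real i * h) (snd p)) \<in> measurable (borel \<Otimes>\<^sub>M M) ?S"
      using BM by (intro measurable_PiM_single') auto
    show ?thesis
      using measurable_compose[OF p Fk[of k]] by (intro borel_measurable_nn_integral) (simp add: split_beta')
  qed
  have "(\<integral>\<^sup>+\<omega>. F (\<lambda>i. B (real (K + i) * h) \<omega> - (real (K + i) * h) *\<^sub>R \<nu>) \<partial>M)
      = (\<integral>\<^sup>+y. (\<integral>\<^sup>+\<omega>. F (\<lambda>i. y + B (real i * h) \<omega> - (real (K + i) * h) *\<^sub>R \<nu>) \<partial>M) \<partial>distr M borel (B (real K * h)))"
    by (rule markov_grid[OF h Fk])
  also have "\<dots> = (\<integral>\<^sup>+\<omega>'. (\<integral>\<^sup>+\<omega>. F (\<lambda>i. B (real K * h) \<omega>' + B (real i * h) \<omega> - (real (K + i) * h) *\<^sub>R \<nu>) \<partial>M) \<partial>M)"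
    by (rule nn_integral_distr[OF BM]) (use meas[of K] in simp)
  also have "\<dots> = (\<integral>\<^sup>+\<omega>'. (\<integral>\<^sup>+\<omega>. F (\<lambda>i. (B (real K * h) \<omega>' - (real K * h) *\<^sub>R \<nu>) + (B (real i * h) \<omega> - (real i * h) *\<^sub>R \<nu>)) \<partial>M) \<partial>M)"
  proof -
    have "b + c - (real (K + i) * h) *\<^sub>R \<nu> = (b - (real K * h) *\<^sub>R \<nu>) + (c - (real i * h) *\<^sub>R \<nu>)" for b c i
      by (simp add: distrib_right scaleR_add_left)
    then show ?thesis by (simp only:)
  qed
  also have "\<dots> = (\<integral>\<^sup>+y. (\<integral>\<^sup>+\<omega>. F (\<lambda>i. y + (B (real i * h) \<omega> - (real i * h) *\<^sub>R \<nu>)) \<partial>M) \<partial>distr M borel (\<lambda>\<omega>. B (real K * h) \<omega> - (real K * h) *\<^sub>R \<nu>))"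
  proof -
    have W: "(\<lambda>\<omega>. B (real K * h) \<omega> - (real K * h) *\<^sub>R \<nu>) \<in> borel_measurable M"
      using BM by measurable
    have "(\<lambda>y. \<integral>\<^sup>+\<omega>. F (\<lambda>i. y + (B (real i * h) \<omega> - (real i * h) *\<^sub>R \<nu>)) \<partial>M) \<in> borel_measurable borel"
      using meas[of 0] by (simp add: add_diff_eq)
    then show ?thesis
      by (subst nn_integral_distr[OF W]) auto
  qed
  finally show "(\<integral>\<^sup>+\<omega>. F (\<lambda>i. B (real (K + i) * h) \<omega> - (real (K + i) * h) *\<^sub>R \<nu>) \<partial>M)
      = (\<integral>\<^sup>+y. (\<integral>\<^sup>+\<omega>. F (\<lambda>i. y + (B (real i * h) \<omega> - (real i * h) *\<^sub>R \<nu>)) \<partial>M) \<partial>distr M borel (\<lambda>\<omega>. B (real K * h) \<omega> - (real K * h) *\<^sub>R \<nu>))" .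
qed

section \<open>Linear algebra of the covariance, the cone and the constants\<close>

lemma matrix_inv_mult:
  fixes A :: "real^'n^'n"
  assumes "invertible A"
  shows "A ** matrix_inv A = mat 1" "matrix_inv A ** A = mat 1"
  using someI_ex[OF assms[unfolded invertible_def]] by (simp_all add: matrix_inv_def)

lemma matrix_inv_vec:
  fixes A :: "real^'n^'n"
  assumes "invertible A"
  shows "A *v (matrix_inv A *v x) = x" "matrix_inv A *v (A *v x) = x"
  using matrix_inv_mult[OF assms] by (simp_all add: matrix_vector_mul_assoc)

lemma inner_transpose: "(transpose A *v c) \<bullet> y = c \<bullet> (A *v y)" for A :: "real^'n^'m"
  by (simp add: dot_lmul_matrix)

text \<open>The inverse of A A^T is A^-T A^-1, so products weighted by \<Sigma>^-1 are Euclidean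
  products after applying A^-1.\<close>

lemma matrix_inv_gram:
  fixes A :: "real^'n^'n"
  assumes A: "invertible A"
  shows "x \<bullet> (matrix_inv (A ** transpose A) *v y) = (matrix_inv A *v x) \<bullet> (matrix_inv A *v y)"
    and "transpose A *v (matrix_inv (A ** transpose A) *v y) = matrix_inv A *v y"
proof -
  let ?G = "A ** transpose A"
  let ?y = "matrix_inv ?G *v y"
  have inv: "invertible ?G" using A by (intro invertible_mult transpose_invertible)
  have "A *v (transpose A *v ?y) = ?G *v ?y" by (rule matrix_vector_mul_assoc)
  also have "\<dots> = y" by (rule matrix_inv_vec(1)[OF inv])
  finally have G: "A *v (transpose A *v ?y) = y" .
  show 2: "transpose A *v ?y = matrix_inv A *v y"
    using matrix_inv_vec(2)[OF A, of "transpose A *v ?y"] unfolding G by (rule sym)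
  have "x \<bullet> ?y = (A *v (matrix_inv A *v x)) \<bullet> ?y"
    by (simp only: matrix_inv_vec(1)[OF A])
  also have "\<dots> = (matrix_inv A *v x) \<bullet> (transpose A *v ?y)"
    using inner_transpose[of A ?y "matrix_inv A *v x"] by (simp only: inner_commute)
  finally show "x \<bullet> ?y = (matrix_inv A *v x) \<bullet> (matrix_inv A *v y)" by (simp only: 2)
qed

text \<open>Where all coordinates of \<open>A *v y\<close> are positive, its product with
  \<open>c\<close> is at least the smallest \<open>c $ i\<close> times its l1 norm, and
  \<open>norm y\<close> is at most a constant times \<open>norm (A *v y)\<close>.\<close>

lemma orthant_preimage_cone:
  fixes A :: "real^'n^'n" and c :: "real^'n"
  assumes A: "invertible A" and c: "0 \<lless> c"
  shows "open {y. 0 \<lless> A *v y}" "{y. 0 \<lless> A *v y} \<noteq> {}"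
    "\<exists>\<epsilon>>0. \<forall>y\<in>{y. 0 \<lless> A *v y}. \<epsilon> * norm y \<le> (transpose A *v c) \<bullet> y"
proof -
  have "{y. 0 \<lless> A *v y} = (\<Inter>i. {y. 0 < (A *v y) $ i})" by (auto simp: vless_def)
  also have "open \<dots>"
    by (intro open_INT finite ballI open_Collect_less continuous_intros
        bounded_linear.continuous_on[OF bounded_linear_compose[OF bounded_linear_vec_nth matrix_vector_mul_bounded_linear]])
  finally show "open {y. 0 \<lless> A *v y}" .
  have "A *v (matrix_inv A *v 1) = 1"
    by (rule matrix_inv_vec(1)[OF A])
  then show "{y. 0 \<lless> A *v y} \<noteq> {}" by (auto simp: vless_def intro!: exI[of _ "matrix_inv A *v 1"])
  obtain K where K: "K > 0" "\<And>x. norm (matrix_inv A *v x) \<le> norm x * K"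
    using bounded_linear.pos_bounded[OF matrix_vector_mul_bounded_linear[of "matrix_inv A"]] by blast
  define m where "m = Min (range (\<lambda>i. c $ i))"
  have m: "0 < m" "\<And>i. m \<le> c $ i" using c by (auto simp: m_def vless_def)
  have "m / K * norm y \<le> (transpose A *v c) \<bullet> y" if y: "0 \<lless> A *v y" for y
  proof -
    have "matrix_inv A *v (A *v y) = y"
      by (rule matrix_inv_vec(2)[OF A])
    then have "norm y \<le> norm (A *v y) * K" using K(2)[of "A *v y"] by simp
    then have "m / K * norm y \<le> m * norm (A *v y)"
      using K(1) m(1) by (simp add: field_simps)
    also have "norm (A *v y) \<le> (\<Sum>i\<in>UNIV. \<bar>(A *v y) $ i\<bar>)" by (rule norm_le_l1_cart)
    also have "m * (\<Sum>i\<in>UNIV. \<bar>(A *v y) $ i\<bar>) = (\<Sum>i\<in>UNIV. m * (A *v y) $ i)"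
      using y by (simp add: sum_distrib_left vless_def less_imp_le)
    also have "\<dots> \<le> (\<Sum>i\<in>UNIV. c $ i * (A *v y) $ i)"
      using y m by (intro sum_mono mult_right_mono) (auto simp: vless_def less_imp_le)
    also have "\<dots> = c \<bullet> (A *v y)" by (simp add: inner_vec_def)
    also have "\<dots> = (transpose A *v c) \<bullet> y"
      by (rule inner_transpose[symmetric])
    finally show ?thesis using m(1) by simp
  qed
  then show "\<exists>\<epsilon>>0. \<forall>y\<in>{y. 0 \<lless> A *v y}. \<epsilon> * norm y \<le> (transpose A *v c) \<bullet> y"
    using m(1) K(1) by (intro exI[of _ "m / K"]) auto
qed

lemma ereal_standardize_le_iff:
  assumes "0 < r"
  shows "(\<tau> - ereal a) / ereal r \<le> ereal s \<longleftrightarrow> \<tau> \<le> ereal (a + r * s)"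
  using assms by (cases \<tau>) (auto simp: field_simps)

lemma nn_integral_invertible:
  fixes A :: "real^'n^'n"
  assumes "invertible A" and "f \<in> borel_measurable borel"
  shows "(\<integral>\<^sup>+x. f x \<partial>lborel) = ennreal \<bar>det A\<bar> * (\<integral>\<^sup>+x. f (A *v x) \<partial>lborel)"
  using nn_integral_matrix[of A] assms unfolding invertible_det_nz by blast

lemma nn_integral_lborel_uminus:
  fixes f :: "'b::euclidean_space \<Rightarrow> ennreal"
  assumes [measurable]: "f \<in> borel_measurable borel"
  shows "(\<integral>\<^sup>+x. f x \<partial>lborel) = (\<integral>\<^sup>+x. f (- x) \<partial>lborel)"
  by (subst lborel_affine[of "-1" 0]) (simp_all add: nn_integral_density nn_integral_distr)

lemma powr_neg_half:
  assumes "0 < x"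
  shows "x powr (- real e / 2) = 1 / sqrt x ^ e"
proof -
  have "sqrt x ^ e = (x powr (1 / 2)) powr real e"
    using assms by (simp add: powr_half_sqrt powr_realpow)
  also have "\<dots> = x powr (real e / 2)" by (simp add: powr_powr)
  finally show ?thesis by (simp add: powr_minus_divide)
qed

text \<open>Here \<open>t0 * n\<close> stands for the root of \<alpha>^T \<Sigma>^-1 \<alpha> and
  \<open>a\<close> for \<open>det A\<close>. The square of \<open>t0\<close> lifts the exponent
  \<open>d - 3\<close>, negative for \<open>d = 2\<close>, to \<open>d - 1\<close>.\<close>

lemma prefactor_eq:
  fixes t0 n j a :: real and d :: nat
  assumes "0 < t0" "0 < n" "a \<noteq> 0" "1 \<le> d"
  shows "(2 * pi) powr ((1 - real d) / 2) * (\<bar>a\<bar> * j) / sqrt (t0 powi (int d - 3) * (t0 * n)\<^sup>2 * a\<^sup>2)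
    = j * ((1 / sqrt (2 * pi * t0)) ^ d * (sqrt t0 / n * sqrt (2 * pi)))"
proof -
  obtain e where d: "d = Suc e" using assms(4) by (cases d) auto
  have "t0 powi (int d - 3) * t0\<^sup>2 = t0 powi (int d - 3 + 2)"
    using assms(1) by (subst power_int_add) auto
  also have "int d - 3 + 2 = int e" using d by simp
  finally have p: "t0 powi (int d - 3) * t0\<^sup>2 = t0 ^ e" by simp
  have "t0 powi (int d - 3) * (t0 * n)\<^sup>2 * a\<^sup>2 = (t0 powi (int d - 3) * t0\<^sup>2) * n\<^sup>2 * a\<^sup>2"
    by (simp add: power_mult_distrib)
  then have "sqrt (t0 powi (int d - 3) * (t0 * n)\<^sup>2 * a\<^sup>2) = sqrt t0 ^ e * n * \<bar>a\<bar>"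
    using assms by (simp add: p real_sqrt_mult real_sqrt_power[of t0 e])
  moreover have "(2 * pi) powr ((1 - real d) / 2) = 1 / sqrt (2 * pi) ^ e"
    using powr_neg_half[of "2 * pi" e] d by simp
  ultimately have "(2 * pi) powr ((1 - real d) / 2) * (\<bar>a\<bar> * j) / sqrt (t0 powi (int d - 3) * (t0 * n)\<^sup>2 * a\<^sup>2)
      = j / (sqrt (2 * pi) ^ e * sqrt t0 ^ e * n)"
    using assms by simp
  also have "\<dots> = j * ((1 / sqrt (2 * pi * t0)) ^ d * (sqrt t0 / n * sqrt (2 * pi)))"
    using assms by (simp add: d real_sqrt_mult power_mult_distrib field_simps)
  finally show ?thesis .
qed

theorem corollary3p7:
  fixes M :: "'a measure"
    and B X :: "real \<Rightarrow> 'a \<Rightarrow> real^'n"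
    and A \<Sigma> :: "real^'n^'n"
    and \<alpha> \<mu> b :: "real^'n"
    and t0 :: real
    and P :: "real \<Rightarrow> real"
    and \<tau> :: "real \<Rightarrow> 'a \<Rightarrow> ereal"
    and H :: ennreal
  assumes dim: "2 \<le> CARD('n)"
    and A: "invertible A"
    and \<Sigma>: "\<Sigma> = A ** transpose A"
    and B: "standard_brownian_motion M B"
    and X: "X = (\<lambda>t \<omega>. A *v B t \<omega>)"
    and \<alpha>: "0 \<lless> matrix_inv \<Sigma> *v \<alpha>"
    and \<mu>: "0 \<lless> matrix_inv \<Sigma> *v \<mu>"
    and pos: "\<exists>i. 0 < \<alpha> $ i \<and> 0 < \<mu> $ i"
    and P: "P = (\<lambda>u. \<P>(\<omega> in M. \<exists>t\<ge>0. u *\<^sub>R \<alpha> \<lless> X t \<omega> - t *\<^sub>R \<mu>))"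
    and \<tau>: "\<tau> = (\<lambda>u. hitting_time X \<mu> (u *\<^sub>R \<alpha>))"
    and t0: "t0 = sqrt ((\<alpha> \<bullet> (matrix_inv \<Sigma> *v \<alpha>)) / (\<mu> \<bullet> (matrix_inv \<Sigma> *v \<mu>)))"
    and b: "b = \<alpha> + t0 *\<^sub>R \<mu>"
    and H: "H = Lim at_top (\<lambda>T.
      exp_hitting_integral M X \<mu> ((1 / t0) *\<^sub>R (matrix_inv \<Sigma> *v b)) T / ennreal T)"
  shows
    "((\<lambda>T. exp_hitting_integral M X \<mu> ((1 / t0) *\<^sub>R (matrix_inv \<Sigma> *v b)) T / ennreal T)
        \<longlongrightarrow> H) at_top \<and>
     ((\<lambda>u. P u /
        ((2 * pi) powr ((1 - real CARD('n)) / 2) * enn2real H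
          / sqrt (t0 powi (int CARD('n) - 3) * (\<alpha> \<bullet> (matrix_inv \<Sigma> *v \<alpha>)) * det \<Sigma>)
          * u powr ((1 - real CARD('n)) / 2)
          * exp (- ((b \<bullet> (matrix_inv \<Sigma> *v b)) / (2 * t0)) * u))) \<longlongrightarrow> 1) at_top \<and>
     (\<forall>s. ((\<lambda>u. \<P>(\<omega> in M.
          (\<tau> u \<omega> - ereal (t0 * u))
            / ereal (sqrt (t0 ^ 3 * inverse (\<alpha> \<bullet> (matrix_inv \<Sigma> *v \<alpha>)) * u)) \<le> ereal s
          \<bar> \<tau> u \<omega> < \<infinity>)) \<longlongrightarrow> cdf std_normal_distribution s) at_top)"
proof -
  interpret BM: standard_brownian_motion M B by (rule B)
  define N where "N = matrix_inv A"
  define \<beta> where "\<beta> = N *v \<alpha>"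
  define \<nu> where "\<nu> = N *v \<mu>"
  define v where "v = (1 / t0) *\<^sub>R \<beta>"
  define \<gamma> where "\<gamma> = v + \<nu>"
  \<comment> \<open>The exponent vector in the integral behind \<open>H\<close>. Pulled back by
    \<open>A\<close> it becomes \<open>\<gamma>\<close>, and its positive coordinates, which combine
    the sign conditions on \<alpha> and \<mu>, yield the cone condition.\<close>
  define c where "c = (1 / t0) *\<^sub>R (matrix_inv \<Sigma> *v b)"
  define C where "C = {y. 0 \<lless> A *v y}"
  have gram: "x \<bullet> (matrix_inv \<Sigma> *v y) = (N *v x) \<bullet> (N *v y)" "transpose A *v (matrix_inv \<Sigma> *v y) = N *v y" for x y
    unfolding \<Sigma> N_def using matrix_inv_gram[OF A] by auto
  have AN: "A *v (N *v x) = x" for x unfolding N_def by (rule matrix_inv_vec(1)[OF A])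
  have ne: "N *v x \<noteq> 0" if "0 \<lless> matrix_inv \<Sigma> *v x" for x
  proof
    assume "N *v x = 0"
    then have "x = 0" using AN[of x] by simp
    then show False using that by (simp add: vless_def)
  qed
  have \<beta>0: "\<beta> \<noteq> 0" and \<nu>0: "\<nu> \<noteq> 0"
    using ne[OF \<alpha>] ne[OF \<mu>] by (simp_all add: \<beta>_def \<nu>_def)
  have t0_eq: "t0 = norm \<beta> / norm \<nu>"
    unfolding t0 gram(1) \<beta>_def[symmetric] \<nu>_def[symmetric] by (simp add: real_sqrt_divide norm_eq_sqrt_inner)
  have t0_pos: "0 < t0" using \<beta>0 \<nu>0 by (simp add: t0_eq)
  have \<beta>_eq: "\<beta> = t0 *\<^sub>R v" using t0_pos by (simp add: v_def)
  have norm_v: "norm v = norm \<nu>" using t0_pos \<beta>0 by (simp add: v_def t0_eq)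
  have v0: "v \<noteq> 0" using norm_v \<nu>0 by auto
  have Nb: "N *v b = t0 *\<^sub>R \<gamma>"
    unfolding b \<gamma>_def by (simp add: matrix_vector_right_distrib matrix_vector_mult_scaleR \<beta>_def[symmetric] \<nu>_def[symmetric] \<beta>_eq scaleR_add_right)
  have Ac: "transpose A *v c = \<gamma>"
    unfolding c_def matrix_vector_mult_scaleR gram(2) Nb using t0_pos by simp
  have c_pos: "0 \<lless> c"
    using \<alpha> \<mu> t0_pos unfolding c_def b vless_def
    by (simp add: matrix_vector_right_distrib matrix_vector_mult_scaleR add_pos_pos)
  obtain \<epsilon> where \<epsilon>: "\<epsilon> > 0" "\<And>y. y \<in> C \<Longrightarrow> \<epsilon> * norm y \<le> \<gamma> \<bullet> y"
    using orthant_preimage_cone(3)[OF A c_pos] unfolding Ac C_def by blast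
  interpret G: gaussian_walk M "\<lambda>t \<omega>. B t \<omega> - t *\<^sub>R \<nu>" \<nu>
    by (rule BM.gaussian_walk_drift)
  interpret cone_hitting M "\<lambda>t \<omega>. B t \<omega> - t *\<^sub>R \<nu>" \<nu> C v \<gamma> \<epsilon>
    using orthant_preimage_cone(1,2)[OF A c_pos] \<epsilon> norm_v v0
    by unfold_locales (simp_all add: C_def \<gamma>_def)
  \<comment> \<open>Subtracting the level turns the crossing of a variable level into a visit to a
    fixed cone from a variable start.\<close>
  have hit_iff: "x \<lless> X t \<omega> - t *\<^sub>R \<mu> \<longleftrightarrow> - (N *v x) + (B t \<omega> - t *\<^sub>R \<nu>) \<in> C" for x t \<omega>
  proof -
    have "A *v (B t \<omega> - t *\<^sub>R \<nu> - N *v x) = X t \<omega> - t *\<^sub>R \<mu> - x"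
      by (simp only: X \<nu>_def matrix_vector_mult_diff_distrib matrix_vector_mult_scaleR AN)
    moreover have "- (N *v x) + (B t \<omega> - t *\<^sub>R \<nu>) = B t \<omega> - t *\<^sub>R \<nu> - N *v x" by simp
    ultimately have "A *v (- (N *v x) + (B t \<omega> - t *\<^sub>R \<nu>)) = X t \<omega> - t *\<^sub>R \<mu> - x" by metis
    then show ?thesis by (simp add: C_def vless_def)
  qed
  have EHI: "exp_hitting_integral M X \<mu> c T
      = ennreal \<bar>det A\<bar> * (\<integral>\<^sup>+z. ennreal (exp (- (\<gamma> \<bullet> z)) * Psi 0 T z) \<partial>lborel)" for T
  proof -
    have meas: "(\<lambda>x. ennreal (exp (x \<bullet> c) * Psi 0 T (- (N *v x)))) \<in> borel_measurable borel"
    proof -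
      have n: "(\<lambda>x. - (N *v x)) \<in> measurable borel borel"
        by (intro borel_measurable_continuous_onI continuous_on_minus linear_continuous_on matrix_vector_mul_bounded_linear)
      have "(\<lambda>x. Psi 0 T (- (N *v x))) \<in> borel_measurable borel"
        by (rule measurable_compose[OF n measurable_Psi[OF order_refl]])
      moreover have "(\<lambda>x. exp (x \<bullet> c)) \<in> borel_measurable borel" by measurable
      ultimately have "(\<lambda>x. exp (x \<bullet> c) * Psi 0 T (- (N *v x))) \<in> borel_measurable borel"
        by (rule borel_measurable_times[rotated])
      from measurable_compose[OF this measurable_ennreal] show ?thesis .
    qed
    have "exp_hitting_integral M X \<mu> c T = (\<integral>\<^sup>+x. ennreal (exp (x \<bullet> c) * Psi 0 T (- (N *v x))) \<partial>lborel)"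
      unfolding exp_hitting_integral_def hit_iff Psi_def ..
    also have "\<dots> = ennreal \<bar>det A\<bar> * (\<integral>\<^sup>+y. ennreal (exp ((A *v y) \<bullet> c) * Psi 0 T (- (N *v (A *v y)))) \<partial>lborel)"
      by (rule nn_integral_invertible[OF A meas])
    also have "(\<integral>\<^sup>+y. ennreal (exp ((A *v y) \<bullet> c) * Psi 0 T (- (N *v (A *v y)))) \<partial>lborel)
        = (\<integral>\<^sup>+y. ennreal (exp (\<gamma> \<bullet> y) * Psi 0 T (- y)) \<partial>lborel)"
    proof -
      have "(A *v y) \<bullet> c = \<gamma> \<bullet> y" for y
        using inner_transpose[of A c y] inner_commute[of "A *v y" c] unfolding Ac by (rule trans[OF _ sym, rotated])
      moreover have "N *v (A *v y) = y" for y unfolding N_def by (rule matrix_inv_vec(2)[OF A])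
      ultimately show ?thesis by (simp only:)
    qed
    \<comment> \<open>The start is minus the level; reflection turns the weight
      \<open>exp (\<gamma> \<bullet> y)\<close> into the invariant one.\<close>
    also have "\<dots> = (\<integral>\<^sup>+z. ennreal (exp (- (\<gamma> \<bullet> z)) * Psi 0 T z) \<partial>lborel)"
      by (subst nn_integral_lborel_uminus) simp_all
    finally show ?thesis .
  qed
  have H_lim: "((\<lambda>T. exp_hitting_integral M X \<mu> c T / ennreal T) \<longlongrightarrow> ennreal (\<bar>det A\<bar> * mass_inf)) at_top"
  proof -
    have "((\<lambda>T. ennreal \<bar>det A\<bar> * ((\<integral>\<^sup>+z. ennreal (exp (- (\<gamma> \<bullet> z)) * Psi 0 T z) \<partial>lborel) / ennreal T))
        \<longlongrightarrow> ennreal \<bar>det A\<bar> * ennreal mass_inf) at_top"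
      by (intro ennreal_tendsto_cmult tilted_mean_tendsto) simp
    then show ?thesis
      using mass_nonneg by (simp add: EHI ennreal_times_divide ennreal_mult)
  qed
  \<comment> \<open>\<open>Lim\<close> is meaningful only once convergence is known, and finiteness
    of the limit lets \<open>enn2real\<close> return the same number.\<close>
  have H_eq: "H = ennreal (\<bar>det A\<bar> * mass_inf)"
    unfolding H c_def[symmetric] by (rule tendsto_Lim[OF _ H_lim]) simp
  have P_eq: "P u = Pinf (- (t0 * u) *\<^sub>R v)" for u
  proof -
    have "- (N *v (u *\<^sub>R \<alpha>)) = - (t0 * u) *\<^sub>R v"
      by (simp add: matrix_vector_mult_scaleR \<beta>_def[symmetric] \<beta>_eq mult.commute)
    then show ?thesis by (simp only: P hit_iff Pinf_def)
  qed
  have \<alpha>\<alpha>: "\<alpha> \<bullet> (matrix_inv \<Sigma> *v \<alpha>) = (t0 * norm v)\<^sup>2"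
    unfolding gram(1) \<beta>_def[symmetric] \<beta>_eq by (simp add: power2_norm_eq_inner[symmetric] power_mult_distrib power2_eq_square)
  \<comment> \<open>Equal norms give
    \<open>\<gamma> \<bullet> \<gamma> = 2 * (\<gamma> \<bullet> v)\<close>, which identifies the
    exponent in the claim with that of \<open>scaled\<close>.\<close>
  have bb: "(b \<bullet> (matrix_inv \<Sigma> *v b)) / (2 * t0) = t0 * (\<gamma> \<bullet> v)"
  proof -
    have "v \<bullet> v = \<nu> \<bullet> \<nu>" using norm_v by (simp add: norm_eq)
    then have "\<gamma> \<bullet> \<gamma> = 2 * (\<gamma> \<bullet> v)"
      by (simp add: \<gamma>_def inner_add_left inner_add_right inner_commute)
    then show ?thesis
      unfolding gram(1) Nb using t0_pos by (simp add: field_simps)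
  qed
  have det: "det \<Sigma> = (det A)\<^sup>2"
    unfolding \<Sigma> by (simp add: det_mul det_transpose power2_eq_square)
  have P_asymp: "((\<lambda>u. P u /
        ((2 * pi) powr ((1 - real CARD('n)) / 2) * enn2real H
          / sqrt (t0 powi (int CARD('n) - 3) * (\<alpha> \<bullet> (matrix_inv \<Sigma> *v \<alpha>)) * det \<Sigma>)
          * u powr ((1 - real CARD('n)) / 2)
          * exp (- ((b \<bullet> (matrix_inv \<Sigma> *v b)) / (2 * t0)) * u))) \<longlongrightarrow> 1) at_top"
  proof -
    have "((\<lambda>u. scaled t0 u (Pinf (- (t0 * u) *\<^sub>R v)) / limit_const t0) \<longlongrightarrow> limit_const t0 / limit_const t0) at_top"
      using limit_const_pos[OF t0_pos] by (intro tendsto_divide Pinf_asymptotics t0_pos tendsto_const) simp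
    then have "((\<lambda>u. scaled t0 u (Pinf (- (t0 * u) *\<^sub>R v)) / limit_const t0) \<longlongrightarrow> 1) at_top"
      using limit_const_pos[OF t0_pos] by simp
    then show ?thesis
    proof (rule Lim_transform_eventually)
      have const: "(2 * pi) powr ((1 - real CARD('n)) / 2) * enn2real H
          / sqrt (t0 powi (int CARD('n) - 3) * (\<alpha> \<bullet> (matrix_inv \<Sigma> *v \<alpha>)) * det \<Sigma>) = limit_const t0"
      proof -
        have "enn2real H = \<bar>det A\<bar> * mass_inf" using mass_nonneg by (simp add: H_eq)
        then show ?thesis
          unfolding \<alpha>\<alpha> det limit_const_def using prefactor_eq[of t0 "norm v" "det A" "CARD('n)" mass_inf] t0_pos v0 A dim
          by (simp add: invertible_det_nz)
      qed
      show "eventually (\<lambda>u. scaled t0 u (Pinf (- (t0 * u) *\<^sub>R v)) / limit_const t0 = P u /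
        ((2 * pi) powr ((1 - real CARD('n)) / 2) * enn2real H
          / sqrt (t0 powi (int CARD('n) - 3) * (\<alpha> \<bullet> (matrix_inv \<Sigma> *v \<alpha>)) * det \<Sigma>)
          * u powr ((1 - real CARD('n)) / 2)
          * exp (- ((b \<bullet> (matrix_inv \<Sigma> *v b)) / (2 * t0)) * u))) at_top"
        using eventually_gt_at_top[of 0]
      proof eventually_elim
        case (elim u)
        have pw: "u powr ((1 - real CARD('n)) / 2) = 1 / sqrt u ^ (CARD('n) - 1)"
          using powr_neg_half[OF elim, of "CARD('n) - 1"] dim by (simp add: of_nat_diff)
        have ex: "exp (- ((b \<bullet> (matrix_inv \<Sigma> *v b)) / (2 * t0)) * u) = 1 / exp (t0 * u * (\<gamma> \<bullet> v))"
          unfolding bb by (simp add: exp_minus field_simps)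
        show ?case
          unfolding const pw ex P_eq by (simp add: field_simps)
      qed
    qed
  qed
  have \<tau>_asymp: "((\<lambda>u. \<P>(\<omega> in M.
          (\<tau> u \<omega> - ereal (t0 * u))
            / ereal (sqrt (t0 ^ 3 * inverse (\<alpha> \<bullet> (matrix_inv \<Sigma> *v \<alpha>)) * u)) \<le> ereal s
          \<bar> \<tau> u \<omega> < \<infinity>)) \<longlongrightarrow> cdf std_normal_distribution s) at_top" for s
    using hit_asymptotics[OF t0_pos, of s]
  proof (rule Lim_transform_eventually)
    show "eventually (\<lambda>u. measure M (hit (t0 * u + sqrt u * (s * (sqrt t0 / norm v))) (- (t0 * u) *\<^sub>R v)) / Pinf (- (t0 * u) *\<^sub>R v)
      = \<P>(\<omega> in M. (\<tau> u \<omega> - ereal (t0 * u))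
            / ereal (sqrt (t0 ^ 3 * inverse (\<alpha> \<bullet> (matrix_inv \<Sigma> *v \<alpha>)) * u)) \<le> ereal s
          \<bar> \<tau> u \<omega> < \<infinity>)) at_top"
      using eventually_gt_at_top[of 0]
    proof eventually_elim
      case (elim u)
      let ?z = "- (t0 * u) *\<^sub>R v"
      have "- (N *v (u *\<^sub>R \<alpha>)) = ?z"
        by (simp add: matrix_vector_mult_scaleR \<beta>_def[symmetric] \<beta>_eq mult.commute)
      then have \<tau>u: "\<tau> u \<omega> = Inf (ereal ` {t. 0 \<le> t \<and> ?z + (B t \<omega> - t *\<^sub>R \<nu>) \<in> C})" for \<omega>
        by (simp only: \<tau> hitting_time_def hit_iff)
      have sc: "sqrt (t0 ^ 3 * inverse (\<alpha> \<bullet> (matrix_inv \<Sigma> *v \<alpha>)) * u) = sqrt u * (sqrt t0 / norm v)"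
      proof -
        have "t0 ^ 3 * inverse ((t0 * norm v)\<^sup>2) * u = u * (t0 / (norm v)\<^sup>2)"
          using t0_pos v0 by (simp add: field_simps power2_eq_square power3_eq_cube)
        then show ?thesis unfolding \<alpha>\<alpha> by (simp add: real_sqrt_mult real_sqrt_divide)
      qed
      have sp: "0 < sqrt u * (sqrt t0 / norm v)" using elim t0_pos v0 by simp
      have fin: "\<tau> u \<omega> < \<infinity> \<longleftrightarrow> (\<exists>t\<ge>0. ?z + (B t \<omega> - t *\<^sub>R \<nu>) \<in> C)" for \<omega>
        unfolding \<tau>u Inf_less_iff by auto
      \<comment> \<open>A hitting time bounded by a real number is finite, so intersecting with the
        conditioning event changes nothing.\<close>
      have "{\<omega> \<in> space M. (\<tau> u \<omega> - ereal (t0 * u)) / ereal (sqrt (t0 ^ 3 * inverse (\<alpha> \<bullet> (matrix_inv \<Sigma> *v \<alpha>)) * u)) \<le> ereal s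
          \<and> \<tau> u \<omega> < \<infinity>} = hit (t0 * u + sqrt u * (s * (sqrt t0 / norm v))) ?z"
      proof -
        have "t0 * u + sqrt u * (sqrt t0 / norm v) * s = t0 * u + sqrt u * (s * (sqrt t0 / norm v))" by simp
        moreover have "\<tau> u \<omega> \<le> ereal x \<and> \<tau> u \<omega> < \<infinity> \<longleftrightarrow> \<tau> u \<omega> \<le> ereal x" for \<omega> x by auto
        ultimately show ?thesis
          unfolding sc ereal_standardize_le_iff[OF sp] hit_def \<tau>u[symmetric] by (simp only:)
      qed
      then show ?case
        unfolding cond_prob_def Pinf_def fin[symmetric] by (simp only:)
    qed
  qed
  show ?thesis
    using H_lim P_asymp \<tau>_asymp unfolding c_def[symmetric] H_eq by blast
qed

end
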